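(* The theory $V^0$ proves (the natural $\Sigma^B_0$-formalization of) the following statement, for all $n$: Let $B$ be a sequence of edges that form a closed curve, let $p_1,p_2$ be any two grid points on different sides of $B$, and let $R$ be a sequence of edges that connects $p_1$ and $p_2$. Then $R$ and $B$ intersect.
   Context: Grid setting: fix $n$. A grid point is a pair $(x,y)$ of integers with $0\le x,y\le n$, with coordinates $x(p),y(p)$; an edge is a pair of grid points differing by exactly 1 in exactly one coordinate. A sequence of edges forms a closed curve if it has the form $\langle q_0,q_1\rangle,\langle q_1,q_2\rangle,\ldots,\langle q_{t-2},q_{t-1}\rangle,\langle q_{t-1},q_0\rangle$ with $t\ge4$ and $q_0,\ldots,q_{t-1}$ distinct. A sequence of edges connects $p_1$ and $p_2$ if it has the form $\langle r_0,r_1\rangle,\ldots,\langle r_{s-1},r_s\rangle$ with $r_0=p_1$, $r_s=p_2$ and $r_0,\ldots,r_s$ distinct. For a set (or sequence) $E$ of edges, the $E$-degree of a point is the number of edges of $E$ incident to it. Two sets/sequences $E_1,E_2$ of edges intersect if some grid point has $E_1$-degree $\ge1$ and $E_2$-degree $\ge1$. Points $p_1,p_2$ are on different sides of $E$ if $x(p_1)=x(p_2)$, $|y(p_1)-y(p_2)|=2$, both have $E$-degree $0$, and the point $p$ with $x(p)=x(p_1)$, $y(p)=\frac12(y(p_1)+y(p_2))$ has $E$-degree $2$. $V^0$ is the two-sorted first-order theory (sorts: natural numbers and finite subsets of $\mathbb N$) over vocabulary $0,1,+,\cdot,\le,=,|X|,\in$, axiomatized by the basic axioms 2-BASIC plus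 the comprehension scheme $\exists X\le y\,\forall z<y\,(X(z)\leftrightarrow\varphi(z))$ for $\Sigma^B_0$ formulas $\varphi$ (bounded number quantifiers, no set quantifiers) not containing $X$. Points, edges and sequences are coded by numbers/finite sets via pairing. *)

theory Defs
  imports Main
begin

section \<open>Two-sorted first-order logic over the vocabulary of bounded arithmetic\<close>

text \<open>
  Variables of both sorts are de Bruijn indices, with separate index spaces for numbers and sets:
  a number quantifier shifts only number indices, a set quantifier only set indices.
  The only set terms are set variables.
\<close>

datatype tm =
    V nat
  | Zero ("\<^bold>0")
  | One ("\<^bold>1")
  | Plus tm tm (infixl "\<^bold>+" 65)
  | Times tm tm (infixl "\<^bold>*" 70)
  | Len nat

datatype fm =
    Falsum ("\<^bold>\<bottom>")
  | Eq tm tm (infix "\<^bold>=" 50)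
  | SetEq nat nat
  | Le tm tm (infix "\<^bold>\<le>" 50)
  | Mem tm nat (infix "\<^bold>\<in>" 50)
  | Imp fm fm (infixr "\<^bold>\<longrightarrow>" 25)
  | AllN fm
  | AllS fm

definition Neg :: "fm \<Rightarrow> fm" ("\<^bold>\<not> _" [40] 40)
  where "(\<^bold>\<not> A) = (A \<^bold>\<longrightarrow> \<^bold>\<bottom>)"

definition Conj :: "fm \<Rightarrow> fm \<Rightarrow> fm" (infixr "\<^bold>\<and>" 35)
  where "(A \<^bold>\<and> B) = (\<^bold>\<not> (A \<^bold>\<longrightarrow> \<^bold>\<not> B))"

definition Disj :: "fm \<Rightarrow> fm \<Rightarrow> fm" (infixr "\<^bold>\<or>" 30)
  where "(A \<^bold>\<or> B) = (\<^bold>\<not> A \<^bold>\<longrightarrow> B)"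

definition Iff :: "fm \<Rightarrow> fm \<Rightarrow> fm" (infixr "\<^bold>\<longleftrightarrow>" 25)
  where "(A \<^bold>\<longleftrightarrow> B) = ((A \<^bold>\<longrightarrow> B) \<^bold>\<and> (B \<^bold>\<longrightarrow> A))"

definition ExN :: "fm \<Rightarrow> fm"
  where "ExN A = (\<^bold>\<not> AllN (\<^bold>\<not> A))"

definition ExS :: "fm \<Rightarrow> fm"
  where "ExS A = (\<^bold>\<not> AllS (\<^bold>\<not> A))"

definition Lt :: "tm \<Rightarrow> tm \<Rightarrow> fm" (infix "\<^bold><" 50)
  where "s \<^bold>< t = (s \<^bold>\<le> t \<^bold>\<and> \<^bold>\<not> s \<^bold>= t)"

text \<open>Simultaneous capture-avoiding substitution for number and set variables.\<close>

primrec substT :: "(nat \<Rightarrow> tm) \<Rightarrow> (nat \<Rightarrow> nat) \<Rightarrow> tm \<Rightarrow> tm" where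
  "substT \<sigma> \<rho> (V i) = \<sigma> i"
| "substT \<sigma> \<rho> \<^bold>0 = \<^bold>0"
| "substT \<sigma> \<rho> \<^bold>1 = \<^bold>1"
| "substT \<sigma> \<rho> (s \<^bold>+ t) = substT \<sigma> \<rho> s \<^bold>+ substT \<sigma> \<rho> t"
| "substT \<sigma> \<rho> (s \<^bold>* t) = substT \<sigma> \<rho> s \<^bold>* substT \<sigma> \<rho> t"
| "substT \<sigma> \<rho> (Len X) = Len (\<rho> X)"

text \<open>\<open>up k t\<close> is \<open>t\<close> moved under \<open>k\<close> number quantifiers.\<close>

definition up :: "nat \<Rightarrow> tm \<Rightarrow> tm"
  where "up k t = substT (\<lambda>i. V (i + k)) id t"

primrec substF :: "(nat \<Rightarrow> tm) \<Rightarrow> (nat \<Rightarrow> nat) \<Rightarrow> fm \<Rightarrow> fm" where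
  "substF \<sigma> \<rho> \<^bold>\<bottom> = \<^bold>\<bottom>"
| "substF \<sigma> \<rho> (s \<^bold>= t) = (substT \<sigma> \<rho> s \<^bold>= substT \<sigma> \<rho> t)"
| "substF \<sigma> \<rho> (SetEq X Y) = SetEq (\<rho> X) (\<rho> Y)"
| "substF \<sigma> \<rho> (s \<^bold>\<le> t) = (substT \<sigma> \<rho> s \<^bold>\<le> substT \<sigma> \<rho> t)"
| "substF \<sigma> \<rho> (t \<^bold>\<in> X) = (substT \<sigma> \<rho> t \<^bold>\<in> \<rho> X)"
| "substF \<sigma> \<rho> (A \<^bold>\<longrightarrow> B) = (substF \<sigma> \<rho> A \<^bold>\<longrightarrow> substF \<sigma> \<rho> B)"
| "substF \<sigma> \<rho> (AllN A) = AllN (substF (case_nat (V 0) (\<lambda>i. up 1 (\<sigma> i))) \<rho> A)"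
| "substF \<sigma> \<rho> (AllS A) =
     AllS (substF (\<lambda>i. substT V Suc (\<sigma> i)) (case_nat 0 (\<lambda>X. Suc (\<rho> X))) A)"

definition liftN :: "fm \<Rightarrow> fm"
  where "liftN A = substF (\<lambda>i. V (Suc i)) id A"

definition liftS :: "fm \<Rightarrow> fm"
  where "liftS A = substF V Suc A"

definition instN :: "fm \<Rightarrow> tm \<Rightarrow> fm"
  where "instN A t = substF (case_nat t V) id A"

definition instS :: "fm \<Rightarrow> nat \<Rightarrow> fm"
  where "instS A X = substF V (case_nat X id) A"

text \<open>
  Classical natural deduction with equality from a set \<open>T\<close> of axioms and a list \<open>G\<close> of
  hypotheses.  Axioms with free variables stand for their universal closures (the quantifier
  introduction rules restrict variables of \<open>G\<close> only).
\<close>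

inductive deriv :: "fm set \<Rightarrow> fm list \<Rightarrow> fm \<Rightarrow> bool" for T :: "fm set" where
  Axiom: "A \<in> T \<Longrightarrow> deriv T G A"
| Hyp: "A \<in> set G \<Longrightarrow> deriv T G A"
| ImpI: "deriv T (A # G) B \<Longrightarrow> deriv T G (A \<^bold>\<longrightarrow> B)"
| ImpE: "deriv T G (A \<^bold>\<longrightarrow> B) \<Longrightarrow> deriv T G A \<Longrightarrow> deriv T G B"
| Raa: "deriv T ((\<^bold>\<not> A) # G) \<^bold>\<bottom> \<Longrightarrow> deriv T G A"
| AllNI: "deriv T (map liftN G) A \<Longrightarrow> deriv T G (AllN A)"
| AllNE: "deriv T G (AllN A) \<Longrightarrow> deriv T G (instN A t)"
| AllSI: "deriv T (map liftS G) A \<Longrightarrow> deriv T G (AllS A)"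
| AllSE: "deriv T G (AllS A) \<Longrightarrow> deriv T G (instS A X)"
| EqRefl: "deriv T G (t \<^bold>= t)"
| EqSubst: "deriv T G (s \<^bold>= t) \<Longrightarrow> deriv T G (instN A s) \<Longrightarrow> deriv T G (instN A t)"
| SetEqRefl: "deriv T G (SetEq X X)"
| SetEqSubst: "deriv T G (SetEq X Y) \<Longrightarrow> deriv T G (instS A X) \<Longrightarrow> deriv T G (instS A Y)"

definition proves :: "fm set \<Rightarrow> fm \<Rightarrow> bool" (infix "\<^bold>\<turnstile>" 20)
  where "(T \<^bold>\<turnstile> A) \<longleftrightarrow> deriv T [] A"


section \<open>The theory \<open>V\<^sup>0\<close>\<close>

text \<open>
  Bounded quantifiers.  The bound \<open>t\<close> is a term outside the quantifier, so the quantified variable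
  does not occur in it.
\<close>

definition AllLe :: "tm \<Rightarrow> fm \<Rightarrow> fm"
  where "AllLe t A = AllN (V 0 \<^bold>\<le> up 1 t \<^bold>\<longrightarrow> A)"

definition ExLe :: "tm \<Rightarrow> fm \<Rightarrow> fm"
  where "ExLe t A = ExN (V 0 \<^bold>\<le> up 1 t \<^bold>\<and> A)"

definition AllLt :: "tm \<Rightarrow> fm \<Rightarrow> fm"
  where "AllLt t A = AllN (V 0 \<^bold>< up 1 t \<^bold>\<longrightarrow> A)"

definition ExLt :: "tm \<Rightarrow> fm \<Rightarrow> fm"
  where "ExLt t A = ExN (V 0 \<^bold>< up 1 t \<^bold>\<and> A)"

inductive Sigma0B :: "fm \<Rightarrow> bool" where
  "Sigma0B \<^bold>\<bottom>"
| "Sigma0B (s \<^bold>= t)"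
| "Sigma0B (SetEq X Y)"
| "Sigma0B (s \<^bold>\<le> t)"
| "Sigma0B (t \<^bold>\<in> X)"
| "Sigma0B A \<Longrightarrow> Sigma0B B \<Longrightarrow> Sigma0B (A \<^bold>\<longrightarrow> B)"
| "Sigma0B A \<Longrightarrow> Sigma0B (AllLe t A)"
| "Sigma0B A \<Longrightarrow> Sigma0B (ExLe t A)"
| "Sigma0B A \<Longrightarrow> Sigma0B (AllLt t A)"
| "Sigma0B A \<Longrightarrow> Sigma0B (ExLt t A)"

text \<open>The axioms 2-BASIC (B1 to B12, L1, L2, SE), with \<open>x = V 0\<close>, \<open>y = V 1\<close>, \<open>X = 0\<close>, \<open>Y = 1\<close>.\<close>

definition two_basic :: "fm set" where
  "two_basic =
    { \<^bold>\<not> V 0 \<^bold>+ \<^bold>1 \<^bold>= \<^bold>0,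
      V 0 \<^bold>+ \<^bold>1 \<^bold>= V 1 \<^bold>+ \<^bold>1 \<^bold>\<longrightarrow> V 0 \<^bold>= V 1,
      V 0 \<^bold>+ \<^bold>0 \<^bold>= V 0,
      V 0 \<^bold>+ (V 1 \<^bold>+ \<^bold>1) \<^bold>= (V 0 \<^bold>+ V 1) \<^bold>+ \<^bold>1,
      V 0 \<^bold>* \<^bold>0 \<^bold>= \<^bold>0,
      V 0 \<^bold>* (V 1 \<^bold>+ \<^bold>1) \<^bold>= (V 0 \<^bold>* V 1) \<^bold>+ V 0,
      (V 0 \<^bold>\<le> V 1 \<^bold>\<and> V 1 \<^bold>\<le> V 0) \<^bold>\<longrightarrow> V 0 \<^bold>= V 1,
      V 0 \<^bold>\<le> V 0 \<^bold>+ V 1,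
      \<^bold>0 \<^bold>\<le> V 0,
      V 0 \<^bold>\<le> V 1 \<^bold>\<or> V 1 \<^bold>\<le> V 0,
      V 0 \<^bold>\<le> V 1 \<^bold>\<longleftrightarrow> V 0 \<^bold>< V 1 \<^bold>+ \<^bold>1,
      \<^bold>\<not> V 0 \<^bold>= \<^bold>0 \<^bold>\<longrightarrow> ExLe (V 0) (V 0 \<^bold>+ \<^bold>1 \<^bold>= V 1),
      V 1 \<^bold>\<in> 0 \<^bold>\<longrightarrow> V 1 \<^bold>< Len 0,
      V 1 \<^bold>+ \<^bold>1 \<^bold>= Len 0 \<^bold>\<longrightarrow> V 1 \<^bold>\<in> 0,
      (Len 0 \<^bold>= Len 1 \<^bold>\<and> AllLt (Len 0) (V 0 \<^bold>\<in> 0 \<^bold>\<longleftrightarrow> V 0 \<^bold>\<in> 1)) \<^bold>\<longrightarrow> SetEq 0 1 }"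

text \<open>
  Comprehension \<open>\<exists>X \<le> y \<forall>z < y (X(z) \<longleftrightarrow> A(z))\<close>.  In \<open>A\<close>, the number variable \<open>z\<close> is
  \<open>V 0\<close>, and \<open>y\<close> is \<open>V 1\<close>; all other variables are parameters.
  \<open>liftS\<close> ensures that \<open>X\<close> does not occur in \<open>A\<close>.
\<close>

definition comprehension :: "fm \<Rightarrow> fm" where
  "comprehension A =
    ExS (Len 0 \<^bold>\<le> V 0 \<^bold>\<and> AllLt (V 0) (V 0 \<^bold>\<in> 0 \<^bold>\<longleftrightarrow> liftS A))"

definition V0 :: "fm set"
  where "V0 = two_basic \<union> {comprehension A |A. Sigma0B A}"


section \<open>Coding of points, edges and sequences of edges\<close>

text \<open>
  The usual pairing term of \<open>V\<^sup>0\<close>: \<open>\<langle>x,y\<rangle> = (x + y)(x + y + 1) + 2y\<close>.  A point is coded by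
  \<open>\<langle>x,y\<rangle>\<close>, an edge by \<open>\<langle>p,q\<rangle>\<close> for its end points \<open>p\<close>, \<open>q\<close>.
\<close>

definition pair :: "tm \<Rightarrow> tm \<Rightarrow> tm"
  where "pair x y = (x \<^bold>+ y) \<^bold>* (x \<^bold>+ y \<^bold>+ \<^bold>1) \<^bold>+ (\<^bold>1 \<^bold>+ \<^bold>1) \<^bold>* y"

text \<open>
  A set \<open>Z\<close> codes the sequence of numbers \<open>(Z)\<^sup>0, (Z)\<^sup>1, \<dots>\<close>, where \<open>(Z)\<^sup>i\<close> is the least
  \<open>e < |Z|\<close> with \<open>\<langle>i,e\<rangle> \<in> Z\<close>, or \<open>|Z|\<close> if there is none.
  \<open>entry Z i e\<close> says \<open>e = (Z)\<^sup>i\<close>.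
\<close>

definition entry :: "nat \<Rightarrow> tm \<Rightarrow> tm \<Rightarrow> fm" where
  "entry Z i e =
    ((e \<^bold>< Len Z \<^bold>\<and> pair i e \<^bold>\<in> Z \<^bold>\<and> AllLt e (\<^bold>\<not> pair (up 1 i) (V 0) \<^bold>\<in> Z)) \<^bold>\<or>
     (e \<^bold>= Len Z \<^bold>\<and> AllLt (Len Z) (\<^bold>\<not> pair (up 1 i) (V 0) \<^bold>\<in> Z)))"

definition grid_point :: "tm \<Rightarrow> tm \<Rightarrow> fm"
  where "grid_point n p = ExLe n (ExLe (up 1 n) (up 2 p \<^bold>= pair (V 1) (V 0)))"

definition differ_by_one :: "tm \<Rightarrow> tm \<Rightarrow> fm"
  where "differ_by_one a b = (a \<^bold>= b \<^bold>+ \<^bold>1 \<^bold>\<or> b \<^bold>= a \<^bold>+ \<^bold>1)"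

definition grid_edge :: "tm \<Rightarrow> tm \<Rightarrow> tm \<Rightarrow> fm" where
  "grid_edge n p q =
    ExLe n (ExLe (up 1 n) (ExLe (up 2 n) (ExLe (up 3 n)
      (up 4 p \<^bold>= pair (V 3) (V 2) \<^bold>\<and> up 4 q \<^bold>= pair (V 1) (V 0) \<^bold>\<and>
       ((V 3 \<^bold>= V 1 \<^bold>\<and> differ_by_one (V 2) (V 0)) \<^bold>\<or>
        (V 2 \<^bold>= V 0 \<^bold>\<and> differ_by_one (V 3) (V 1)))))))"

text \<open>
  A sequence of edges is given by its length \<open>t\<close> and a set \<open>Z\<close>: its members are
  \<open>(Z)\<^sup>0, \<dots>, (Z)\<^sup>t\<^sup>-\<^sup>1\<close>.  The end points of an edge \<open>(Z)\<^sup>i\<close> are bounded by \<open>|Z|\<close>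
  because \<open>p, q \<le> \<langle>p,q\<rangle>\<close> and \<open>(Z)\<^sup>i \<le> |Z|\<close>.
\<close>

definition edge_seq :: "tm \<Rightarrow> tm \<Rightarrow> nat \<Rightarrow> fm" where
  "edge_seq n t Z =
    AllLt t (ExLe (Len Z) (ExLe (Len Z)
      (entry Z (V 2) (pair (V 1) (V 0)) \<^bold>\<and> grid_edge (up 3 n) (V 1) (V 0))))"

text \<open>
  The sequence has the form \<open>\<langle>q\<^sub>0,q\<^sub>1\<rangle>, \<langle>q\<^sub>1,q\<^sub>2\<rangle>, \<dots>, \<langle>q\<^sub>t\<^sub>-\<^sub>1,q\<^sub>t\<rangle>\<close> with
  \<open>q\<^sub>0, \<dots>, q\<^sub>t\<^sub>-\<^sub>1\<close> distinct.  Here \<open>q\<^sub>i\<close> is the first component of \<open>(Z)\<^sup>i\<close>; the bound variables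
  are \<open>i = V 5\<close>, \<open>j = V 4\<close>, \<open>(Z)\<^sup>i = \<langle>V 3, V 2\<rangle>\<close>, \<open>(Z)\<^sup>j = \<langle>V 1, V 0\<rangle>\<close>.
\<close>

definition chain :: "tm \<Rightarrow> nat \<Rightarrow> fm" where
  "chain t Z =
    AllLt t (AllLt (up 1 t) (AllLe (Len Z) (AllLe (Len Z) (AllLe (Len Z) (AllLe (Len Z)
      (entry Z (V 5) (pair (V 3) (V 2)) \<^bold>\<and> entry Z (V 4) (pair (V 1) (V 0)) \<^bold>\<longrightarrow>
       (V 4 \<^bold>= V 5 \<^bold>+ \<^bold>1 \<^bold>\<longrightarrow> V 2 \<^bold>= V 1) \<^bold>\<and>
       (\<^bold>\<not> V 5 \<^bold>= V 4 \<^bold>\<longrightarrow> \<^bold>\<not> V 3 \<^bold>= V 1)))))))"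

text \<open>In addition \<open>t \<ge> 4\<close> and \<open>q\<^sub>t = q\<^sub>0\<close>; with \<open>t - 1 = V 3\<close>, \<open>(Z)\<^sup>t\<^sup>-\<^sup>1 = \<langle>V 2, V 1\<rangle>\<close>,
  \<open>(Z)\<^sup>0 = \<langle>V 1, V 0\<rangle>\<close>.\<close>

definition closed_curve :: "tm \<Rightarrow> nat \<Rightarrow> fm" where
  "closed_curve t Z =
    (\<^bold>1 \<^bold>+ \<^bold>1 \<^bold>+ \<^bold>1 \<^bold>+ \<^bold>1 \<^bold>\<le> t \<^bold>\<and>
     chain t Z \<^bold>\<and>
     ExLt t (V 0 \<^bold>+ \<^bold>1 \<^bold>= up 1 t \<^bold>\<and>
       ExLe (Len Z) (ExLe (Len Z) (ExLe (Len Z)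
         (entry Z (V 3) (pair (V 2) (V 1)) \<^bold>\<and> entry Z \<^bold>0 (pair (V 1) (V 0)))))))"

text \<open>
  For \<open>s\<close> edges: \<open>r\<^sub>0 = p\<^sub>1\<close>, \<open>r\<^sub>s = p\<^sub>2\<close>, and \<open>r\<^sub>s\<close> is distinct from \<open>r\<^sub>0, \<dots>, r\<^sub>s\<^sub>-\<^sub>1\<close>.
  The first two existential clauses force \<open>s \<ge> 1\<close>.
\<close>

definition connects :: "tm \<Rightarrow> nat \<Rightarrow> tm \<Rightarrow> tm \<Rightarrow> fm" where
  "connects s Z p1 p2 =
    (chain s Z \<^bold>\<and>
     ExLe (Len Z) (entry Z \<^bold>0 (pair (up 1 p1) (V 0))) \<^bold>\<and>
     ExLt s (V 0 \<^bold>+ \<^bold>1 \<^bold>= up 1 s \<^bold>\<and> ExLe (Len Z) (entry Z (V 1) (pair (V 0) (up 2 p2)))) \<^bold>\<and>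
     AllLt s (AllLe (Len Z) (AllLe (Len Z)
       (entry Z (V 2) (pair (V 1) (V 0)) \<^bold>\<longrightarrow> \<^bold>\<not> V 1 \<^bold>= up 3 p2))))"

text \<open>
  \<open>has_edge t Z p u\<close>: the edge between \<open>p\<close> and \<open>u\<close>, in either orientation, occurs in the sequence.
  The degree of \<open>p\<close> is therefore the number of such \<open>u\<close>.
\<close>

definition has_edge :: "tm \<Rightarrow> nat \<Rightarrow> tm \<Rightarrow> tm \<Rightarrow> fm" where
  "has_edge t Z p u =
    ExLt t (entry Z (V 0) (pair (up 1 p) (up 1 u)) \<^bold>\<or> entry Z (V 0) (pair (up 1 u) (up 1 p)))"

definition degree_ge1 :: "tm \<Rightarrow> nat \<Rightarrow> tm \<Rightarrow> fm"
  where "degree_ge1 t Z p = ExLe (Len Z) (has_edge (up 1 t) Z (up 1 p) (V 0))"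

definition degree_eq0 :: "tm \<Rightarrow> nat \<Rightarrow> tm \<Rightarrow> fm"
  where "degree_eq0 t Z p = (\<^bold>\<not> degree_ge1 t Z p)"

definition degree_eq2 :: "tm \<Rightarrow> nat \<Rightarrow> tm \<Rightarrow> fm" where
  "degree_eq2 t Z p =
    ExLe (Len Z) (ExLe (Len Z)
      (\<^bold>\<not> V 1 \<^bold>= V 0 \<^bold>\<and>
       has_edge (up 2 t) Z (up 2 p) (V 1) \<^bold>\<and> has_edge (up 2 t) Z (up 2 p) (V 0) \<^bold>\<and>
       AllLe (Len Z)
         (has_edge (up 3 t) Z (up 3 p) (V 0) \<^bold>\<longrightarrow> V 0 \<^bold>= V 2 \<^bold>\<or> V 0 \<^bold>= V 1)))"

text \<open>
  Bound variables: \<open>x(p\<^sub>1) = x(p\<^sub>2) = x(p) = V 3\<close>, \<open>y(p\<^sub>1) = V 2\<close>, \<open>y(p\<^sub>2) = V 1\<close>,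
  \<open>y(p) = V 0\<close>.
\<close>

definition different_sides :: "tm \<Rightarrow> tm \<Rightarrow> nat \<Rightarrow> tm \<Rightarrow> tm \<Rightarrow> fm" where
  "different_sides n t Z p1 p2 =
    ExLe n (ExLe (up 1 n) (ExLe (up 2 n) (ExLe (up 3 n)
      (up 4 p1 \<^bold>= pair (V 3) (V 2) \<^bold>\<and> up 4 p2 \<^bold>= pair (V 3) (V 1) \<^bold>\<and>
       (V 2 \<^bold>= V 1 \<^bold>+ (\<^bold>1 \<^bold>+ \<^bold>1) \<^bold>\<or> V 1 \<^bold>= V 2 \<^bold>+ (\<^bold>1 \<^bold>+ \<^bold>1)) \<^bold>\<and>
       V 0 \<^bold>+ V 0 \<^bold>= V 2 \<^bold>+ V 1 \<^bold>\<and>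
       degree_eq0 (up 4 t) Z (up 4 p1) \<^bold>\<and> degree_eq0 (up 4 t) Z (up 4 p2) \<^bold>\<and>
       degree_eq2 (up 4 t) Z (pair (V 3) (V 0))))))"

definition intersect :: "tm \<Rightarrow> tm \<Rightarrow> nat \<Rightarrow> tm \<Rightarrow> nat \<Rightarrow> fm" where
  "intersect n s R t B =
    ExLe n (ExLe (up 1 n)
      (degree_ge1 (up 2 s) R (pair (V 1) (V 0)) \<^bold>\<and> degree_ge1 (up 2 t) B (pair (V 1) (V 0))))"

text \<open>
  \<open>n\<close>: grid size; \<open>t\<close>, \<open>B\<close>: the closed curve; \<open>s\<close>, \<open>R\<close>: the connecting sequence.
\<close>

definition jordan_curve_seq ::
  "tm \<Rightarrow> tm \<Rightarrow> nat \<Rightarrow> tm \<Rightarrow> nat \<Rightarrow> tm \<Rightarrow> tm \<Rightarrow> fm" where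
  "jordan_curve_seq n t B s R p1 p2 =
    (edge_seq n t B \<^bold>\<and> closed_curve t B \<^bold>\<and>
     grid_point n p1 \<^bold>\<and> grid_point n p2 \<^bold>\<and> different_sides n t B p1 p2 \<^bold>\<and>
     edge_seq n s R \<^bold>\<and> connects s R p1 p2
     \<^bold>\<longrightarrow> intersect n s R t B)"

lemma Sigma0B_jordan_curve_seq: "Sigma0B (jordan_curve_seq n t B s R p1 p2)"
  by (auto simp: jordan_curve_seq_def edge_seq_def closed_curve_def chain_def connects_def
      grid_point_def different_sides_def intersect_def degree_eq0_def degree_eq2_def
      degree_ge1_def has_edge_def grid_edge_def differ_by_one_def entry_def
      Conj_def Disj_def Neg_def Lt_def intro!: Sigma0B.intros)

end

theory Submission
  imports Defs "HOL-Library.Countable" "HOL-Library.FSet"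
begin

text \<open>By completeness it suffices to check the sentence in every term model of \<open>V0\<close>. Such a model is
  passed to its discretely ordered ring of differences, where induction is available only for
  \<open>\<Sigma>\<^sup>B\<^sub>0\<close>-definable predicates; in particular crossings cannot be counted, not even modulo 2.

  Two facts replace the parity of crossing numbers. Consider a path and the heights at which it
  crosses the line \<open>x = m + 1/2\<close>. The pieces between consecutive crossings join these heights
  by chords on either side of the line, and disjoint chords on one side do not separate each other
  (induction on \<open>m\<close>). Hence, if a piece of a simple closed curve between two of its crossings has no
  crossing strictly between their heights, then its crossings, ordered by height, alternate in
  direction (strong induction on the length of the piece). Consequently the direction of the next
  crossing below a point tells on which side of the curve the point lies, and this is constant
  along any path disjoint from the curve. Finally the curve is cut open at its crossing between
  \<open>p\<^sub>1\<close> and \<open>p\<^sub>2\<close>, which lie on different sides of it in this sense.\<close>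

section \<open>Paths in a discretely ordered ring\<close>

text \<open>At column \<open>m + 1\<close> a chord splits, at its visits to that column, into unit
  vertical steps, between whose ends no height fits, and chords of column \<open>m\<close>; so
  chords that separate each other at \<open>m + 1\<close> contain such chords at \<open>m\<close>.
  For the alternation, suppose that two crossings of the same direction are neighbours in height.
  The part of the curve from one to the other is a shorter piece, so it alternates and has two
  sides. The rest of the curve avoids it, yet leads from one side of the closing segment to the
  other, which contradicts the invariance of the side. This argument passes to parts of parts, so
  the statement proved by induction cannot be about closed curves only; it is about pieces closed up
  by a segment of the line, and the closing segment is one more letter of the word. Each of these
  inductions must be over a definable predicate with bounded quantifiers. The geometry therefore
  works with an abstract class of such predicates, and it uses a ring because reflecting the plane
  and reversing indices need negative elements.\<close>

definition grid_adj :: "'z::linordered_idom \<Rightarrow> 'z \<Rightarrow> 'z \<Rightarrow> 'z \<Rightarrow> bool" where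
  "grid_adj x y x' y' \<longleftrightarrow> (x = x' \<and> (y' = y + 1 \<or> y = y' + 1)) \<or> (y = y' \<and> (x' = x + 1 \<or> x = x' + 1))"

definition between :: "'z::linorder \<Rightarrow> 'z \<Rightarrow> 'z \<Rightarrow> bool" where
  "between a b c \<longleftrightarrow> a < c \<and> c < b \<or> b < c \<and> c < a"

text \<open>Both sides of the equation say that the intervals spanned by \<open>a\<close>,
  \<open>b\<close> and by \<open>c\<close>, \<open>d\<close> do not interlace, and interlacing is
  symmetric. This lets an induction walk along either of two paths while the other stays
  fixed.\<close>

lemma between_chords_sym:
  "a \<noteq> c \<Longrightarrow> a \<noteq> d \<Longrightarrow> b \<noteq> c \<Longrightarrow> b \<noteq> d \<Longrightarrow>
   (between a b c = between a b d) = (between c d a = between c d b)"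
  unfolding between_def by (metis less_asym linorder_neqE order.strict_trans)

definition path_on :: "('z::linordered_idom \<Rightarrow> 'z) \<Rightarrow> ('z \<Rightarrow> 'z) \<Rightarrow> 'z \<Rightarrow> 'z \<Rightarrow> bool" where
  "path_on X Y u v \<longleftrightarrow> (\<forall>k\<in>{u..v-1}. grid_adj (X k) (Y k) (X (k+1)) (Y (k+1)))"

definition disjoint_on where
  "disjoint_on X Y u v X' Y' u' v' \<longleftrightarrow>
    (\<forall>k\<in>{u..v}. \<forall>k'\<in>{u'..v'}. \<not> ((X k :: 'z::linordered_idom) = X' (k'::'z) \<and> (Y (k::'z) :: 'z) = Y' k'))"

definition left_arc where
  "left_arc X Y m u v \<longleftrightarrow> u \<le> v \<and> path_on X Y u v \<and> (\<forall>k\<in>{u..v}. X k \<le> m) \<and> X u = m \<and> X v = m"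

text \<open>\<open>D\<close> and \<open>F\<close> stand for the predicates and functions of a
  valuation that bounded formulas can define. Using classes with closure rules instead of formulas
  reduces the definability obligations of the geometry to the rules collected in \<open>dfn\<close>.
  Variables are de Bruijn indices: in \<open>D_ball\<close> the body reads the quantified element at
  \<open>e 0\<close>. Quantifiers range over intervals with definable ends only, which is what keeps
  the formulas bounded.\<close>

locale definability =
  fixes D :: "((nat \<Rightarrow> 'z::linordered_idom) \<Rightarrow> bool) \<Rightarrow> bool"
    and F :: "((nat \<Rightarrow> 'z) \<Rightarrow> 'z) \<Rightarrow> bool"
  assumes D_False: "D (\<lambda>e. False)"
    and D_imp: "\<And>P Q. D P \<Longrightarrow> D Q \<Longrightarrow> D (\<lambda>e. P e \<longrightarrow> Q e)"
    and D_le: "\<And>f g. F f \<Longrightarrow> F g \<Longrightarrow> D (\<lambda>e. f e \<le> g e)"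
    and D_ball: "\<And>f g P. F f \<Longrightarrow> F g \<Longrightarrow> D (\<lambda>e. P (e 0) (\<lambda>i. e (Suc i)))
                  \<Longrightarrow> D (\<lambda>e. \<forall>k\<in>{f e..g e}. P k e)"
    and D_ren: "\<And>P r. D P \<Longrightarrow> D (\<lambda>e. P (\<lambda>i. e (r i)))"
    and F_ren: "\<And>f r. F f \<Longrightarrow> F (\<lambda>e. f (\<lambda>i. e (r i)))"
    and F_var: "\<And>i. F (\<lambda>e. e i)"
    and F_const: "\<And>c. F (\<lambda>e. c)"
    and F_add: "\<And>f g. F f \<Longrightarrow> F g \<Longrightarrow> F (\<lambda>e. f e + g e)"
    and F_diff: "\<And>f g. F f \<Longrightarrow> F g \<Longrightarrow> F (\<lambda>e. f e - g e)"
    and F_comp: "\<And>f X. F (\<lambda>e. X (e 0)) \<Longrightarrow> F f \<Longrightarrow> F (\<lambda>e. X (f e))"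
    and discrete: "\<And>x::'z. 0 < x \<Longrightarrow> 1 \<le> x"
    and induct: "\<And>P k. D (\<lambda>e. P (e 0)) \<Longrightarrow> P 0 \<Longrightarrow> (\<And>k. 0 \<le> k \<Longrightarrow> P k \<Longrightarrow> P (k + 1))
                  \<Longrightarrow> 0 \<le> k \<Longrightarrow> P k"
begin

section \<open>Induction, least and greatest elements for definable predicates\<close>

lemma less_iff_le: "(x::'z) < y \<longleftrightarrow> x + 1 \<le> y"
proof
  assume "x < y" then have "1 \<le> y - x" using discrete[of "y - x"] by simp
  then show "x + 1 \<le> y" by (simp add: algebra_simps)
next
  assume "x + 1 \<le> y" then show "x < y" using zero_less_one[where 'a='z] by linarith
qed

lemma le_cases: "(x::'z) \<le> y + 1 \<Longrightarrow> x \<le> y \<or> x = y + 1"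
  using less_iff_le[of x "y+1"] by force

lemma F_uminus: "F f \<Longrightarrow> F (\<lambda>e. - f e)"
  using F_diff[OF F_const[of 0], of f] by simp

lemma D_const: "D (\<lambda>e. c)"
  by (cases c) (use D_False D_imp[OF D_False D_False] in auto)

lemma D_not: "D P \<Longrightarrow> D (\<lambda>e. \<not> P e)"
  using D_imp[OF _ D_False] by simp

lemma D_conj: "D P \<Longrightarrow> D Q \<Longrightarrow> D (\<lambda>e. P e \<and> Q e)"
  using D_not[OF D_imp[OF _ D_not]] by simp

lemma D_disj: "D P \<Longrightarrow> D Q \<Longrightarrow> D (\<lambda>e. P e \<or> Q e)"
  using D_imp[OF D_not] by (simp add: disj_imp)

lemma D_iff: "D P \<Longrightarrow> D Q \<Longrightarrow> D (\<lambda>e. P e = Q e)"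
  using D_conj[OF D_imp D_imp, of P Q Q P] by (simp add: iff_conv_conj_imp)

lemma D_eq: "F f \<Longrightarrow> F g \<Longrightarrow> D (\<lambda>e. f e = g e)"
  using D_conj[OF D_le D_le, of f g g f] by (simp add: eq_iff)

lemma D_less: "F f \<Longrightarrow> F g \<Longrightarrow> D (\<lambda>e. f e < g e)"
  using D_not[OF D_le, of g f] by (simp add: not_le)

lemma D_bex: "F f \<Longrightarrow> F g \<Longrightarrow> D (\<lambda>e. P (e 0) (\<lambda>i. e (Suc i))) \<Longrightarrow> D (\<lambda>e. \<exists>k\<in>{f e..g e}. P k e)"
  using D_not[OF D_ball[of f g "\<lambda>k e. \<not> P k e"]] D_not[of "\<lambda>e. P (e 0) (\<lambda>i. e (Suc i))"] by simp

lemmas dfn = D_const D_not D_conj D_disj D_imp D_iff D_le D_eq D_less D_ball D_bex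
  F_var F_const F_add F_diff F_uminus

text \<open>Substituting a function into a predicate is not among the closure rules; a quantifier
  over the one-point interval from \<open>f e\<close> to \<open>f e\<close> supplies it.\<close>

lemma D_comp: "D (\<lambda>e. P (e 0)) \<Longrightarrow> F f \<Longrightarrow> D (\<lambda>e. P (f e))"
  using D_ball[of f f "\<lambda>k e. P k"] by simp

lemma D_comp2:
  assumes P: "D (\<lambda>e. P (e 0) (e 1))" and f: "F f" and g: "F g"
  shows "D (\<lambda>e. P (f e) (g e))"
proof -
  \<comment> \<open>With truncated subtraction on \<open>nat\<close>, the renaming
    \<open>1 - i\<close> swaps the indices 0 and 1.\<close>
  have 1: "D (\<lambda>e. P (e 1) (e 0))"
    using D_ren[OF P, of "\<lambda>i. 1 - i"] by simp
  have 2: "F (\<lambda>e. g (\<lambda>i. e (Suc i)))" by (rule F_ren[OF g])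
  have "D (\<lambda>e. \<forall>l\<in>{g (\<lambda>i. e (Suc i))..g (\<lambda>i. e (Suc i))}. P (e 0) l)"
    by (rule D_ball[OF 2 2]) (use 1 in simp)
  then have "D (\<lambda>e. P (e 0) (g (\<lambda>i. e (Suc i))))" by simp
  then have "D (\<lambda>e. \<forall>k\<in>{f e..f e}. P k (g e))"
    by (intro D_ball[OF f f, of "\<lambda>k e. P k (g e)"])
  then show ?thesis by simp
qed

lemma strong_induct:
  assumes P: "D (\<lambda>e. P (e 0))" and k: "a \<le> k"
    and step: "\<And>k. a \<le> k \<Longrightarrow> (\<And>l. a \<le> l \<Longrightarrow> l < k \<Longrightarrow> P l) \<Longrightarrow> P k"
  shows "P k"
proof -
  have "\<forall>l\<in>{0..k - a}. P (a + l)"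
  proof (rule induct[where P="\<lambda>k. \<forall>l\<in>{0..k}. P (a + l)"])
    show "D (\<lambda>e. \<forall>l\<in>{0..e 0}. P (a + l))"
      by (intro dfn D_comp[OF P])
    show "\<forall>l\<in>{0..0}. P (a + l)" using step[of a] by auto
    show "0 \<le> k - a" using k by simp
  next
    fix k :: 'z assume k: "0 \<le> k" and IH: "\<forall>l\<in>{0..k}. P (a + l)"
    have "P (a + (k + 1))"
    proof (rule step)
      show "a \<le> a + (k + 1)" using k by simp
      fix l assume "a \<le> l" "l < a + (k + 1)"
      then have "l - a \<in> {0..k}" using less_iff_le[of l "a + (k+1)"] by auto
      from bspec[OF IH this] show "P l" by simp
    qed
    with IH show "\<forall>l\<in>{0..k + 1}. P (a + l)"
      using le_cases by fastforce
  qed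
  then show ?thesis using k by (auto dest: bspec[of _ _ "k - a"])
qed

lemma least:
  assumes P: "D (\<lambda>e. P (e 0))" and "a \<le> k" "P k"
  obtains l where "a \<le> l" "l \<le> k" "P l" "\<And>j. a \<le> j \<Longrightarrow> j < l \<Longrightarrow> \<not> P j"
proof (rule ccontr)
  assume no: "\<not> thesis"
  have "\<forall>l\<in>{a..k}. \<not> P l"
  proof
    fix l assume "l \<in> {a..k}"
    then have "a \<le> l" "l \<le> k" by auto
    have "l \<le> k \<longrightarrow> \<not> P l"
    proof (rule strong_induct[where P="\<lambda>l. l \<le> k \<longrightarrow> \<not> P l" and a=a])
      show "D (\<lambda>e. e 0 \<le> k \<longrightarrow> \<not> P (e 0))" by (intro dfn P)
      show "a \<le> l" by fact
    next
      fix m assume "a \<le> m" "\<And>l. a \<le> l \<Longrightarrow> l < m \<Longrightarrow> l \<le> k \<longrightarrow> \<not> P l"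
      then show "m \<le> k \<longrightarrow> \<not> P m"
        using no that by (meson less_imp_le order.trans)
    qed
    with \<open>l \<le> k\<close> show "\<not> P l" by simp
  qed
  then show False using assms by auto
qed

text \<open>Negating the index turns this into \<open>least\<close>; here the negative elements of
  the ring are used.\<close>

lemma greatest:
  assumes P: "D (\<lambda>e. P (e 0))" and "k \<le> b" "P k"
  obtains l where "k \<le> l" "l \<le> b" "P l" "\<And>j. l < j \<Longrightarrow> j \<le> b \<Longrightarrow> \<not> P j"
proof -
  have "D (\<lambda>e. P (- e 0))" by (rule D_comp[OF P]) (intro dfn)
  then obtain l where l: "- b \<le> l" "l \<le> - k" "P (- l)"
      "\<And>j. - b \<le> j \<Longrightarrow> j < l \<Longrightarrow> \<not> P (- j)"
    using assms by (auto intro: least[of "\<lambda>k. P (- k)" "- b" "- k"])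
  show thesis
    by (rule that[of "- l"]) (use l l(4)[of "- j" for j] in auto)
qed

text \<open>The hypothesis \<open>step\<close> compares consecutive visits only. The visit preceding
  a given one exists by \<open>greatest\<close>, since \<open>u\<close> itself is a visit. This
  takes the place of an enumeration of the visits, which would amount to counting them.\<close>

lemma invariant_along_visits:
  assumes G: "D (\<lambda>e. G (e 0))" and V: "D (\<lambda>e. vis (e 0))" and u: "vis u" and l: "u \<le> l" "vis l" "l \<le> w"
    and step: "\<And>a b. u \<le> a \<Longrightarrow> a < b \<Longrightarrow> b \<le> w \<Longrightarrow> vis a \<Longrightarrow> vis b \<Longrightarrow>
                (\<And>j. a < j \<Longrightarrow> j < b \<Longrightarrow> \<not> vis j) \<Longrightarrow> G a = G b"
  shows "G l = G u"
proof -
  have "vis l \<and> l \<le> w \<longrightarrow> G l = G u"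
  proof (rule strong_induct[where P="\<lambda>l. vis l \<and> l \<le> w \<longrightarrow> G l = G u" and a=u])
    show "D (\<lambda>e. vis (e 0) \<and> e 0 \<le> w \<longrightarrow> G (e 0) = G u)" by (intro dfn G V)
    show "u \<le> l" by fact
  next
    fix k assume k: "u \<le> k" and IH: "\<And>l. u \<le> l \<Longrightarrow> l < k \<Longrightarrow> vis l \<and> l \<le> w \<longrightarrow> G l = G u"
    show "vis k \<and> k \<le> w \<longrightarrow> G k = G u"
    proof (intro impI, elim conjE)
      assume Vk: "vis k" "k \<le> w"
      show "G k = G u"
      proof (cases "k = u")
        case False
        then have "u \<le> k - 1" using k less_iff_le[of u k] by auto
        then obtain a where a: "u \<le> a" "a \<le> k - 1" "vis a" "\<And>j. a < j \<Longrightarrow> j \<le> k - 1 \<Longrightarrow> \<not> vis j"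
          using greatest[OF V, of u "k - 1"] u by metis
        have "a < k" using a less_iff_le[of a k] by auto
        moreover have "\<And>j. a < j \<Longrightarrow> j < k \<Longrightarrow> \<not> vis j"
          using a(4) less_iff_le by auto
        ultimately have "G a = G k" using step[of a k] a Vk by auto
        with IH[of a] \<open>a < k\<close> a Vk show ?thesis by auto
      qed simp
    qed
  qed
  with l show ?thesis by simp
qed

section \<open>Disjoint chords on one side of a line do not separate each other\<close>

definition noncrossing_at where
  "noncrossing_at X1 Y1 X2 Y2 A B m \<longleftrightarrow>
    (\<forall>u\<in>{A..B}. \<forall>v\<in>{A..B}. \<forall>u'\<in>{A..B}. \<forall>v'\<in>{A..B}.
      left_arc X1 Y1 m u v \<and> left_arc X2 Y2 m u' v' \<and> disjoint_on X1 Y1 u v X2 Y2 u' v' \<longrightarrow>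
      between (Y1 u) (Y1 v) (Y2 u') = between (Y1 u) (Y1 v) (Y2 v'))"

lemma no_between_adjacent:
  "b = a + 1 \<or> a = b + 1 \<Longrightarrow> \<not> between a b (c::'z)"
  unfolding between_def less_iff_le by auto

text \<open>Until its next return to column \<open>m + 1\<close> the path stays in the columns up to
  \<open>m\<close>, so it leaves and re-enters by horizontal steps, which keep the height. If the
  return is immediate, the single step is vertical.\<close>

lemma arc_step:
  assumes P: "path_on X Y u v" and uv: "u \<le> a" "a < b" "b \<le> v" and bd: "\<forall>k\<in>{u..v}. X k \<le> (m::'z) + 1"
    and ends: "X a = m + 1" "X b = m + 1" and inner: "\<And>j. a < j \<Longrightarrow> j < b \<Longrightarrow> X j \<noteq> m + 1"
  shows "(Y b = Y a + 1 \<or> Y a = Y b + 1) \<or>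
    (a + 1 \<le> b - 1 \<and> left_arc X Y m (a + 1) (b - 1) \<and> Y (a + 1) = Y a \<and> Y (b - 1) = Y b)"
proof (cases "b = a + 1")
  case True
  have "grid_adj (X a) (Y a) (X (a+1)) (Y (a+1))" using P uv True unfolding path_on_def by auto
  then show ?thesis using ends True unfolding grid_adj_def by auto
next
  case False
  have ab: "a + 1 \<le> b - 1" using uv(2) False less_iff_le[of a b] less_iff_le[of "a + 1" b] by auto
  have le: "X k \<le> m" if "a + 1 \<le> k" "k \<le> b - 1" for k
    using bd inner[of k] that uv le_cases[of "X k" m] less_iff_le[of a k] less_iff_le[of k b] by auto
  have A1: "grid_adj (X a) (Y a) (X (a+1)) (Y (a+1))" using P uv ab unfolding path_on_def less_iff_le by auto
  have A2: "grid_adj (X (b-1)) (Y (b-1)) (X (b-1+1)) (Y (b-1+1))"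
    using bspec[OF P[unfolded path_on_def], of "b - 1"] uv ab by auto
  have 1: "Y (a+1) = Y a" "X (a + 1) = m" using A1 le[of "a+1"] ab ends unfolding grid_adj_def by auto
  have 2: "Y (b-1) = Y b" "X (b-1) = m" using A2 le[of "b-1"] ab ends unfolding grid_adj_def by auto
  have "path_on X Y (a+1) (b-1)" using P uv ab unfolding path_on_def less_iff_le by auto
  then show ?thesis using 1 2 le ab unfolding left_arc_def by auto
qed

text \<open>Both arcs are cut at their visits to column \<open>m + 1\<close>. Single jumps are
  compared with each other, then a jump of the second arc with the whole first arc, finally the two
  arcs; \<open>between_chords_sym\<close> exchanges the roles so that only one arc is walked along
  at a time.\<close>

lemma noncrossing_step:
  assumes F: "F (\<lambda>e. X1 (e 0))" "F (\<lambda>e. Y1 (e 0))" "F (\<lambda>e. X2 (e 0))" "F (\<lambda>e. Y2 (e 0))"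
    and NC: "noncrossing_at X1 Y1 X2 Y2 A B m"
  shows "noncrossing_at X1 Y1 X2 Y2 A B (m + 1)"
  unfolding noncrossing_at_def
proof (intro ballI impI, elim conjE)
  fix u v u' v' assume R: "u \<in> {A..B}" "v \<in> {A..B}" "u' \<in> {A..B}" "v' \<in> {A..B}"
    and P: "left_arc X1 Y1 (m+1) u v" and Q: "left_arc X2 Y2 (m+1) u' v'"
    and dj: "disjoint_on X1 Y1 u v X2 Y2 u' v'"
  note Fc = F[THEN F_comp]
  have dY: "Y1 k \<noteq> Y2 k'" if "u \<le> k" "k \<le> v" "u' \<le> k'" "k' \<le> v'" "X1 k = m + 1" "X2 k' = m + 1" for k k'
    using dj that unfolding disjoint_on_def by auto
  have P': "u \<le> v" "path_on X1 Y1 u v" "\<forall>k\<in>{u..v}. X1 k \<le> m + 1" "X1 u = m + 1" "X1 v = m + 1"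
    using P unfolding left_arc_def by auto
  have Q': "u' \<le> v'" "path_on X2 Y2 u' v'" "\<forall>k\<in>{u'..v'}. X2 k \<le> m + 1" "X2 u' = m + 1" "X2 v' = m + 1"
    using Q unfolding left_arc_def by auto
  \<comment> \<open>A jump by one unit has no height strictly between its ends. If neither jump is
    of this kind, both are arcs at \<open>m\<close> after dropping one index at each end, and
    \<open>NC\<close> applies.\<close>
  have jumps: "between (Y2 c) (Y2 d) (Y1 a) = between (Y2 c) (Y2 d) (Y1 b)"
    if a: "u \<le> a" "a < b" "b \<le> v" "X1 a = m + 1" "X1 b = m + 1" "\<And>j. a < j \<Longrightarrow> j < b \<Longrightarrow> X1 j \<noteq> m + 1"
      and c: "u' \<le> c" "c < d" "d \<le> v'" "X2 c = m + 1" "X2 d = m + 1" "\<And>j. c < j \<Longrightarrow> j < d \<Longrightarrow> X2 j \<noteq> m + 1"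
    for a b c d
  proof -
    have ne: "Y1 a \<noteq> Y2 c" "Y1 a \<noteq> Y2 d" "Y1 b \<noteq> Y2 c" "Y1 b \<noteq> Y2 d"
      using dY a c by auto
    note sym = between_chords_sym[OF ne]
    have "(Y1 b = Y1 a + 1 \<or> Y1 a = Y1 b + 1) \<or>
      (a + 1 \<le> b - 1 \<and> left_arc X1 Y1 m (a + 1) (b - 1) \<and> Y1 (a + 1) = Y1 a \<and> Y1 (b - 1) = Y1 b)"
      by (rule arc_step[OF P'(2) a(1-3) P'(3) a(4,5)]) (use a(6) in auto)
    then show ?thesis
    proof (elim disjE conjE)
      assume a': "a + 1 \<le> b - 1" "left_arc X1 Y1 m (a + 1) (b - 1)" "Y1 (a + 1) = Y1 a" "Y1 (b - 1) = Y1 b"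
      have "(Y2 d = Y2 c + 1 \<or> Y2 c = Y2 d + 1) \<or>
        (c + 1 \<le> d - 1 \<and> left_arc X2 Y2 m (c + 1) (d - 1) \<and> Y2 (c + 1) = Y2 c \<and> Y2 (d - 1) = Y2 d)"
        by (rule arc_step[OF Q'(2) c(1-3) Q'(3) c(4,5)]) (use c(6) in auto)
      then show ?thesis
      proof (elim disjE conjE)
        assume c': "c + 1 \<le> d - 1" "left_arc X2 Y2 m (c + 1) (d - 1)" "Y2 (c + 1) = Y2 c" "Y2 (d - 1) = Y2 d"
        have "disjoint_on X1 Y1 (a+1) (b-1) X2 Y2 (c+1) (d-1)"
          using dj a(1-3) c(1-3) unfolding disjoint_on_def less_iff_le by auto
        moreover have "a + 1 \<in> {A..B}" "b - 1 \<in> {A..B}" "c + 1 \<in> {A..B}" "d - 1 \<in> {A..B}"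
          using R a(1-3) c(1-3) a'(1) c'(1) by auto
        ultimately show ?thesis using NC a' c' sym unfolding noncrossing_at_def by metis
      qed (use no_between_adjacent in blast)+
    qed (use sym no_between_adjacent in blast)+
  qed
  have chord: "between (Y1 u) (Y1 v) (Y2 c) = between (Y1 u) (Y1 v) (Y2 d)"
    if c: "u' \<le> c" "c < d" "d \<le> v'" "X2 c = m + 1" "X2 d = m + 1" "\<And>j. c < j \<Longrightarrow> j < d \<Longrightarrow> X2 j \<noteq> m + 1" for c d
  proof -
    have "between (Y2 c) (Y2 d) (Y1 v) = between (Y2 c) (Y2 d) (Y1 u)"
    proof (rule invariant_along_visits[where vis="\<lambda>k. X1 k = m + 1" and w=v and G="\<lambda>k. between (Y2 c) (Y2 d) (Y1 k)"])
      show "D (\<lambda>e. between (Y2 c) (Y2 d) (Y1 (e 0)))" unfolding between_def by (intro dfn Fc)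
      show "D (\<lambda>e. X1 (e 0) = m + 1)" by (intro dfn Fc)
    qed (use P' jumps[OF _ _ _ _ _ _ c] in auto)
    with between_chords_sym[of "Y1 u" "Y2 c" "Y2 d" "Y1 v"] dY P' c show ?thesis by auto
  qed
  have "between (Y1 u) (Y1 v) (Y2 v') = between (Y1 u) (Y1 v) (Y2 u')"
  proof (rule invariant_along_visits[where vis="\<lambda>k. X2 k = m + 1" and w=v' and G="\<lambda>k. between (Y1 u) (Y1 v) (Y2 k)"])
    show "D (\<lambda>e. between (Y1 u) (Y1 v) (Y2 (e 0)))" unfolding between_def by (intro dfn Fc)
    show "D (\<lambda>e. X2 (e 0) = m + 1)" by (intro dfn Fc)
  qed (use Q' chord in auto)
  then show "between (Y1 u) (Y1 v) (Y2 u') = between (Y1 u) (Y1 v) (Y2 v')" by simp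
qed

text \<open>Induction on the column, starting at \<open>L - 1\<close>, where there are no arcs of
  the first path because its columns are at least \<open>L\<close>. All indices are confined to one
  interval from \<open>A\<close> to \<open>B\<close>, so that \<open>noncrossing_at\<close> has
  bounded quantifiers and is definable.\<close>

lemma noncrossing_left:
  assumes F: "F (\<lambda>e. X1 (e 0))" "F (\<lambda>e. Y1 (e 0))" "F (\<lambda>e. X2 (e 0))" "F (\<lambda>e. Y2 (e 0))"
    and L: "\<And>k. L \<le> X1 k"
    and P: "left_arc X1 Y1 m u v" and Q: "left_arc X2 Y2 m u' v'"
    and dj: "disjoint_on X1 Y1 u v X2 Y2 u' v'"
  shows "between (Y1 u) (Y1 v) (Y2 u') = between (Y1 u) (Y1 v) (Y2 v')"
proof -
  define A where "A = min u u'"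
  define B where "B = max v v'"
  note Fc = F[THEN F_comp]
  have "noncrossing_at X1 Y1 X2 Y2 A B (L - 1 + (m - L + 1))"
  proof (rule induct[where P="\<lambda>i. noncrossing_at X1 Y1 X2 Y2 A B (L - 1 + i)"])
    show "D (\<lambda>e. noncrossing_at X1 Y1 X2 Y2 A B (L - 1 + e 0))"
      unfolding noncrossing_at_def left_arc_def disjoint_on_def path_on_def grid_adj_def between_def
      by (intro dfn Fc)
    show "noncrossing_at X1 Y1 X2 Y2 A B (L - 1 + 0)"
      unfolding noncrossing_at_def left_arc_def
    proof (intro ballI impI, elim conjE)
      fix u v u' v'
      assume "X1 u = L - 1 + 0"
      then have False using L[of u] zero_less_one[where 'a='z] by linarith
      then show "between (Y1 u) (Y1 v) (Y2 u') = between (Y1 u) (Y1 v) (Y2 v')" ..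
    qed
    show "0 \<le> m - L + 1" using L[of u] P zero_less_one[where 'a='z] unfolding left_arc_def by auto
    fix k assume "noncrossing_at X1 Y1 X2 Y2 A B (L - 1 + k)"
    from noncrossing_step[OF F this] show "noncrossing_at X1 Y1 X2 Y2 A B (L - 1 + (k + 1))"
      by (simp add: algebra_simps)
  qed
  moreover have "L - 1 + (m - L + 1) = m" by simp
  moreover have "u \<in> {A..B}" "v \<in> {A..B}" "u' \<in> {A..B}" "v' \<in> {A..B}"
    using P Q unfolding A_def B_def left_arc_def by auto
  ultimately show ?thesis using P Q dj unfolding noncrossing_at_def by metis
qed

end

section \<open>Words of directions and the status of a height\<close>

definition alternating :: "('z::linorder \<Rightarrow> bool) \<Rightarrow> ('z \<Rightarrow> bool) \<Rightarrow> bool" where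
  "alternating W d \<longleftrightarrow> (\<forall>h h'. W h \<and> W h' \<and> h < h' \<and> (\<forall>g. h < g \<and> g < h' \<longrightarrow> \<not> W g) \<longrightarrow> d h \<noteq> d h')"

text \<open>In use, \<open>\<beta>\<close> is the direction of the lowest letter
  (\<open>bottom_dir\<close>). A height with no letter below it gets the value False, so with this
  choice passing the lowest letter changes the status, just as passing any other letter of an
  alternating word does. The quantifiers are bounded to make the status definable.\<close>

definition status :: "('z::linordered_idom \<Rightarrow> bool) \<Rightarrow> ('z \<Rightarrow> bool) \<Rightarrow> bool \<Rightarrow> 'z \<Rightarrow> bool" where
  "status W d \<beta> z \<longleftrightarrow> (\<exists>h\<in>{0..z}. W h \<and> h < z \<and> (\<forall>g\<in>{h..z}. h < g \<and> g < z \<longrightarrow> \<not> W g) \<and> d h = \<beta>)"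

definition bottom_dir :: "('z::linorder \<Rightarrow> bool) \<Rightarrow> ('z \<Rightarrow> bool) \<Rightarrow> bool \<Rightarrow> bool" where
  "bottom_dir W d \<beta> \<longleftrightarrow> (\<forall>h. W h \<and> (\<forall>g. W g \<longrightarrow> h \<le> g) \<longrightarrow> d h = \<beta>)"

lemma bottom_dir_exists: "\<exists>\<beta>. bottom_dir W d \<beta>"
  unfolding bottom_dir_def by (metis order.antisym)

lemma statusI:
  assumes "0 \<le> h" "W h" "h < z" "\<And>g. h < g \<Longrightarrow> g < z \<Longrightarrow> \<not> W g"
  shows "status W d \<beta> z \<longleftrightarrow> d h = \<beta>"
proof
  assume "status W d \<beta> z"
  then obtain h' where h': "W h'" "h' < z" "\<forall>g\<in>{h'..z}. h' < g \<and> g < z \<longrightarrow> \<not> W g" "d h' = \<beta>"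
    unfolding status_def by auto
  have "h' = h"
  proof (rule ccontr)
    assume "h' \<noteq> h"
    then consider "h < h'" | "h' < h" by linarith
    then show False by cases (use assms h' in auto)
  qed
  with h' show "d h = \<beta>" by simp
next
  assume "d h = \<beta>" then show "status W d \<beta> z" unfolding status_def using assms by force
qed

lemma status_none: "(\<And>g. W g \<Longrightarrow> z \<le> g) \<Longrightarrow> \<not> status W d \<beta> z"
  unfolding status_def by force

context definability begin

lemma next_below:
  assumes W: "D (\<lambda>e. W (e 0))" and "0 \<le> h" "W h" "h < z"
  obtains h' where "h \<le> h'" "W h'" "h' < z" "\<And>g. h' < g \<Longrightarrow> g < z \<Longrightarrow> \<not> W g"
proof -
  have "h \<le> z - 1" using \<open>h < z\<close> by (simp add: less_iff_le algebra_simps)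
  from greatest[OF W this \<open>W h\<close>] obtain l where l: "h \<le> l" "l \<le> z - 1" "W l" "\<And>j. l < j \<Longrightarrow> j \<le> z - 1 \<Longrightarrow> \<not> W j"
    by blast
  show thesis
  proof (rule that[of l])
    show "l < z" using l(2) by (simp add: less_iff_le algebra_simps)
    fix g assume "l < g" "g < z" then show "\<not> W g" using l(4)[of g] by (simp add: less_iff_le algebra_simps)
  qed (use l in auto)
qed

text \<open>Induction on \<open>x\<close>: if \<open>x'\<close> is the mate of the topmost element \<open>x\<close>, then the elements below
  \<open>x'\<close> are matched among themselves, so the topmost of them has the direction opposite to \<open>low\<close>.\<close>

lemma matched_directions:
  assumes W: "D (\<lambda>e. W (e 0))" and d: "D (\<lambda>e. d (e 0))" and M: "D (\<lambda>e. M (e 0) (e 1))"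
    and alt: "alternating W d"
    and Md: "\<And>h h'. M h h' \<Longrightarrow> d h \<noteq> d h'"
    and Mx: "\<And>h h' g g'. M h h' \<Longrightarrow> M g g' \<Longrightarrow> (g = h \<and> g' = h') \<or> (g = h' \<and> g' = h) \<or>
       (g \<noteq> h \<and> g \<noteq> h' \<and> g' \<noteq> h \<and> g' \<noteq> h' \<and> between h h' g = between h h' g')"
    and low: "0 \<le> low" "W low"
    and x: "low \<le> x" "W x" "\<And>p. low \<le> p \<Longrightarrow> p \<le> x \<Longrightarrow> W p \<Longrightarrow> \<exists>p'. low \<le> p' \<and> p' \<le> x \<and> W p' \<and> M p p'"
  shows "d x \<noteq> d low"
proof -
  note Wc = D_comp[OF W] and Mc = D_comp2[OF M] and dc = D_comp[OF d]
  have "W x \<and> (\<forall>p\<in>{low..x}. W p \<longrightarrow> (\<exists>p'\<in>{low..x}. W p' \<and> M p p')) \<longrightarrow> d x \<noteq> d low"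
  proof (rule strong_induct[where P="\<lambda>x. W x \<and> (\<forall>p\<in>{low..x}. W p \<longrightarrow> (\<exists>p'\<in>{low..x}. W p' \<and> M p p')) \<longrightarrow> d x \<noteq> d low"])
    show "D (\<lambda>e. W (e 0) \<and> (\<forall>p\<in>{low..e 0}. W p \<longrightarrow> (\<exists>p'\<in>{low..e 0}. W p' \<and> M p p')) \<longrightarrow> d (e 0) \<noteq> d low)"
      by (intro dfn Wc Mc dc)
    show "low \<le> x" by fact
  next
    fix x assume x: "low \<le> x"
      and IH: "\<And>l. low \<le> l \<Longrightarrow> l < x \<Longrightarrow>
        W l \<and> (\<forall>p\<in>{low..l}. W p \<longrightarrow> (\<exists>p'\<in>{low..l}. W p' \<and> M p p')) \<longrightarrow> d l \<noteq> d low"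
    show "W x \<and> (\<forall>p\<in>{low..x}. W p \<longrightarrow> (\<exists>p'\<in>{low..x}. W p' \<and> M p p')) \<longrightarrow> d x \<noteq> d low"
    proof (intro impI, elim conjE)
      assume Wx: "W x" and mates: "\<forall>p\<in>{low..x}. W p \<longrightarrow> (\<exists>p'\<in>{low..x}. W p' \<and> M p p')"
      then obtain x' where x': "low \<le> x'" "x' \<le> x" "W x'" "M x x'" using x by force
      have dx: "d x \<noteq> d x'" by (rule Md[OF x'(4)])
      then have "x' < x" using x' by (metis order.not_eq_order_implies_strict)
      show "d x \<noteq> d low"
      proof (cases "x' = low")
        case True then show ?thesis using dx by simp
      next
        case False
        then have "low < x'" using x' by simp
        from next_below[OF W low this] obtain g where g: "low \<le> g" "W g" "g < x'" "\<And>p. g < p \<Longrightarrow> p < x' \<Longrightarrow> \<not> W p"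
          by blast
        have "\<forall>p\<in>{low..g}. W p \<longrightarrow> (\<exists>p'\<in>{low..g}. W p' \<and> M p p')"
        proof (intro ballI impI)
          fix p assume p: "p \<in> {low..g}" "W p"
          then obtain p' where p': "low \<le> p'" "p' \<le> x" "W p'" "M p p'" using mates g \<open>x' < x\<close> by force
          have "p < x'" using p g by auto
          with Mx[OF x'(4) p'(4)] p'(2) \<open>x' < x\<close> have "p' < x'" unfolding between_def by auto
          then have "p' \<le> g" using g(4)[of p'] p'(3) by force
          with p' show "\<exists>p'\<in>{low..g}. W p' \<and> M p p'" by auto
        qed
        then have "d g \<noteq> d low" using IH[of g] g \<open>x' < x\<close> by auto
        moreover have "d g \<noteq> d x'" using alt g x'(3) unfolding alternating_def by blast
        ultimately show ?thesis using dx by blast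
      qed
    qed
  qed
  then show ?thesis using x by fastforce
qed

text \<open>Let \<open>low\<close> and \<open>x\<close> be the lowest and the highest letter between
  \<open>z\<close> and \<open>z'\<close>. They have opposite directions by
  \<open>matched_directions\<close>, and \<open>low\<close> is opposite to the next letter below
  \<open>z\<close> by alternation, so \<open>x\<close> repeats the direction found below
  \<open>z\<close>. If there is no letter below \<open>z\<close>, then \<open>low\<close> is the
  lowest letter of all and has direction \<open>\<beta>\<close>, and both values are False.\<close>

lemma status_matched:
  assumes W: "D (\<lambda>e. W (e 0))" and d: "D (\<lambda>e. d (e 0))" and M: "D (\<lambda>e. M (e 0) (e 1))"
    and W0: "\<And>h. W h \<Longrightarrow> 0 \<le> h"
    and alt: "alternating W d" and bot: "bottom_dir W d \<beta>"
    and Md: "\<And>h h'. M h h' \<Longrightarrow> d h \<noteq> d h'"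
    and Mx: "\<And>h h' g g'. M h h' \<Longrightarrow> M g g' \<Longrightarrow> (g = h \<and> g' = h') \<or> (g = h' \<and> g' = h) \<or>
       (g \<noteq> h \<and> g \<noteq> h' \<and> g' \<noteq> h \<and> g' \<noteq> h' \<and> between h h' g = between h h' g')"
    and z: "z < z'" "\<not> W z" "\<not> W z'"
    and mate: "\<And>h. W h \<Longrightarrow> z < h \<Longrightarrow> h < z' \<Longrightarrow> \<exists>h'. W h' \<and> z < h' \<and> h' < z' \<and> M h h'"
  shows "status W d \<beta> z = status W d \<beta> z'"
proof (cases "\<exists>h. W h \<and> z < h \<and> h < z'")
  case False
  then have out: "W h \<Longrightarrow> h < z \<or> z' < h" for h using z by (metis linorder_neqE)
  show ?thesis
  proof (cases "\<exists>h. W h \<and> h < z")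
    case True
    then obtain h where "W h" "h < z" by auto
    from next_below[OF W W0[OF this(1)] this] obtain l where l: "h \<le> l" "W l" "l < z" "\<And>j. l < j \<Longrightarrow> j < z \<Longrightarrow> \<not> W j"
      by blast
    have "status W d \<beta> z = (d l = \<beta>)" by (rule statusI) (use l W0 in auto)
    moreover have "status W d \<beta> z' = (d l = \<beta>)"
    proof (rule statusI)
      fix g assume "l < g" "g < z'" then show "\<not> W g" using out[of g] l(4)[of g] by auto
    qed (use l W0 z in auto)
    ultimately show ?thesis by simp
  next
    case no: False
    then have "\<not> status W d \<beta> z" "\<not> status W d \<beta> z'"
      using out z by (force intro!: status_none)+
    then show ?thesis by simp
  qed
next
  case True
  then obtain h where h: "W h" "z < h" "h < z'" by auto
  have "D (\<lambda>e. W (e 0) \<and> z < e 0)" by (intro dfn W)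
  from least[where P="\<lambda>h. W h \<and> z < h", OF this W0[OF h(1)] conjI[OF h(1,2)]]
  obtain low where low0: "0 \<le> low" "low \<le> h" "W low \<and> z < low" "\<And>j. 0 \<le> j \<Longrightarrow> j < low \<Longrightarrow> \<not> (W j \<and> z < j)"
    by blast
  then have low: "0 \<le> low" "low \<le> h" "W low" "z < low" by auto
  have low': "low \<le> j" if "W j" "z < j" for j using low0(4)[of j] W0[of j] that by force
  from next_below[OF W W0[OF h(1)] h(1,3)] obtain x where x: "h \<le> x" "W x" "x < z'" "\<And>g. x < g \<Longrightarrow> g < z' \<Longrightarrow> \<not> W g"
    by blast
  have xz: "z < x" using x h by auto
  have dx: "d x \<noteq> d low"
  proof (rule matched_directions[OF W d M alt Md Mx low(1,3)])
    show "low \<le> x" by (rule low'[OF x(2) xz])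
    fix p assume p: "low \<le> p" "p \<le> x" "W p"
    then obtain p' where p': "W p'" "z < p'" "p' < z'" "M p p'" using mate[of p] low x by auto
    then have "low \<le> p'" "p' \<le> x" using low' x(4)[of p'] by force+
    with p' show "\<exists>p'. low \<le> p' \<and> p' \<le> x \<and> W p' \<and> M p p'" by blast
  qed (use x in auto)
  have sz': "status W d \<beta> z' = (d x = \<beta>)" by (rule statusI) (use x W0 in auto)
  show ?thesis
  proof (cases "\<exists>g. W g \<and> g < z")
    case True
    then obtain g where g: "W g" "g < z" by auto
    from next_below[OF W W0[OF g(1)] g] obtain l where l: "W l" "l < z" "\<And>j. l < j \<Longrightarrow> j < z \<Longrightarrow> \<not> W j" by blast
    have "\<not> W j" if "l < j" "j < low" for j
      using l(3)[of j] low'[of j] that z(2) by (metis linorder_neqE not_le)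
    moreover have "l < low" using l low by auto
    ultimately have "d l \<noteq> d low" using alt l low unfolding alternating_def by blast
    moreover have "status W d \<beta> z = (d l = \<beta>)" by (rule statusI) (use l W0 in auto)
    ultimately show ?thesis using sz' dx by blast
  next
    case False
    then have above: "z < g" if "W g" for g using that z(2) by (metis linorder_neqE)
    then have "d low = \<beta>" using bot low' low(3) unfolding bottom_dir_def by blast
    moreover have "\<not> status W d \<beta> z" by (rule status_none) (use above in force)
    ultimately show ?thesis using sz' dx by auto
  qed
qed

end

section \<open>Replacing one letter of a word by a nearby one\<close>

context definability begin

context
  fixes C d :: "'z \<Rightarrow> bool" and a b :: 'z
  assumes tight: "\<And>g. C g \<Longrightarrow> \<not> between a b g \<and> g \<noteq> a \<and> g \<noteq> b"
    and da: "d a" and db: "d b"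
begin

text \<open>On its way from \<open>a\<close> to \<open>b\<close> the one movable letter meets no
  letter of \<open>C\<close>. So the map \<open>r\<close> from the new letters to the old ones
  preserves order and neighbours and, by \<open>da\<close> and \<open>db\<close>, directions. The
  same cut, seen from the two sides of the line, gives two such words.\<close>

lemma alternating_shift:
  assumes "alternating (\<lambda>h. C h \<or> h = a) d"
  shows "alternating (\<lambda>h. C h \<or> h = b) d"
  unfolding alternating_def
proof (intro allI impI, elim conjE)
  fix h h' assume h: "C h \<or> h = b" "C h' \<or> h' = b" "h < h'" and g: "\<forall>g. h < g \<and> g < h' \<longrightarrow> \<not> (C g \<or> g = b)"
  define r where "r x = (if x = b then a else x)" for x
  have "d (r h) \<noteq> d (r h')"
  proof -
    have 1: "C (r h) \<or> r h = a" "C (r h') \<or> r h' = a" using h unfolding r_def by auto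
    have lt: "r h < r h'"
      using h tight[of h] tight[of h'] unfolding r_def between_def by auto
    have 2: "\<not> (C g \<or> g = a)" if "r h < g" "g < r h'" for g
    proof -
      have "\<not> C g" using h g tight[of g] tight[of h] tight[of h'] that unfolding r_def between_def
        by (auto split: if_splits)
      moreover have "g \<noteq> a" using h g tight[of h] tight[of h'] that unfolding r_def between_def
        by (auto split: if_splits) (metis linorder_neqE)
      ultimately show ?thesis by simp
    qed
    show ?thesis using assms 1 lt 2 unfolding alternating_def by blast
  qed
  then show "d h \<noteq> d h'" using da db unfolding r_def by (auto split: if_splits)
qed

lemma bottom_dir_shift:
  assumes "bottom_dir (\<lambda>h. C h \<or> h = a) d \<beta>"
  shows "bottom_dir (\<lambda>h. C h \<or> h = b) d \<beta>"
  unfolding bottom_dir_def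
proof (intro allI impI, elim conjE)
  fix h assume h: "C h \<or> h = b" and g: "\<forall>g. C g \<or> g = b \<longrightarrow> h \<le> g"
  define r where "r = (if h = b then a else h)"
  have "r \<le> g'" if "C g' \<or> g' = a" for g'
    using that h g tight[of g'] tight[of h] unfolding r_def between_def by (auto simp: not_less not_le)
  moreover have "C r \<or> r = a" using h unfolding r_def by auto
  ultimately have "d r = \<beta>" using assms unfolding bottom_dir_def by blast
  then show "d h = \<beta>" using da db unfolding r_def by (auto split: if_splits)
qed

lemma status_shift:
  assumes C: "D (\<lambda>e. C (e 0))" and pos: "\<And>h. C h \<Longrightarrow> 0 \<le> h" "0 \<le> a" "0 \<le> b"
    and z: "a < z \<longleftrightarrow> b < z" "z \<noteq> a" "z \<noteq> b"
  shows "status (\<lambda>h. C h \<or> h = a) d \<beta> z = status (\<lambda>h. C h \<or> h = b) d \<beta> z"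
proof (cases "\<exists>h. (C h \<or> h = a) \<and> h < z")
  case True
  then obtain h where h: "C h \<or> h = a" "h < z" by auto
  have W: "D (\<lambda>e. C (e 0) \<or> e 0 = a)" by (intro dfn C)
  from h pos have "0 \<le> h" by auto
  from next_below[where W="\<lambda>h. C h \<or> h = a", OF W this h] obtain l where
    l: "C l \<or> l = a" "l < z" "\<And>g. l < g \<Longrightarrow> g < z \<Longrightarrow> \<not> (C g \<or> g = a)" by blast
  define r where "r = (if l = a then b else l)"
  have "status (\<lambda>h. C h \<or> h = a) d \<beta> z = (d l = \<beta>)"
    by (rule statusI) (use l pos in auto)
  moreover have "status (\<lambda>h. C h \<or> h = b) d \<beta> z = (d r = \<beta>)"
  proof (rule statusI)
    show "0 \<le> r" "r < z" "C r \<or> r = b" using pos l z unfolding r_def by auto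
    fix g assume g: "r < g" "g < z"
    have "g \<noteq> b" using g l z tight[of l] unfolding r_def between_def
      by (auto split: if_splits) (metis linorder_neqE)
    moreover have "\<not> C g"
      using g l z tight[of g] tight[of l] unfolding r_def between_def
      by (auto split: if_splits)
    ultimately show "\<not> (C g \<or> g = b)" by simp
  qed
  moreover have "d r = d l" using da db unfolding r_def by auto
  ultimately show ?thesis by simp
next
  case False
  have "\<not> status (\<lambda>h. C h \<or> h = a) d \<beta> z" "\<not> status (\<lambda>h. C h \<or> h = b) d \<beta> z"
    using False z by (auto intro!: status_none simp: not_less)
  then show ?thesis by simp
qed

lemma status_above:
  assumes "0 \<le> a" "a < z" "\<And>g. a < g \<Longrightarrow> g < z \<Longrightarrow> \<not> C g"
  shows "status (\<lambda>h. C h \<or> h = a) d \<beta> z = \<beta>"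
  using statusI[of a "\<lambda>h. C h \<or> h = a" z d \<beta>] assms da by auto

text \<open>The letter \<open>a\<close> has direction True. The next letter below \<open>z\<close>
  is also the next one below \<open>a\<close>, so it has direction False and yields the negation of
  \<open>\<beta>\<close>. If there is none, \<open>a\<close> is the lowest letter, hence
  \<open>\<beta>\<close> is True while the status is False.\<close>

lemma status_below:
  assumes C: "D (\<lambda>e. C (e 0))" and pos: "\<And>h. C h \<Longrightarrow> 0 \<le> h"
    and alt: "alternating (\<lambda>h. C h \<or> h = a) d" and bot: "bottom_dir (\<lambda>h. C h \<or> h = a) d \<beta>"
    and z: "z < a" "\<And>g. z \<le> g \<Longrightarrow> g < a \<Longrightarrow> \<not> C g"
  shows "status (\<lambda>h. C h \<or> h = a) d \<beta> z = (\<not> \<beta>)"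
proof (cases "\<exists>h. C h \<and> h < z")
  case True
  then obtain h where "C h" "h < z" by auto
  from next_below[OF C pos[OF this(1)] this] obtain l where l: "C l" "l < z" "\<And>g. l < g \<Longrightarrow> g < z \<Longrightarrow> \<not> C g" by blast
  have "\<not> (C g \<or> g = a)" if "l < g" "g < a" for g using l(3)[of g] z(2)[of g] that by (cases "g < z") auto
  moreover have "l < a" using l z by auto
  ultimately have "d l \<noteq> d a" using alt l z unfolding alternating_def by blast
  moreover have "status (\<lambda>h. C h \<or> h = a) d \<beta> z = (d l = \<beta>)"
    by (rule statusI) (use l pos z in auto)
  ultimately show ?thesis using da by auto
next
  case False
  then have "a \<le> g" if "C g" for g using z(2)[of g] that by (metis not_le)
  then have "\<beta>" using bot da unfolding bottom_dir_def by auto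
  moreover have "\<not> status (\<lambda>h. C h \<or> h = a) d \<beta> z" by (rule status_none) (use False z in force)
  ultimately show ?thesis by simp
qed

end

end

section \<open>Curves cut open at a crossing of the line\<close>

definition line_col :: "'z::linordered_idom \<Rightarrow> bool \<Rightarrow> 'z" where
  "line_col m s = (if s then m + 1 else m)"

definition crosses :: "('z::linordered_idom \<Rightarrow> 'z) \<Rightarrow> 'z \<Rightarrow> 'z \<Rightarrow> bool" where
  "crosses X m k \<longleftrightarrow> (m < X k) \<noteq> (m < X (k + 1))"

definition inj_path where
  "inj_path X Y u v \<longleftrightarrow>
    (\<forall>k\<in>{u..v}. \<forall>l\<in>{u..v}. (X (k::'z::linordered_idom) :: 'z) = X l \<and> (Y k :: 'z) = Y l \<longrightarrow> k = l)"

text \<open>A path from one side of the line \<open>x = m + 1/2\<close> to the other that is closed up by a vertical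
  segment of the line; the segment counts as one more crossing, at height \<open>Y u\<close> when seen from
  the side of the start and at height \<open>Y v\<close> when seen from the side of the end.\<close>

definition cut_curve where
  "cut_curve X Y m u v \<longleftrightarrow> u < v \<and> path_on X Y u v \<and> inj_path X Y u v \<and>
    X u = line_col m (m < X u) \<and> X v = line_col m (m < X v) \<and> (m < X u) \<noteq> (m < X v) \<and>
    \<not> crosses X m u \<and> \<not> crosses X m (v - 1) \<and>
    (\<forall>k\<in>{u..v-1}. crosses X m k \<longrightarrow> \<not> between (Y u) (Y v) (Y k))"

definition cross_heights where
  "cross_heights X Y m u v h \<longleftrightarrow> (\<exists>k\<in>{u..v-1}. crosses X m k \<and> (Y k :: 'z::linordered_idom) = h)"

text \<open>Sides of the line are Booleans \<open>m < X k\<close>, True being the right side. The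
  closing segment leads from \<open>v\<close> back to \<open>u\<close>, hence to the side of
  \<open>u\<close>; a crossing counts as forward if it leads to that side too. The negative form
  makes \<open>forward\<close> true at the height of the cut, where the path has no crossing, so the
  cut needs no clause of its own.\<close>

definition forward where
  "forward X Y m u v h \<longleftrightarrow>
    \<not> (\<exists>k\<in>{u..v-1}. crosses X m k \<and> (m < X k) = (m < X u) \<and> (Y k :: 'z::linordered_idom) = h)"

definition cut_height where
  "cut_height X Y m u v s = (if s = (m < X u) then Y u else (Y v :: 'z::linordered_idom))"

definition word where
  "word X Y m u v s h \<longleftrightarrow> cross_heights X Y m u v h \<or> h = cut_height X Y m u v s"

definition chord where
  "chord X m u v s k k' \<longleftrightarrow> u \<le> k \<and> k \<le> k' \<and> k' \<le> v \<and> (\<forall>l\<in>{k..k'}. (m < X l) = s) \<and>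
    (k = u \<or> (m < X (k - 1)) \<noteq> s) \<and> (k' = v \<or> (m < X (k' + 1)) \<noteq> s)"

definition mates where
  "mates X Y m u v s h h' \<longleftrightarrow> (\<exists>k\<in>{u..v}. \<exists>k'\<in>{u..v}. chord X m u v s k k' \<and>
     (h = (Y k :: 'z::linordered_idom) \<and> h' = Y k' \<or> h = Y k' \<and> h' = Y k))"

context definability begin

lemma crosses_point:
  assumes "grid_adj (X k) (Y k) (X (k+1)) (Y (k+1))" "crosses X m (k::'z)"
  shows "Y (k + 1) = Y k" "X k = line_col m (m < X k)" "X (k + 1) = line_col m (m < X (k + 1))"
proof -
  have 1: "Y (k + 1) = Y k \<and> (X k = X (k+1) + 1 \<or> X (k+1) = X k + 1)"
    using assms unfolding grid_adj_def crosses_def by auto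
  then show "Y (k+1) = Y k" by simp
  have "X k = line_col m (m < X k) \<and> X (k + 1) = line_col m (m < X (k + 1))"
    using 1 assms(2) unfolding crosses_def line_col_def less_iff_le
    by (auto simp: not_le less_iff_le)
  then show "X k = line_col m (m < X k)" "X (k + 1) = line_col m (m < X (k + 1))" by auto
qed

lemma path_on_sub: "path_on X Y u v \<Longrightarrow> u \<le> a \<Longrightarrow> b \<le> v \<Longrightarrow> path_on X Y a (b::'z)"
  unfolding path_on_def by auto

lemma path_on_adj: "path_on X Y u v \<Longrightarrow> u \<le> k \<Longrightarrow> k < v \<Longrightarrow> grid_adj (X k) (Y k) (X (k+1)) (Y ((k::'z)+1))"
  unfolding path_on_def less_iff_le by auto

lemma disjoint_on_sub:
  "disjoint_on X Y u v X' Y' u' v' \<Longrightarrow> u \<le> a \<Longrightarrow> b \<le> v \<Longrightarrow> u' \<le> a' \<Longrightarrow> b' \<le> v' \<Longrightarrow>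
   disjoint_on X Y a b X' Y' a' b'"
  unfolding disjoint_on_def by auto

text \<open>The right side is the left side of the mirror image: negating \<open>X\<close> turns
  column \<open>m + 1\<close> into \<open>- (m + 1)\<close> and the upper bound \<open>n\<close>
  into the lower bound that \<open>noncrossing_left\<close> asks for.\<close>

lemma noncrossing_side:
  assumes F: "F (\<lambda>e. X1 (e 0))" "F (\<lambda>e. Y1 (e 0))" "F (\<lambda>e. X2 (e 0))" "F (\<lambda>e. Y2 (e 0))"
    and L: "\<And>k. 0 \<le> X1 k \<and> X1 k \<le> n"
    and P: "u \<le> v" "path_on X1 Y1 u v" "\<And>k. u \<le> k \<Longrightarrow> k \<le> v \<Longrightarrow> (m < X1 k) = s"
      "X1 u = line_col m s" "X1 v = line_col m s"
    and Q: "u' \<le> v'" "path_on X2 Y2 u' v'" "\<And>k. u' \<le> k \<Longrightarrow> k \<le> v' \<Longrightarrow> (m < X2 k) = s"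
      "X2 u' = line_col m s" "X2 v' = line_col m s"
    and dj: "disjoint_on X1 Y1 u v X2 Y2 u' v'"
  shows "between (Y1 u) (Y1 v) (Y2 u') = between (Y1 u) (Y1 v) (Y2 v')"
proof (cases s)
  case False
  have "left_arc X1 Y1 m u v" "left_arc X2 Y2 m u' v'"
    using P Q False unfolding left_arc_def line_col_def by force+
  with noncrossing_left[OF F _ this dj] L show ?thesis by blast
next
  case True
  have neg: "path_on (\<lambda>k. - X k) Y a b" if "path_on X Y a b" for X Y :: "'z \<Rightarrow> 'z" and a b
    using that unfolding path_on_def grid_adj_def by force
  have "left_arc (\<lambda>k. - X1 k) Y1 (- (m + 1)) u v"
    using P neg[OF P(2)] True unfolding left_arc_def line_col_def less_iff_le by force
  moreover have "left_arc (\<lambda>k. - X2 k) Y2 (- (m + 1)) u' v'"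
    using Q neg[OF Q(2)] True unfolding left_arc_def line_col_def less_iff_le by force
  moreover have "disjoint_on (\<lambda>k. - X1 k) Y1 u v (\<lambda>k. - X2 k) Y2 u' v'"
    using dj unfolding disjoint_on_def by simp
  ultimately show ?thesis
    using noncrossing_left[of "\<lambda>k. - X1 k" Y1 "\<lambda>k. - X2 k" Y2 "- n"] F F_uminus[OF F(1)] F_uminus[OF F(3)] L
    by auto
qed

lemma chord_start:
  assumes F: "F (\<lambda>e. X (e 0))" and "u \<le> k" "(m < X k) = s"
  obtains a where "u \<le> a" "a \<le> k" "\<And>l. a \<le> l \<Longrightarrow> l \<le> k \<Longrightarrow> (m < X l) = s" "a = u \<or> (m < X (a - 1)) \<noteq> s"
proof -
  have "D (\<lambda>e. \<forall>l\<in>{e 0..k}. (m < X l) = s)" by (intro dfn F_comp[OF F])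
  from least[where P="\<lambda>a. \<forall>l\<in>{a..k}. (m < X l) = s", OF this \<open>u \<le> k\<close>] assms(3)
  obtain a where a: "u \<le> a" "a \<le> k" "\<forall>l\<in>{a..k}. (m < X l) = s"
    "\<And>j. u \<le> j \<Longrightarrow> j < a \<Longrightarrow> \<not> (\<forall>l\<in>{j..k}. (m < X l) = s)" by auto
  show thesis
  proof (rule that[of a])
    show "a = u \<or> (m < X (a - 1)) \<noteq> s"
    proof (rule ccontr)
      assume no: "\<not> ?thesis"
      then have "u \<le> a - 1" using a(1) less_iff_le[of u a] by auto
      from a(4)[OF this] obtain l where l: "a - 1 \<le> l" "l \<le> k" "(m < X l) \<noteq> s" by auto
      then have "\<not> a \<le> l" using a(3) by auto
      then have "l = a - 1" using l less_iff_le[of l a] by (auto simp: not_le)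
      with l no show False by simp
    qed
  qed (use a in auto)
qed

lemma chord_end:
  assumes F: "F (\<lambda>e. X (e 0))" and "k \<le> v" "(m < X k) = s"
  obtains b where "k \<le> b" "b \<le> v" "\<And>l. k \<le> l \<Longrightarrow> l \<le> b \<Longrightarrow> (m < X l) = s" "b = v \<or> (m < X (b + 1)) \<noteq> s"
proof -
  have "D (\<lambda>e. \<forall>l\<in>{k..e 0}. (m < X l) = s)" by (intro dfn F_comp[OF F])
  from greatest[where P="\<lambda>b. \<forall>l\<in>{k..b}. (m < X l) = s", OF this \<open>k \<le> v\<close>] assms(3)
  obtain b where b: "k \<le> b" "b \<le> v" "\<forall>l\<in>{k..b}. (m < X l) = s"
    "\<And>j. b < j \<Longrightarrow> j \<le> v \<Longrightarrow> \<not> (\<forall>l\<in>{k..j}. (m < X l) = s)" by auto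
  show thesis
  proof (rule that[of b])
    show "b = v \<or> (m < X (b + 1)) \<noteq> s"
    proof (rule ccontr)
      assume no: "\<not> ?thesis"
      then have "b + 1 \<le> v" using b(2) less_iff_le[of b v] by auto
      from b(4)[OF _ this] obtain l where l: "k \<le> l" "l \<le> b + 1" "(m < X l) \<noteq> s"
        using less_iff_le[of b "b+1"] by auto
      then have "\<not> l \<le> b" using b(3) by auto
      then have "l = b + 1" using l le_cases[of l b] by auto
      with l no show False by simp
    qed
  qed (use b in auto)
qed

context
  fixes X Y :: "'z \<Rightarrow> 'z" and m n u v :: 'z
  assumes FX: "F (\<lambda>e. X (e 0))" and FY: "F (\<lambda>e. Y (e 0))"
    and bX: "\<And>k. 0 \<le> X k \<and> X k \<le> n" and bY: "\<And>k. 0 \<le> Y k"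
    and cut: "cut_curve X Y m u v"
begin

private abbreviation "C \<equiv> cross_heights X Y m u v"
private abbreviation "d \<equiv> forward X Y m u v"
private abbreviation "W \<equiv> word X Y m u v"
private abbreviation "s0 \<equiv> m < X u"

private lemma cutD: "u < v" "path_on X Y u v" "X u = line_col m s0" "X v = line_col m (\<not> s0)"
    "(m < X v) = (\<not> s0)" "\<not> crosses X m u" "\<not> crosses X m (v - 1)"
    "\<And>k. u \<le> k \<Longrightarrow> k \<le> v - 1 \<Longrightarrow> crosses X m k \<Longrightarrow> \<not> between (Y u) (Y v) (Y k)"
  using cut unfolding cut_curve_def by auto

private lemma inj: "u \<le> k \<Longrightarrow> k \<le> v \<Longrightarrow> u \<le> l \<Longrightarrow> l \<le> v \<Longrightarrow> X k = X l \<Longrightarrow> Y k = Y l \<Longrightarrow> k = l"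
  using cut unfolding cut_curve_def inj_path_def by auto

private lemma cr:
  assumes "u \<le> k" "k \<le> v - 1" "crosses X m k"
  shows "Y (k+1) = Y k" "X k = line_col m (m < X k)" "X (k+1) = line_col m (m < X (k+1))"
    "(m < X (k+1)) = (\<not> m < X k)"
proof -
  have "k < v" using assms(2) less_iff_le[of k v] by (simp add: algebra_simps)
  from crosses_point[OF path_on_adj[OF cutD(2) assms(1) this] assms(3)]
  show "Y (k+1) = Y k" "X k = line_col m (m < X k)" "X (k+1) = line_col m (m < X (k+1))" .
  show "(m < X (k+1)) = (\<not> m < X k)" using assms(3) unfolding crosses_def by auto
qed

text \<open>The crossing step \<open>l\<close> occupies both columns next to the line at its height.
  As the path is injective, a point of the path in one of these columns at that height is one of the
  two ends of the step. Therefore a height carries at most one crossing, and letters can be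
  identified with heights.\<close>

private lemma cross_index:
  assumes l: "u \<le> l" "l \<le> v - 1" "crosses X m l" and k: "u \<le> k" "k \<le> v" "X k = line_col m (m < X k)" "Y k = Y l"
  shows "k = (if (m < X k) = (m < X l) then l else l + 1)"
proof -
  have l1: "l + 1 \<le> v" using l by (simp add: algebra_simps)
  have l2: "l \<le> v" "u \<le> l + 1" using l1 l(1) zero_less_one[where 'a='z] by linarith+
  show ?thesis
  proof (cases "(m < X k) = (m < X l)")
    case True
    have "X k = X l" using k(3) cr(2)[OF l] True by simp
    then have "k = l" by (rule inj[OF k(1,2) l(1) l2(1) _ k(4)])
    then show ?thesis using True by simp
  next
    case False
    then have "(m < X k) = (m < X (l+1))" using cr(4)[OF l] by auto
    then have "X k = X (l+1)" using k(3) cr(3)[OF l] by simp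
    then have "k = l+1" by (rule inj[OF k(1,2) l2(2) l1]) (use k(4) cr(1)[OF l] in simp)
    then show ?thesis using False by simp
  qed
qed

private lemma uv1: "u + 1 \<le> v" "u \<le> v - 1" "u \<le> v"
  using cutD(1) by (auto simp: less_iff_le algebra_simps)

text \<open>By \<open>cross_index\<close>, a crossing at the height of \<open>u\<close> or
  \<open>v\<close> would have that point as an end, so it would be step \<open>u\<close> or step
  \<open>v - 1\<close>; \<open>cut_curve\<close> excludes both.\<close>

lemma cross_heights_not_ends:
  assumes "C h" shows "\<not> between (Y u) (Y v) h" "h \<noteq> Y u" "h \<noteq> Y v"
proof -
  from assms obtain l where l: "u \<le> l" "l \<le> v - 1" "crosses X m l" "Y l = h"
    unfolding cross_heights_def by auto
  show "\<not> between (Y u) (Y v) h" using cutD(8)[OF l(1-3)] l by simp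
  show "h \<noteq> Y u"
  proof
    assume h: "h = Y u"
    have "u = (if s0 = (m < X l) then l else l + 1)"
      by (rule cross_index[OF l(1-3)]) (use uv1 cutD(3) h l(4) in auto)
    then show False using l cutD(6) zero_less_one[where 'a='z] by (auto split: if_splits)
  qed
  show "h \<noteq> Y v"
  proof
    assume h: "h = Y v"
    have "v = (if (m < X v) = (m < X l) then l else l + 1)"
      by (rule cross_index[OF l(1-3)]) (use uv1 cutD(4,5) h l(4) in auto)
    then show False using l cutD(7) zero_less_one[where 'a='z] by (auto split: if_splits)
  qed
qed

lemma cross_heights_tight:
  assumes "C h" shows "\<not> between (cut_height X Y m u v s) (cut_height X Y m u v s') h \<and>
    h \<noteq> cut_height X Y m u v s \<and> h \<noteq> cut_height X Y m u v s'"
  using cross_heights_not_ends[OF assms] unfolding cut_height_def between_def by auto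

lemma forward_cut: "d (cut_height X Y m u v s)"
  using cross_heights_tight[of "cut_height X Y m u v s" s s] unfolding forward_def cross_heights_def by auto

lemma D_C: "D (\<lambda>e. C (e 0))"
  unfolding cross_heights_def crosses_def by (intro dfn F_comp[OF FX] F_comp[OF FY])

lemma D_d: "D (\<lambda>e. d (e 0))"
  unfolding forward_def crosses_def by (intro dfn F_comp[OF FX] F_comp[OF FY])

lemma D_W: "D (\<lambda>e. W s (e 0))"
  unfolding word_def by (intro dfn D_C)

lemma D_mates: "D (\<lambda>e. mates X Y m u v s (e 0) (e 1))"
  unfolding mates_def chord_def by (intro dfn F_comp[OF FX] F_comp[OF FY])

lemma C_pos: "C h \<Longrightarrow> 0 \<le> h"
  using bY unfolding cross_heights_def by auto

lemma W_pos: "W s h \<Longrightarrow> 0 \<le> h"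
  using bY C_pos unfolding word_def cut_height_def by auto

lemma word_as_fun: "W s = (\<lambda>h. C h \<or> h = cut_height X Y m u v s)"
  unfolding word_def by auto

lemma alternating_sides: "alternating (W s) d \<Longrightarrow> alternating (W s') d"
  unfolding word_as_fun
  by (rule alternating_shift[where a="cut_height X Y m u v s"]) (use cross_heights_tight forward_cut in auto)

lemma bottom_dir_sides: "bottom_dir (W s) d \<beta> \<Longrightarrow> bottom_dir (W s') d \<beta>"
  unfolding word_as_fun
  by (rule bottom_dir_shift[where a="cut_height X Y m u v s"]) (use cross_heights_tight forward_cut in auto)

lemma status_sides:
  assumes "\<not> between (Y u) (Y v) z" "z \<noteq> Y u" "z \<noteq> Y v"
  shows "status (W s) d \<beta> z = status (W s') d \<beta> z"
  unfolding word_as_fun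
proof (rule status_shift)
  show "cut_height X Y m u v s < z \<longleftrightarrow> cut_height X Y m u v s' < z"
    "z \<noteq> cut_height X Y m u v s" "z \<noteq> cut_height X Y m u v s'"
    using assms unfolding cut_height_def between_def by auto
qed (use cross_heights_tight forward_cut D_C C_pos bY in \<open>auto simp: cut_height_def\<close>)

lemma word_point:
  assumes "W s h"
  obtains k where "u \<le> k" "k \<le> v" "X k = line_col m s" "Y k = h" "(m < X k) = s"
    "(k = u \<or> (m < X (k - 1)) \<noteq> s) \<or> (k = v \<or> (m < X (k + 1)) \<noteq> s)"
proof (cases "C h")
  case True
  then obtain l where l: "u \<le> l" "l \<le> v - 1" "crosses X m l" "Y l = h"
    unfolding cross_heights_def by auto
  have l1: "l + 1 \<le> v" "l \<le> v" "u \<le> l + 1" using l zero_less_one[where 'a='z] by (simp add: algebra_simps, linarith, linarith)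
  note c = cr[OF l(1-3)]
  show thesis
  proof (cases "(m < X l) = s")
    case True then show thesis using that[of l] l l1 c by auto
  next
    case False then show thesis using that[of "l+1"] l l1 c by auto
  qed
next
  case False
  then have h: "h = cut_height X Y m u v s" using assms unfolding word_def by simp
  show thesis
  proof (cases "s = s0")
    case True
    show thesis by (rule that[of u]) (use True h uv1 cutD(3) in \<open>simp_all add: cut_height_def\<close>)
  next
    case False
    then have "s = (\<not> s0)" by auto
    then show thesis by (intro that[of v]) (use h uv1 cutD(4,5) in \<open>simp_all add: cut_height_def\<close>)
  qed
qed

text \<open>A chord enters its side at one end and leaves it at the other, where the cut serves as
  the missing crossing if the end is \<open>u\<close> or \<open>v\<close>. This is why the
  directions at its two ends are opposite.\<close>

lemma chord_props:
  assumes "chord X m u v s k k'"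
  shows "X k = line_col m s" "X k' = line_col m s" "W s (Y k)" "W s (Y k')" "k < k'"
    "d (Y k) \<noteq> d (Y k')"
proof -
  have c: "u \<le> k" "k \<le> k'" "k' \<le> v" "\<And>l. k \<le> l \<Longrightarrow> l \<le> k' \<Longrightarrow> (m < X l) = s"
     "k = u \<or> (m < X (k - 1)) \<noteq> s" "k' = v \<or> (m < X (k' + 1)) \<noteq> s"
    using assms unfolding chord_def by auto
  have sk: "(m < X k) = s" "(m < X k') = s" using c by auto
  have pre: "u \<le> k - 1 \<and> k - 1 \<le> v - 1 \<and> crosses X m (k - 1)" if "k \<noteq> u"
    using c that less_iff_le[of u k] sk unfolding crosses_def by auto
  have post: "u \<le> k' \<and> k' \<le> v - 1 \<and> crosses X m k'" if "k' \<noteq> v"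
    using c that less_iff_le[of k' v] sk unfolding crosses_def by (auto simp: algebra_simps)
  show Xk: "X k = line_col m s"
    using cutD(3) cr(3)[of "k-1"] pre sk by (cases "k = u") auto
  show Xk': "X k' = line_col m s"
    using cutD(4,5) cr(2)[of k'] post sk by (cases "k' = v") auto
  show W1: "W s (Y k)"
  proof (cases "k = u")
    case True then show ?thesis using sk unfolding word_def cut_height_def by auto
  next
    case False
    then have "C (Y k)" using pre cr(1)[of "k-1"] unfolding cross_heights_def by force
    then show ?thesis unfolding word_def by simp
  qed
  show W2: "W s (Y k')"
  proof (cases "k' = v")
    case True then show ?thesis using sk cutD(5) unfolding word_def cut_height_def by auto
  next
    case False
    then have "C (Y k')" using post unfolding cross_heights_def by force
    then show ?thesis unfolding word_def by simp
  qed
  \<comment> \<open>A chord of a single point would mean crossing the line and returning at once to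
    the point of departure, against injectivity. If the point were \<open>u\<close> or
    \<open>v\<close>, there would be a crossing right next to that end of the curve.\<close>
  have "k \<noteq> k'"
  proof
    assume e: "k = k'"
    have "k \<noteq> u" 
    proof
      assume "k = u" then show False using c(6) cutD(1,6) e sk unfolding crosses_def by (cases "k' = v") auto
    qed
    moreover have "k \<noteq> v" 
    proof
      assume "k = v" then show False using c(5) cutD(1,7) sk unfolding crosses_def by (cases "k = u") auto
    qed
    ultimately have a: "u \<le> k - 1 \<and> k - 1 \<le> v - 1 \<and> crosses X m (k - 1)" and b: "k \<le> v - 1" "crosses X m k"
      using pre post e by auto
    have "X (k - 1) = X (k + 1)" "Y (k - 1) = Y (k + 1)"
      using cr[of "k-1"] cr[of k] a b c(1) by auto
    moreover have "k - 1 \<le> v" "u \<le> k + 1" "k + 1 \<le> v" using a b zero_less_one[where 'a='z] by linarith+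
    ultimately have "k - 1 = k + 1" using inj[of "k - 1" "k + 1"] a by blast
    then show False using zero_less_one[where 'a='z] by linarith
  qed
  then show kk': "k < k'" using c(2) by simp
  have k1: "k + 1 \<le> k'" "k \<le> k' - 1" using kk' less_iff_le[of k k'] by (auto simp: le_diff_eq)
  \<comment> \<open>By \<open>cross_index\<close> a crossing at the height of \<open>j\<close> is
    step \<open>j\<close> or step \<open>j - 1\<close>, so the direction can be read off these two
    steps.\<close>
  have dW: "d (Y j) = (\<not> (j < v \<and> crosses X m j \<and> (m < X j) = s0 \<or> u < j \<and> crosses X m (j - 1) \<and> (m < X (j - 1)) = s0))"
    if j: "u \<le> j" "j \<le> v" "X j = line_col m (m < X j)" for j
  proof
    assume "d (Y j)"
    then have no: "\<not> (crosses X m l \<and> (m < X l) = s0 \<and> Y l = Y j)" if "u \<le> l" "l \<le> v - 1" for l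
      using that unfolding forward_def by auto
    show "\<not> (j < v \<and> crosses X m j \<and> (m < X j) = s0 \<or> u < j \<and> crosses X m (j - 1) \<and> (m < X (j - 1)) = s0)"
    proof (intro notI, elim disjE conjE)
      assume "j < v" "crosses X m j" "(m < X j) = s0"
      then show False using no[of j] j less_iff_le[of j v] by (auto simp: algebra_simps)
    next
      assume "u < j" "crosses X m (j - 1)" "(m < X (j-1)) = s0"
      then show False using no[of "j-1"] j less_iff_le[of u j] cr(1)[of "j-1"] by (auto simp: algebra_simps)
    qed
  next
    assume R: "\<not> (j < v \<and> crosses X m j \<and> (m < X j) = s0 \<or> u < j \<and> crosses X m (j - 1) \<and> (m < X (j - 1)) = s0)"
    show "d (Y j)" unfolding forward_def
    proof (intro notI, elim bexE conjE)
      fix l assume l: "l \<in> {u..v-1}" "crosses X m l" "(m < X l) = s0" "Y l = Y j"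
      then have "j = (if (m < X j) = (m < X l) then l else l + 1)"
        using cross_index[of l j] j by auto
      moreover have "l < v" "u < l + 1" using l(1) less_iff_le[of l v] less_iff_le[of u "l+1"] by (auto simp: algebra_simps)
      ultimately show False using R l by (auto split: if_splits)
    qed
  qed
  have colk: "X k = line_col m (m < X k)" "X k' = line_col m (m < X k')" using Xk Xk' sk by auto
  have nk: "\<not> crosses X m k" "\<not> crosses X m (k' - 1)"
    using c(4)[of k] c(4)[of "k+1"] c(4)[of k'] c(4)[of "k'-1"] k1 c(2) unfolding crosses_def by auto
  have dk: "d (Y k) = (\<not> (u < k \<and> crosses X m (k - 1) \<and> (m < X (k - 1)) = s0))"
    using dW[of k] c colk nk by auto
  have dk': "d (Y k') = (\<not> (k' < v \<and> crosses X m k' \<and> (m < X k') = s0))"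
    using dW[of k'] c colk nk by auto
  show "d (Y k) \<noteq> d (Y k')"
  proof (cases "s = s0")
    case True
    then have "k' \<noteq> v" using sk cutD(5) by auto
    then have "k' < v" using c(3) by simp
    then have "\<not> d (Y k')" using dk' post sk True by auto
    moreover have "d (Y k)" using dk c(5) True by auto
    ultimately show ?thesis by simp
  next
    case False
    then have "k \<noteq> u" using sk by auto
    then have "u < k" using c(1) by simp
    then have "\<not> d (Y k)" using dk pre sk False c(5) by auto
    moreover have "d (Y k')" using dk' sk False by auto
    ultimately show ?thesis by simp
  qed
qed

text \<open>By maximality: if one chord started or ended strictly inside the other, the next point
  beyond that end would still be on side \<open>s\<close>.\<close>

lemma chord_disjoint:
  assumes c: "chord X m u v s k k'" and c': "chord X m u v s l l'"
  shows "(k = l \<and> k' = l') \<or> k' < l \<or> l' < k"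
proof (rule ccontr)
  assume no: "\<not> ?thesis"
  have A: "k = l" if "k \<le> l" "l \<le> k'" "chord X m u v s k k'" "chord X m u v s l l'" for k k' l l'
  proof (rule ccontr)
    assume "k \<noteq> l"
    then have "k < l" "u \<le> k" using that unfolding chord_def by auto
    then have "k \<le> l - 1" "l \<noteq> u" "l - 1 \<le> k'"
      using that(2) less_iff_le[of k l] zero_less_one[where 'a='z] by (simp add: le_diff_eq, simp, linarith)
    then show False using that unfolding chord_def by auto
  qed
  have B: "k' = l'" if "k' \<le> l'" "l \<le> k'" "chord X m u v s k k'" "chord X m u v s l l'" for k k' l l'
  proof (rule ccontr)
    assume "k' \<noteq> l'"
    then have "k' < l'" "l' \<le> v" using that unfolding chord_def by auto
    then have "k' + 1 \<le> l'" "k' \<noteq> v" "l \<le> k' + 1"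
      using that(2) less_iff_le[of k' l'] zero_less_one[where 'a='z] by (simp, simp, linarith)
    then show False using that unfolding chord_def by auto
  qed
  have "k = l" using A[OF _ _ c c'] A[OF _ _ c' c] no by force
  moreover have "k' = l'" using B[OF _ _ c c'] B[OF _ _ c' c] no c c' unfolding chord_def by force
  ultimately show False using no by simp
qed

lemma mate_exists:
  assumes "W s h"
  obtains k k' where "chord X m u v s k k'" "h = Y k \<or> h = Y k'"
proof -
  from word_point[OF assms] obtain k where k: "u \<le> k" "k \<le> v" "X k = line_col m s" "Y k = h" "(m < X k) = s"
    "(k = u \<or> (m < X (k - 1)) \<noteq> s) \<or> (k = v \<or> (m < X (k + 1)) \<noteq> s)" by blast
  show thesis
  proof (cases "k = u \<or> (m < X (k - 1)) \<noteq> s")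
    case True
    from chord_end[OF FX k(2,5)] obtain b where "k \<le> b" "b \<le> v" "\<And>l. k \<le> l \<Longrightarrow> l \<le> b \<Longrightarrow> (m < X l) = s"
      "b = v \<or> (m < X (b + 1)) \<noteq> s" by blast
    then have "chord X m u v s k b" unfolding chord_def using True k by auto
    then show thesis using that k by blast
  next
    case False
    from chord_start[OF FX k(1,5)] obtain a where "u \<le> a" "a \<le> k" "\<And>l. a \<le> l \<Longrightarrow> l \<le> k \<Longrightarrow> (m < X l) = s"
      "a = u \<or> (m < X (a - 1)) \<noteq> s" by blast
    then have "chord X m u v s a k" unfolding chord_def using False k by auto
    then show thesis using that k by blast
  qed
qed

end

end

section \<open>The status along a path that is disjoint from a cut curve\<close>

context definability begin

lemma D_status:
  assumes "D (\<lambda>e. W (e 0))" "D (\<lambda>e. d (e 0))" "F f"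
  shows "D (\<lambda>e. status W d \<beta> (f e))"
proof -
  have "D (\<lambda>e. status W d \<beta> (e 0))"
    unfolding status_def by (intro dfn D_comp[OF assms(1)] D_comp[OF assms(2)])
  then show ?thesis by (rule D_comp[OF _ assms(3)])
qed

lemma status_near:
  assumes W: "D (\<lambda>e. W (e 0))" and W0: "\<And>h. W h \<Longrightarrow> 0 \<le> h"
    and no: "\<And>h. W h \<Longrightarrow> \<not> between z z' h \<and> h \<noteq> z \<and> h \<noteq> z'"
  shows "status W d \<beta> z = status W d \<beta> z'"
proof -
  have A: "status W d \<beta> z = status W d \<beta> z'" if "z < z'"
    and no: "\<And>h. W h \<Longrightarrow> \<not> between z z' h \<and> h \<noteq> z \<and> h \<noteq> z'" for z z'
  proof (cases "\<exists>h. W h \<and> h < z")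
    case True
    then obtain h where h: "W h" "h < z" by auto
    from next_below[OF W W0[OF h(1)] h] obtain l where l: "W l" "l < z" "\<And>j. l < j \<Longrightarrow> j < z \<Longrightarrow> \<not> W j"
      by blast
    have "status W d \<beta> z = (d l = \<beta>)" by (rule statusI) (use l W0 in auto)
    moreover have "status W d \<beta> z' = (d l = \<beta>)"
    proof (rule statusI)
      fix g assume "l < g" "g < z'"
      then show "\<not> W g" using no[of g] l(3)[of g] unfolding between_def by (metis linorder_neqE)
    qed (use l W0 that in auto)
    ultimately show ?thesis by simp
  next
    case False
    then have "z' \<le> g" if "W g" for g
      using that no[OF that] unfolding between_def by (metis linorder_neqE not_le)
    moreover from this have "z \<le> g" if "W g" for g using that \<open>z < z'\<close> by force
    ultimately have "\<not> status W d \<beta> z" "\<not> status W d \<beta> z'" by (blast intro!: status_none)+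
    then show ?thesis by simp
  qed
  show ?thesis
    using A[of z z'] A[of z' z] no unfolding between_def by (metis linorder_neqE)
qed

context
  fixes X Y :: "'z \<Rightarrow> 'z" and m n u v :: 'z
  assumes FX: "F (\<lambda>e. X (e 0))" and FY: "F (\<lambda>e. Y (e 0))"
    and bX: "\<And>k. 0 \<le> X k \<and> X k \<le> n" and bY: "\<And>k. 0 \<le> Y k"
    and cut: "cut_curve X Y m u v"
begin

private abbreviation "Cu \<equiv> cross_heights X Y m u v"
private abbreviation "du \<equiv> forward X Y m u v"
private abbreviation "Wu \<equiv> word X Y m u v"

private lemma inj2: "u \<le> k \<Longrightarrow> k \<le> v \<Longrightarrow> u \<le> l \<Longrightarrow> l \<le> v \<Longrightarrow> X k = X l \<Longrightarrow> Y k = Y l \<Longrightarrow> k = l"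
  using cut unfolding cut_curve_def inj_path_def by auto

private lemma P: "path_on X Y u v"
  using cut unfolding cut_curve_def by auto

text \<open>Distinct chords occupy disjoint ranges of indices, hence disjoint sets of points by
  injectivity, and \<open>noncrossing_side\<close> applies.\<close>

lemma mates_noncrossing:
  assumes "mates X Y m u v s h h'" "mates X Y m u v s g g'"
  shows "(g = h \<and> g' = h') \<or> (g = h' \<and> g' = h) \<or>
       (g \<noteq> h \<and> g \<noteq> h' \<and> g' \<noteq> h \<and> g' \<noteq> h' \<and> between h h' g = between h h' g')"
proof -
  from assms(1) obtain k k' where c: "chord X m u v s k k'" and h: "h = Y k \<and> h' = Y k' \<or> h = Y k' \<and> h' = Y k"
    unfolding mates_def by auto
  from assms(2) obtain l l' where c': "chord X m u v s l l'" and g: "g = Y l \<and> g' = Y l' \<or> g = Y l' \<and> g' = Y l"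
    unfolding mates_def by auto
  from chord_disjoint[OF FX FY bX bY cut c c'] consider (eq) "k = l" "k' = l'" | (dj) "k' < l \<or> l' < k" by blast
  then show ?thesis
  proof cases
    case eq then show ?thesis using h g by auto
  next
    case dj
    have k: "u \<le> k" "k \<le> k'" "k' \<le> v" "\<And>j. k \<le> j \<Longrightarrow> j \<le> k' \<Longrightarrow> (m < X j) = s"
      and l: "u \<le> l" "l \<le> l'" "l' \<le> v" "\<And>j. l \<le> j \<Longrightarrow> j \<le> l' \<Longrightarrow> (m < X j) = s"
      using c c' unfolding chord_def by auto
    note cp = chord_props[OF FX FY bX bY cut c] and cp' = chord_props[OF FX FY bX bY cut c']
    have ne: "\<not> (X p = X q \<and> Y p = Y q)" if "k \<le> p" "p \<le> k'" "l \<le> q" "q \<le> l'" for p q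
      using inj2[of p q] that k l dj by force
    have "disjoint_on X Y k k' X Y l l'" using ne unfolding disjoint_on_def by auto
    then have b: "between (Y k) (Y k') (Y l) = between (Y k) (Y k') (Y l')"
      using noncrossing_side[OF FX FY FX FY bX k(2) path_on_sub[OF P k(1,3)] k(4) cp(1,2)
            l(2) path_on_sub[OF P l(1,3)] l(4) cp'(1,2)] by blast
    have "Y k \<noteq> Y l" "Y k \<noteq> Y l'" "Y k' \<noteq> Y l" "Y k' \<noteq> Y l'"
      using ne[of k l] ne[of k l'] ne[of k' l] ne[of k' l'] cp(1,2) cp'(1,2) k(2) l(2) by auto
    moreover have "between (Y k') (Y k) z = between (Y k) (Y k') z" for z unfolding between_def by auto
    ultimately show ?thesis using h g b by metis
  qed
qed

lemma mates_directions: "mates X Y m u v s h h' \<Longrightarrow> du h \<noteq> du h'"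
  using chord_props(6)[OF FX FY bX bY cut] unfolding mates_def by blast

context
  fixes X2 Y2 :: "'z \<Rightarrow> 'z" and \<beta> :: bool
  assumes FX2: "F (\<lambda>e. X2 (e 0))" and FY2: "F (\<lambda>e. Y2 (e 0))"
    and alt: "\<And>s. alternating (Wu s) du" and bot: "\<And>s. bottom_dir (Wu s) du \<beta>"
begin

text \<open>The stretch of the second path does not interlace with any chord of the cut curve on the
  same side. So the letters between its end heights are matched among themselves, as
  \<open>status_matched\<close> requires.\<close>

lemma status_chord:
  assumes k: "k0 \<le> k1" "path_on X2 Y2 k0 k1" "\<And>l. k0 \<le> l \<Longrightarrow> l \<le> k1 \<Longrightarrow> (m < X2 l) = s"
    "X2 k0 = line_col m s" "X2 k1 = line_col m s"
    and dj: "disjoint_on X Y u v X2 Y2 k0 k1"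
  shows "status (Wu s) du \<beta> (Y2 k0) = status (Wu s) du \<beta> (Y2 k1)"
proof -
  have notW: "\<not> Wu s (Y2 l)" if "l = k0 \<or> l = k1" for l
  proof
    assume "Wu s (Y2 l)"
    from word_point[OF FX FY bX bY cut this] obtain j where "u \<le> j" "j \<le> v" "X j = line_col m s" "Y j = Y2 l" by metis
    then show False using dj that k unfolding disjoint_on_def by auto
  qed
  have nc: "between (Y2 k0) (Y2 k1) (Y p) = between (Y2 k0) (Y2 k1) (Y q)" if c: "chord X m u v s p q" for p q
  proof -
    have pq: "u \<le> p" "p \<le> q" "q \<le> v" "\<And>j. p \<le> j \<Longrightarrow> j \<le> q \<Longrightarrow> (m < X j) = s"
      using c unfolding chord_def by auto
    note cp = chord_props[OF FX FY bX bY cut c]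
    have "between (Y p) (Y q) (Y2 k0) = between (Y p) (Y q) (Y2 k1)"
      using noncrossing_side[OF FX FY FX2 FY2 bX pq(2) path_on_sub[OF P pq(1,3)] pq(4) cp(1,2)
            k(1,2,3,4,5) disjoint_on_sub[OF dj pq(1,3)]] by blast
    moreover have "Y p \<noteq> Y2 k0" "Y p \<noteq> Y2 k1" "Y q \<noteq> Y2 k0" "Y q \<noteq> Y2 k1"
      using notW cp(3,4) by metis+
    ultimately show ?thesis using between_chords_sym by blast
  qed
  have main: "status (Wu s) du \<beta> z = status (Wu s) du \<beta> z'"
    if z: "z = Y2 k0 \<and> z' = Y2 k1 \<or> z = Y2 k1 \<and> z' = Y2 k0" and "z < z'" for z z'
  proof (rule status_matched[where M="mates X Y m u v s"])
    show "D (\<lambda>e. Wu s (e 0))" by (rule D_W[OF FX FY bX bY cut])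
    show "D (\<lambda>e. du (e 0))" by (rule D_d[OF FX FY bX bY cut])
    show "D (\<lambda>e. mates X Y m u v s (e 0) (e 1))" by (rule D_mates[OF FX FY bX bY cut])
    show "\<And>h. Wu s h \<Longrightarrow> 0 \<le> h" by (rule W_pos[OF FX FY bX bY cut])
    show "\<not> Wu s z" "\<not> Wu s z'" using z notW by auto
    fix h assume h: "Wu s h" "z < h" "h < z'"
    from mate_exists[OF FX FY bX bY cut h(1)] obtain p q where c: "chord X m u v s p q" and hp: "h = Y p \<or> h = Y q"
      by blast
    define h' where "h' = (if h = Y p then Y q else Y p)"
    have b: "between z z' (Y p) = between z z' (Y q)"
      using nc[OF c] z unfolding between_def by auto
    moreover have "between z z' h" using h unfolding between_def by simp
    ultimately have "between z z' h'" using hp unfolding h'_def by (auto split: if_splits)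
    then have "z < h'" "h' < z'" using \<open>z < z'\<close> unfolding between_def by auto
    moreover have "Wu s h'" using chord_props(3,4)[OF FX FY bX bY cut c] unfolding h'_def by auto
    moreover have "mates X Y m u v s h h'"
      unfolding mates_def
    proof (rule bexI[of _ p], rule bexI[of _ q])
      show "p \<in> {u..v}" "q \<in> {u..v}" using c unfolding chord_def by auto
    qed (use c hp h'_def in auto)
    ultimately show "\<exists>h'. Wu s h' \<and> z < h' \<and> h' < z' \<and> mates X Y m u v s h h'" by blast
  qed (fact alt bot \<open>z < z'\<close> mates_directions mates_noncrossing)+
  show ?thesis
  proof (cases "Y2 k0" "Y2 k1" rule: linorder_cases)
    case less show ?thesis by (rule main[OF _ less]) simp
  next
    case equal then show ?thesis by simp
  next
    case greater show ?thesis by (rule main[OF _ greater, symmetric]) simp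
  qed
qed

text \<open>Within a stretch on one side \<open>status_chord\<close> applies. At a crossing the
  height stays and only the side changes, hence only the place of the cut letter; by
  \<open>tight\<close> the letter does not pass this height when it moves between \<open>Y u\<close>
  and \<open>Y v\<close>.\<close>

lemma status_along_path:
  assumes uv: "u' \<le> v'" "path_on X2 Y2 u' v'"
    and ends: "X2 u' = line_col m (m < X2 u')" "X2 v' = line_col m (m < X2 v')"
    and dj: "disjoint_on X Y u v X2 Y2 u' v'"
    and tight: "\<And>k. u' \<le> k \<Longrightarrow> k < v' \<Longrightarrow> crosses X2 m k \<Longrightarrow> \<not> between (Y u) (Y v) (Y2 k)"
  shows "status (Wu (m < X2 v')) du \<beta> (Y2 v') = status (Wu (m < X2 u')) du \<beta> (Y2 u')"
proof -
  define c where "c = status (Wu (m < X2 u')) du \<beta> (Y2 u')"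
  \<comment> \<open>\<open>D_status\<close> is applied to a word seen from a fixed side, so the two
    sides are listed separately to keep the induction predicate definable.\<close>
  define Q where "Q k \<longleftrightarrow> (m < X2 k \<longrightarrow> status (Wu True) du \<beta> (Y2 k) = c) \<and> (\<not> m < X2 k \<longrightarrow> status (Wu False) du \<beta> (Y2 k) = c)" for k
  have Q: "Q k \<longleftrightarrow> status (Wu (m < X2 k)) du \<beta> (Y2 k) = c" for k
    unfolding Q_def by (cases "m < X2 k") auto
  have "k \<le> v' \<and> X2 k = line_col m (m < X2 k) \<longrightarrow> Q k" if "u' \<le> k" for k
  proof (rule strong_induct[where P="\<lambda>k. k \<le> v' \<and> X2 k = line_col m (m < X2 k) \<longrightarrow> Q k"])
    have e: "(X2 k = line_col m (m < X2 k)) \<longleftrightarrow> (X2 k = m \<or> X2 k = m + 1)" for k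
      unfolding line_col_def by auto
    show "D (\<lambda>e. e 0 \<le> v' \<and> X2 (e 0) = line_col m (m < X2 (e 0)) \<longrightarrow> Q (e 0))"
      unfolding e Q_def
      by (intro dfn F_comp[OF FX2] F_comp[OF FY2] D_status D_W[OF FX FY bX bY cut] D_d[OF FX FY bX bY cut])
    show "u' \<le> k" by fact
  next
    fix k assume k: "u' \<le> k" and IH: "\<And>l. u' \<le> l \<Longrightarrow> l < k \<Longrightarrow> l \<le> v' \<and> X2 l = line_col m (m < X2 l) \<longrightarrow> Q l"
    show "k \<le> v' \<and> X2 k = line_col m (m < X2 k) \<longrightarrow> Q k"
    proof (intro impI, elim conjE)
      assume kv: "k \<le> v'" and Xk: "X2 k = line_col m (m < X2 k)"
      \<comment> \<open>The current stretch is followed back to its start \<open>a\<close>. Either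
        this is the start of the path, or step \<open>a - 1\<close> is a crossing and the induction
        hypothesis applies to the point before it.\<close>
      from chord_start[OF FX2 k refl] obtain a where a: "u' \<le> a" "a \<le> k"
        "\<And>l. a \<le> l \<Longrightarrow> l \<le> k \<Longrightarrow> (m < X2 l) = (m < X2 k)" "a = u' \<or> (m < X2 (a - 1)) \<noteq> (m < X2 k)"
        by blast
      have sa: "(m < X2 a) = (m < X2 k)" by (rule a(3)[OF order.refl a(2)])
      have av: "a \<le> v'" by (rule order.trans[OF a(2) kv])
      have "X2 a = line_col m (m < X2 a) \<and> Q a"
      proof (cases "a = u'")
        case True
        show ?thesis unfolding Q c_def True using ends(1) by blast
      next
        case False
        then have l: "u' \<le> a - 1" "a - 1 < a" using a(1) less_iff_le[of u' a] by (auto simp: le_diff_eq)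
        have lv: "a - 1 < v'" using l av by linarith
        have cr: "crosses X2 m (a - 1)" using a(4) False sa unfolding crosses_def by auto
        note cp = crosses_point[OF path_on_adj[OF uv(2) l(1) lv] cr, unfolded diff_add_cancel]
        have "Q (a - 1)"
          by (intro IH[THEN mp] conjI cp(2)) (use lv l a(2) in linarith)+
        moreover have djp: "\<not> (X w = X2 b \<and> Y w = Y2 b)" if "u \<le> w" "w \<le> v" "u' \<le> b" "b \<le> v'" for w b
          using dj that unfolding disjoint_on_def by auto
        have z: "Y2 a \<noteq> Y w" if w: "u \<le> w" "w \<le> v" "X w = line_col m s" for w s
        proof (cases "(m < X2 a) = s")
          case True
          from cp(3)[unfolded True] w(3) djp[OF w(1,2) a(1) av] show ?thesis by metis
        next
          case False
          then have "(m < X2 (a - 1)) = s" using cr unfolding crosses_def by auto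
          from cp(2)[unfolded this] w(3) cp(1) djp[OF w(1,2) l(1) less_imp_le[OF lv]] show ?thesis by metis
        qed
        have uvc: "u < v" "X u = line_col m (m < X u)" "X v = line_col m (m < X v)"
          using cut unfolding cut_curve_def by blast+
        have zz: "Y2 a \<noteq> Y u" "Y2 a \<noteq> Y v"
          by (rule z[OF _ _ uvc(2)] z[OF _ _ uvc(3)]; use uvc(1) in simp)+
        have "status (Wu (m < X2 (a-1))) du \<beta> (Y2 a) = status (Wu (m < X2 a)) du \<beta> (Y2 a)"
          by (rule status_sides[OF FX FY bX bY cut _ zz]) (use tight[OF l(1) lv cr] cp(1) in simp)
        ultimately have "Q a" unfolding Q using cp(1) by simp
        then show ?thesis using cp(3) by blast
      qed
      then have Qa: "Q a" and "X2 a = line_col m (m < X2 a)" by blast+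
      then have Xa: "X2 a = line_col m (m < X2 k)" unfolding sa by blast
      have "status (Wu (m < X2 k)) du \<beta> (Y2 a) = status (Wu (m < X2 k)) du \<beta> (Y2 k)"
        by (rule status_chord[OF a(2) path_on_sub[OF uv(2) a(1) kv] a(3) Xa Xk disjoint_on_sub[OF dj _ _ a(1) kv]]) auto
      then show "Q k" using Qa unfolding Q sa by simp
    qed
  qed
  from this[OF uv(1)] ends(2) have "Q v'" by blast
  then show ?thesis unfolding Q c_def .
qed

end

lemma status_above_cut:
  assumes "cut_height X Y m u v s < z" "\<And>g. cut_height X Y m u v s < g \<Longrightarrow> g < z \<Longrightarrow> \<not> Cu g"
  shows "status (Wu s) du \<beta> z = \<beta>"
  unfolding word_as_fun[OF FX FY bX bY cut]
  by (rule status_above[where a="cut_height X Y m u v s" and b="cut_height X Y m u v s"])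
    (use assms cross_heights_tight[OF FX FY bX bY cut] forward_cut[OF FX FY bX bY cut] bY in
      \<open>auto simp: cut_height_def\<close>)

lemma status_below_cut:
  assumes "alternating (Wu s) du" "bottom_dir (Wu s) du \<beta>"
    and "z < cut_height X Y m u v s" "\<And>g. z \<le> g \<Longrightarrow> g < cut_height X Y m u v s \<Longrightarrow> \<not> Cu g"
  shows "status (Wu s) du \<beta> z = (\<not> \<beta>)"
  unfolding word_as_fun[OF FX FY bX bY cut]
  by (rule status_below[where a="cut_height X Y m u v s" and b="cut_height X Y m u v s"])
    (use assms cross_heights_tight[OF FX FY bX bY cut] forward_cut[OF FX FY bX bY cut]
      C_pos[OF FX FY bX bY cut] D_C[OF FX FY bX bY cut] in
      \<open>auto simp: word_as_fun[OF FX FY bX bY cut]\<close>)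

end

end

section \<open>Closed curves, given with a period, and their tight pairs\<close>

definition loop_on where
  "loop_on X Y lo hi t \<longleftrightarrow> path_on X Y lo hi \<and> 3 \<le> t \<and>
    (\<forall>k\<in>{lo..hi}. \<forall>l\<in>{lo..hi}. k < l \<and> l < k + t \<longrightarrow> \<not> ((X k :: 'z::linordered_idom) = X (l :: 'z) \<and> (Y k :: 'z) = Y l))"

text \<open>The piece meant is the one from \<open>i + 1\<close> to \<open>j\<close>; the crossings
  \<open>i\<close> and \<open>j\<close> themselves give way to the cut. As they have the same
  direction, the ends of the piece are on opposite sides of the line. The bound
  \<open>j \<le> i + t\<close> keeps the piece within one period, where \<open>loop_on\<close> makes
  its points distinct, and still admits the whole curve, cut open at one crossing.\<close>

definition tight_pair where
  "tight_pair X Y m lo hi t i j \<longleftrightarrow> lo \<le> i \<and> i < j \<and> j + 1 \<le> hi \<and> j \<le> i + t \<and>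
    crosses X m i \<and> crosses X m j \<and> (m < X i) = (m < X j) \<and>
    (\<forall>k\<in>{i+1..j-1}. crosses X m k \<longrightarrow> \<not> between (Y i) (Y j) (Y (k::'z::linordered_idom) :: 'z::linordered_idom))"

lemma line_col_eq: "a = line_col m p \<Longrightarrow> b = line_col m q \<Longrightarrow> p = q \<Longrightarrow> a = b"
  by simp

text \<open>Serves definability: once all letters lie in a fixed interval, bounded quantifiers
  express alternation.\<close>

lemma alternating_bounded:
  assumes "\<And>h. W h \<Longrightarrow> h \<in> {a..b}"
  shows "alternating W d \<longleftrightarrow> (\<forall>h\<in>{a..b}. \<forall>h'\<in>{a..b}. W h \<and> W h' \<and> h < h' \<and>
    (\<forall>g\<in>{h..h'}. h < g \<and> g < h' \<longrightarrow> \<not> W g) \<longrightarrow> d h \<noteq> d h')"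
proof -
  have "(\<forall>g\<in>{h..h'}. h < g \<and> g < h' \<longrightarrow> \<not> W g) \<longleftrightarrow> (\<forall>g. h < g \<and> g < h' \<longrightarrow> \<not> W g)" for h h'
    by (meson atLeastAtMost_iff less_imp_le)
  then show ?thesis unfolding alternating_def using assms by blast
qed

context definability begin

text \<open>The ends of the piece are functions of the valuation because the induction on the length
  quantifies over all pieces. The word is the one seen from the side of the start, with the cut at
  \<open>Y (u e)\<close>; \<open>alternating_start_word\<close> carries the result over to the other
  side.\<close>

lemma D_alternating_word:
  assumes FX: "F (\<lambda>e. X (e 0))" and FY: "F (\<lambda>e. Y (e 0))" and bY: "\<And>k. 0 \<le> Y k \<and> Y k \<le> n"
    and uv: "F u" "F v"
  shows "D (\<lambda>e. alternating (\<lambda>h. cross_heights X Y m (u e) (v e) h \<or> h = Y (u e)) (forward X Y m (u e) (v e)))"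
proof -
  have eq: "alternating (\<lambda>h. cross_heights X Y m u v h \<or> h = Y u) (forward X Y m u v) \<longleftrightarrow>
    (\<forall>h\<in>{0..n}. \<forall>h'\<in>{0..n}. (cross_heights X Y m u v h \<or> h = Y u) \<and>
       (cross_heights X Y m u v h' \<or> h' = Y u) \<and> h < h' \<and>
       (\<forall>g\<in>{h..h'}. h < g \<and> g < h' \<longrightarrow> \<not> (cross_heights X Y m u v g \<or> g = Y u)) \<longrightarrow>
       forward X Y m u v h \<noteq> forward X Y m u v h')" for u v
    by (rule alternating_bounded) (use bY in \<open>auto simp: cross_heights_def\<close>)
  have lift: "F (\<lambda>e. f (\<lambda>i. e (Suc i)))" "F (\<lambda>e. f (\<lambda>i. e (Suc (Suc i))))" "F (\<lambda>e. f (\<lambda>i. e (Suc (Suc (Suc i)))))"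
     "F (\<lambda>e. f (\<lambda>i. e (Suc (Suc (Suc (Suc i))))))" if "F f" for f
    using F_ren[OF that, of Suc] F_ren[OF that, of "\<lambda>i. Suc (Suc i)"] F_ren[OF that, of "\<lambda>i. Suc (Suc (Suc i))"]
      F_ren[OF that, of "\<lambda>i. Suc (Suc (Suc (Suc i)))"] by simp_all
  show ?thesis
    unfolding eq unfolding cross_heights_def forward_def crosses_def
    by (intro dfn F_comp[OF FX] F_comp[OF FY] uv lift)
qed

context
  fixes X Y :: "'z \<Rightarrow> 'z" and m n lo hi t :: 'z
  assumes FX: "F (\<lambda>e. X (e 0))" and FY: "F (\<lambda>e. Y (e 0))"
    and bX: "\<And>k. 0 \<le> X k \<and> X k \<le> n" and bY: "\<And>k. 0 \<le> Y k \<and> Y k \<le> n"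
    and loop: "loop_on X Y lo hi t"
begin

private lemma bY0: "0 \<le> Y k" using bY by blast

private lemma t3: "3 \<le> t" using loop unfolding loop_on_def by blast

lemma loop_step:
  assumes "lo \<le> k" "k < hi" "crosses X m k"
  shows "Y (k + 1) = Y k" "X k = line_col m (m < X k)" "X (k + 1) = line_col m (m < X (k + 1))"
    "(m < X (k + 1)) = (\<not> m < X k)"
proof -
  have "path_on X Y lo hi" using loop unfolding loop_on_def by blast
  from crosses_point[OF path_on_adj[OF this assms(1,2)] assms(3)]
  show "Y (k + 1) = Y k" "X k = line_col m (m < X k)" "X (k + 1) = line_col m (m < X (k + 1))" .
  show "(m < X (k + 1)) = (\<not> m < X k)" using assms(3) unfolding crosses_def by blast
qed

lemma loop_distinct:
  assumes "lo \<le> k" "l \<le> hi" "k < l" "l < k + t"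
  shows "\<not> (X k = X l \<and> Y k = Y l)"
proof -
  have "k \<in> {lo..hi}" "l \<in> {lo..hi}" using assms by auto
  then show ?thesis using loop assms unfolding loop_on_def by blast
qed

text \<open>Two successive crossings would lead back to the same point two steps later, and
  \<open>3 \<le> t\<close> makes \<open>k\<close> and \<open>k + 2\<close> indices of different
  points.\<close>

lemma loop_no_return:
  assumes "lo \<le> k" "k + 2 \<le> hi" "crosses X m k" shows "\<not> crosses X m (k + 1)"
proof
  assume c: "crosses X m (k + 1)"
  have k: "k < hi" "lo \<le> k + 1" "k + 1 < hi" using assms zero_less_one[where 'a='z] by linarith+
  have e: "k + 1 + 1 = k + 2" by simp
  note a = loop_step[OF assms(1) k(1) assms(3)]
  note b = loop_step[OF k(2,3) c, unfolded e]
  have "(m < X (k + 2)) = (m < X k)" using a(4) b(4) by blast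
  then have "X (k + 2) = X k" by (intro line_col_eq[OF b(3) a(2)])
  moreover have "Y (k + 2) = Y k" using a(1) b(1) by simp
  ultimately show False using loop_distinct[of k "k + 2"] assms t3 by auto
qed

lemma tight_pair_cut:
  assumes "tight_pair X Y m lo hi t i j"
  shows "cut_curve X Y m (i + 1) j"
proof -
  have ij: "lo \<le> i" "i < j" "j + 1 \<le> hi" "j \<le> i + t" and cr: "crosses X m i" "crosses X m j"
    and dir: "(m < X i) = (m < X j)"
    and tight: "\<And>k. i + 1 \<le> k \<Longrightarrow> k \<le> j - 1 \<Longrightarrow> crosses X m k \<Longrightarrow> \<not> between (Y i) (Y j) (Y k)"
    using assms unfolding tight_pair_def by auto
  have h: "i < hi" "j < hi" "lo \<le> j" "lo \<le> i + 1" "j \<le> hi" using ij zero_less_one[where 'a='z] by linarith+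
  note ci = loop_step[OF ij(1) h(1) cr(1)] and cj = loop_step[OF h(3,2) cr(2)]
  have "j \<noteq> i + 1" using ci(4) dir by auto
  then have ij1: "i + 1 < j" using ij(2) less_iff_le[of i j] by auto
  show ?thesis
    unfolding cut_curve_def
  proof (intro conjI)
    show "i + 1 < j" by fact
    show "path_on X Y (i + 1) j"
      by (rule path_on_sub[of X Y lo hi]) (use loop h in \<open>auto simp: loop_on_def\<close>)
    show "inj_path X Y (i + 1) j" unfolding inj_path_def
    proof (intro ballI impI)
      fix k l assume k: "k \<in> {i+1..j}" "l \<in> {i+1..j}" and e: "X k = X l \<and> Y k = Y l"
      have *: "\<not> p < q" if "p \<in> {i+1..j}" "q \<in> {i+1..j}" "X p = X q \<and> Y p = Y q" for p q
      proof
        assume "p < q"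
        moreover have "lo \<le> p" "q \<le> hi" "q < p + t"
          using that(1,2) h ij zero_less_one[where 'a='z] unfolding atLeastAtMost_iff by linarith+
        ultimately show False using loop_distinct[of p q] that(3) by blast
      qed
      show "k = l" using *[OF k e] *[OF k(2,1)] e by (metis linorder_neqE)
    qed
    show "X (i + 1) = line_col m (m < X (i + 1))" "X j = line_col m (m < X j)" by (rule ci cj)+
    show "(m < X (i + 1)) \<noteq> (m < X j)" using ci(4) dir by blast
    show "\<not> crosses X m (i + 1)"
      by (rule loop_no_return[OF ij(1) _ cr(1)]) (use ij1 ij(3) in linarith)
    show "\<not> crosses X m (j - 1)"
    proof
      assume c: "crosses X m (j - 1)"
      have "lo \<le> j - 1" "j - 1 + 2 \<le> hi" using ij1 ij by linarith+
      from loop_no_return[OF this c] cr(2) show False by simp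
    qed
    show "\<forall>k\<in>{i+1..j-1}. crosses X m k \<longrightarrow> \<not> between (Y (i + 1)) (Y j) (Y k)"
      using tight ci(1) by auto
  qed
qed

text \<open>Crossing \<open>i\<close> leads to the side of \<open>i + 1\<close>, the start of the
  piece, so to be forward is to have the direction of \<open>i\<close>. The height determines the
  crossing (\<open>uniq\<close>), since two crossings at one height would share a point within a
  period.\<close>

lemma forward_cross:
  assumes p: "tight_pair X Y m lo hi t i j" and k: "i < k" "k < j" "crosses X m k"
  shows "forward X Y m (i + 1) j (Y k) \<longleftrightarrow> (m < X k) = (m < X i)"
proof -
  have ij: "lo \<le> i" "i < j" "j + 1 \<le> hi" "j \<le> i + t" "crosses X m i"
    using p unfolding tight_pair_def by auto
  have k': "i + 1 \<le> k" "k \<le> j - 1" using k less_iff_le[of i k] less_iff_le[of k j] by (auto simp: le_diff_eq)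
  have ihi: "i < hi" using ij zero_less_one[where 'a='z] by linarith
  note ci = loop_step[OF ij(1) ihi ij(5)]
  have uniq: "l = k" if l: "i + 1 \<le> l" "l \<le> j - 1" "crosses X m l" "Y l = Y k" for l
  proof -
    have *: "\<not> p < q" if pq: "i + 1 \<le> p" "p \<le> j - 1" "crosses X m p" "i + 1 \<le> q" "q \<le> j - 1" "crosses X m q" "Y p = Y q" for p q
    proof
      assume "p < q"
      have b: "lo \<le> p" "p < hi" "lo \<le> q" "q < hi" "q \<le> hi" "p + 1 \<le> q" "q + 1 \<le> hi" "q < p + t" "q + 1 < p + t" "p < q + 1" "lo \<le> p + 1" "q + 1 < p + 1 + t" "p + 1 < q + 1"
        using pq(1,2,4,5) ij t3 \<open>p < q\<close> less_iff_le[of p q] zero_less_one[where 'a='z] by linarith+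
      note cp = loop_step[OF b(1,2) pq(3)] and cq = loop_step[OF b(3,4) pq(6)]
      show False
      proof (cases "(m < X p) = (m < X q)")
        case True
        then have "X p = X q" by (rule line_col_eq[OF cp(2) cq(2)])
        then show False using loop_distinct[OF b(1,5) \<open>p < q\<close> b(8)] pq(7) by blast
      next
        case False
        then have "(m < X p) = (m < X (q + 1))" using cq(4) by blast
        then have "X p = X (q + 1)" by (rule line_col_eq[OF cp(2) cq(3)])
        then show False using loop_distinct[OF b(1,7,10,9)] pq(7) cq(1) by simp
      qed
    qed
    show ?thesis using *[OF l(1-3) k' k(3) l(4)] *[OF k' k(3) l(1-3) l(4)[symmetric]] by (metis linorder_neqE)
  qed
  show ?thesis
  proof
    assume "forward X Y m (i + 1) j (Y k)"
    then have "\<not> (m < X k) = (m < X (i + 1))" using k' k(3) unfolding forward_def by auto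
    then show "(m < X k) = (m < X i)" using ci(4) by blast
  next
    assume e: "(m < X k) = (m < X i)"
    show "forward X Y m (i + 1) j (Y k)" unfolding forward_def
    proof (intro notI, elim bexE conjE)
      fix l assume l: "l \<in> {i+1..j-1}" "crosses X m l" "(m < X l) = (m < X (i + 1))" "Y l = Y k"
      then have "l = k" using uniq by auto
      then show False using l(3) e ci(4) by blast
    qed
  qed
qed

text \<open>By \<open>sep\<close> the second piece comes after or before the one from
  \<open>p + 1\<close> to \<open>q\<close>, and both together span less than a period; so they have
  no point in common.\<close>

lemma status_along_loop:
  assumes p: "tight_pair X Y m lo hi t p q"
    and alt: "\<And>s. alternating (word X Y m (p + 1) q s) (forward X Y m (p + 1) q)"
    and bot: "\<And>s. bottom_dir (word X Y m (p + 1) q s) (forward X Y m (p + 1) q) \<beta>"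
    and uv: "lo \<le> u'" "u' \<le> v'" "v' \<le> hi"
    and ends: "X u' = line_col m (m < X u')" "X v' = line_col m (m < X v')"
    and sep: "(q < u' \<and> v' < p + 1 + t) \<or> (v' < p + 1 \<and> q < u' + t)"
    and gap: "\<And>k. u' \<le> k \<Longrightarrow> k < v' \<Longrightarrow> crosses X m k \<Longrightarrow> \<not> between (Y p) (Y q) (Y k)"
  shows "status (word X Y m (p + 1) q (m < X v')) (forward X Y m (p + 1) q) \<beta> (Y v') =
     status (word X Y m (p + 1) q (m < X u')) (forward X Y m (p + 1) q) \<beta> (Y u')"
proof (rule status_along_path[OF FX FY bX bY0 tight_pair_cut[OF p] FX FY alt bot uv(2) _ ends])
  have pq: "lo \<le> p" "p < q" "q + 1 \<le> hi" "crosses X m p" using p unfolding tight_pair_def by auto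
  have phi: "p < hi" using pq zero_less_one[where 'a='z] by linarith
  show "path_on X Y u' v'"
    by (rule path_on_sub[of X Y lo hi]) (use loop uv in \<open>auto simp: loop_on_def\<close>)
  show "disjoint_on X Y (p + 1) q X Y u' v'" unfolding disjoint_on_def
  proof (intro ballI)
    fix k l assume "k \<in> {p+1..q}" "l \<in> {u'..v'}"
    then have k: "p + 1 \<le> k" "k \<le> q" and l: "u' \<le> l" "l \<le> v'" by auto
    from sep show "\<not> (X k = X l \<and> Y k = Y l)"
    proof
      assume "q < u' \<and> v' < p + 1 + t"
      then have "lo \<le> k" "l \<le> hi" "k < l" "l < k + t" using k l pq uv zero_less_one[where 'a='z] by linarith+
      then show ?thesis by (rule loop_distinct)
    next
      assume "v' < p + 1 \<and> q < u' + t"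
      then have "lo \<le> l" "k \<le> hi" "l < k" "k < l + t" using k l pq uv zero_less_one[where 'a='z] by linarith+
      then show ?thesis using loop_distinct[of l k] by metis
    qed
  qed
  fix k assume "u' \<le> k" "k < v'" "crosses X m k"
  from gap[OF this] show "\<not> between (Y (p + 1)) (Y q) (Y k)"
    using loop_step(1)[OF pq(1) phi pq(4)] by simp
qed

lemma cross_heightsE:
  assumes "cross_heights X Y m (i + 1) j h"
  obtains k where "i < k" "k < j" "crosses X m k" "Y k = h"
  using assms less_iff_le that unfolding cross_heights_def by (auto simp: le_diff_eq)

lemma cross_heightsI:
  "i < k \<Longrightarrow> k < j \<Longrightarrow> crosses X m k \<Longrightarrow> cross_heights X Y m (i + 1) j (Y k)"
  using less_iff_le unfolding cross_heights_def by (auto simp: le_diff_eq)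

end

end

section \<open>Alternation for tight pairs, by strong induction on the length\<close>

context definability begin

context
  fixes X Y :: "'z \<Rightarrow> 'z" and m n lo hi t :: 'z
  assumes FX: "F (\<lambda>e. X (e 0))" and FY: "F (\<lambda>e. Y (e 0))"
    and bX: "\<And>k. 0 \<le> X k \<and> X k \<le> n" and bY: "\<And>k. 0 \<le> Y k \<and> Y k \<le> n"
    and loop: "loop_on X Y lo hi t"
begin

private lemma bY0': "0 \<le> Y k" using bY by blast

private abbreviation "tight \<equiv> tight_pair X Y m lo hi t"

lemma bottom_dir_pair:
  assumes p: "tight p q"
  obtains \<beta> where "\<And>s. bottom_dir (word X Y m (p + 1) q s) (forward X Y m (p + 1) q) \<beta>"
proof -
  obtain \<beta> where "bottom_dir (word X Y m (p + 1) q True) (forward X Y m (p + 1) q) \<beta>"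
    using bottom_dir_exists by blast
  from that[OF bottom_dir_sides[OF FX FY bX bY0' tight_pair_cut[OF FX FY bX bY loop p] this]]
  show thesis .
qed

text \<open>The cut letter is seen at height \<open>Y p\<close> from the side of
  \<open>p + 1\<close> and at height \<open>Y q\<close> from the side of \<open>q\<close>. The first
  four facts give the status directly above and below it in both views; the last two change the
  height or the side without passing a letter.\<close>

lemma pair_status:
  fixes p q \<beta>
  defines "St s z \<equiv> status (word X Y m (p + 1) q s) (forward X Y m (p + 1) q) \<beta> z"
  assumes p: "tight p q" and alt: "\<And>s. alternating (word X Y m (p + 1) q s) (forward X Y m (p + 1) q)"
    and bot: "\<And>s. bottom_dir (word X Y m (p + 1) q s) (forward X Y m (p + 1) q) \<beta>"
  shows "\<And>z. Y p < z \<Longrightarrow> (\<And>g. Y p < g \<Longrightarrow> g < z \<Longrightarrow> \<not> cross_heights X Y m (p + 1) q g) \<Longrightarrow> St (\<not> m < X p) z = \<beta>"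
    "\<And>z. Y q < z \<Longrightarrow> (\<And>g. Y q < g \<Longrightarrow> g < z \<Longrightarrow> \<not> cross_heights X Y m (p + 1) q g) \<Longrightarrow> St (m < X p) z = \<beta>"
    "\<And>z. z < Y p \<Longrightarrow> (\<And>g. z \<le> g \<Longrightarrow> g < Y p \<Longrightarrow> \<not> cross_heights X Y m (p + 1) q g) \<Longrightarrow> St (\<not> m < X p) z = (\<not> \<beta>)"
    "\<And>z. z < Y q \<Longrightarrow> (\<And>g. z \<le> g \<Longrightarrow> g < Y q \<Longrightarrow> \<not> cross_heights X Y m (p + 1) q g) \<Longrightarrow> St (m < X p) z = (\<not> \<beta>)"
    "\<And>s z z'. (\<And>h. cross_heights X Y m (p + 1) q h \<or> h = Y p \<or> h = Y q \<Longrightarrow> \<not> between z z' h \<and> h \<noteq> z \<and> h \<noteq> z') \<Longrightarrow>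
      St s z = St s z'"
    "\<And>s s' z. \<not> between (Y p) (Y q) z \<Longrightarrow> z \<noteq> Y p \<Longrightarrow> z \<noteq> Y q \<Longrightarrow> St s z = St s' z"
proof -
  have pq: "lo \<le> p" "p < q" "q + 1 \<le> hi" "crosses X m p" using p unfolding tight_pair_def by auto
  have phi: "p < hi" using pq zero_less_one[where 'a='z] by linarith
  note cp = loop_step[OF FX FY bX bY loop pq(1) phi pq(4)]
  note cut = tight_pair_cut[OF FX FY bX bY loop p]
  have h1: "cut_height X Y m (p + 1) q (\<not> m < X p) = Y p" and h2: "cut_height X Y m (p + 1) q (m < X p) = Y q"
    using cp(1,4) unfolding cut_height_def by auto
  have hs: "cut_height X Y m (p + 1) q s = Y p \<or> cut_height X Y m (p + 1) q s = Y q" for s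
    using cp(1) unfolding cut_height_def by auto
  note ab = status_above_cut[OF FX FY bX bY0' cut]
  note be = status_below_cut[OF FX FY bX bY0' cut alt bot]
  show "St (\<not> m < X p) z = \<beta>" if "Y p < z" "\<And>g. Y p < g \<Longrightarrow> g < z \<Longrightarrow> \<not> cross_heights X Y m (p + 1) q g" for z
    using ab[of "\<not> m < X p" z \<beta>, unfolded h1] that unfolding St_def by blast
  show "St (m < X p) z = \<beta>" if "Y q < z" "\<And>g. Y q < g \<Longrightarrow> g < z \<Longrightarrow> \<not> cross_heights X Y m (p + 1) q g" for z
    using ab[of "m < X p" z \<beta>, unfolded h2] that unfolding St_def by blast
  show "St (\<not> m < X p) z = (\<not> \<beta>)" if "z < Y p" "\<And>g. z \<le> g \<Longrightarrow> g < Y p \<Longrightarrow> \<not> cross_heights X Y m (p + 1) q g" for z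
    using be[of z "\<not> m < X p", unfolded h1] that unfolding St_def by blast
  show "St (m < X p) z = (\<not> \<beta>)" if "z < Y q" "\<And>g. z \<le> g \<Longrightarrow> g < Y q \<Longrightarrow> \<not> cross_heights X Y m (p + 1) q g" for z
    using be[of z "m < X p", unfolded h2] that unfolding St_def by blast
  show "St s z = St s z'" if no: "\<And>h. cross_heights X Y m (p + 1) q h \<or> h = Y p \<or> h = Y q \<Longrightarrow> \<not> between z z' h \<and> h \<noteq> z \<and> h \<noteq> z'"
    for s z z' unfolding St_def
  proof (rule status_near[OF D_W[OF FX FY bX bY0' cut]])
    fix h assume w: "word X Y m (p + 1) q s h"
    from W_pos[OF FX FY bX bY0' cut this] show "0 \<le> h" .
    from w hs[of s] have "cross_heights X Y m (p + 1) q h \<or> h = Y p \<or> h = Y q" unfolding word_def by auto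
    from no[OF this] show "\<not> between z z' h \<and> h \<noteq> z \<and> h \<noteq> z'" .
  qed
  show "St s z = St s' z" if "\<not> between (Y p) (Y q) z" "z \<noteq> Y p" "z \<noteq> Y q" for s s' z
    unfolding St_def by (intro status_sides[OF FX FY bX bY0' cut]) (use cp(1) that in auto)
qed

lemma alternating_start_word:
  assumes p: "tight p q" and alt: "alternating (\<lambda>h. cross_heights X Y m (p + 1) q h \<or> h = Y (p + 1)) (forward X Y m (p + 1) q)"
  shows "alternating (word X Y m (p + 1) q s) (forward X Y m (p + 1) q)"
proof -
  note cut = tight_pair_cut[OF FX FY bX bY loop p]
  have "word X Y m (p + 1) q (m < X (p + 1)) = (\<lambda>h. cross_heights X Y m (p + 1) q h \<or> h = Y (p + 1))"
    unfolding word_def cut_height_def by auto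
  then have "alternating (word X Y m (p + 1) q (m < X (p + 1))) (forward X Y m (p + 1) q)"
    using alt by simp
  from alternating_sides[OF FX FY bX bY0' cut this] show ?thesis .
qed

lemma tight_pair_ends:
  assumes p: "tight i j" and C: "cross_heights X Y m (i + 1) j h"
  shows "\<not> between (Y i) (Y j) h" "h \<noteq> Y i" "h \<noteq> Y j"
proof -
  have ij: "lo \<le> i" "i < j" "j + 1 \<le> hi" "crosses X m i" using p unfolding tight_pair_def by auto
  have "i < hi" using ij zero_less_one[where 'a='z] by linarith
  note c = loop_step[OF FX FY bX bY loop ij(1) this ij(4)]
  from cross_heights_not_ends[OF FX FY bX bY0' tight_pair_cut[OF FX FY bX bY loop p] C]
  show "\<not> between (Y i) (Y j) h" "h \<noteq> Y i" "h \<noteq> Y j" using c(1) by auto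
qed

lemma cross_heights_mono:
  "i \<le> p \<Longrightarrow> q \<le> j \<Longrightarrow> cross_heights X Y m (p + 1) q h \<Longrightarrow> cross_heights X Y m (i + 1) j h"
  unfolding cross_heights_def by (auto intro!: bexI)

lemma tight_sub:
  assumes "tight i j" "i \<le> p" "p < q" "q \<le> j" "crosses X m p" "crosses X m q" "(m < X p) = (m < X q)"
    and "\<And>g. cross_heights X Y m (p + 1) q g \<Longrightarrow> \<not> between (Y p) (Y q) g"
  shows "tight p q"
  using assms unfolding tight_pair_def cross_heights_def by auto

text \<open>The piece from \<open>i + 1\<close> to \<open>k\<close> is shorter, so it alternates and
  defines a status. The rest, from \<open>k + 1\<close> to \<open>j\<close>, is disjoint from it and
  never crosses the line between the heights \<open>Y i\<close> and \<open>Y k\<close>, so the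
  status at its two ends agrees. But one of these ends lies directly above the cut letter of the
  shorter piece and the other directly below it, each in the view from its own side.\<close>

lemma star_case:
  assumes ij: "tight i j" and k: "i < k" "k < j" "crosses X m k" "(m < X k) = (m < X i)"
    and IH: "\<And>p q. tight p q \<Longrightarrow> q - p < j - i \<Longrightarrow>
      alternating (\<lambda>h. cross_heights X Y m (p + 1) q h \<or> h = Y (p + 1)) (forward X Y m (p + 1) q)"
    and gap: "\<And>g. cross_heights X Y m (i + 1) j g \<Longrightarrow> \<not> between (Y i) (Y k) g"
  shows False
proof -
  have t: "lo \<le> i" "i < j" "j + 1 \<le> hi" "j \<le> i + t" "crosses X m i" "crosses X m j" "(m < X i) = (m < X j)"
    using ij unfolding tight_pair_def by auto
  have b: "i < hi" "lo \<le> k" "k < hi" "lo \<le> k + 1" "k + 1 \<le> j" "j \<le> hi" "j < i + 1 + t" "k < k + 1" "lo \<le> j" "j < hi"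
    using t k less_iff_le[of k j] zero_less_one[where 'a='z] by linarith+
  note ci = loop_step[OF FX FY bX bY loop t(1) b(1) t(5)]
  note ck = loop_step[OF FX FY bX bY loop b(2,3) k(3)]
  note cj = loop_step[OF FX FY bX bY loop b(9,10) t(6)]
  have sub: "cross_heights X Y m (i + 1) k g \<Longrightarrow> cross_heights X Y m (i + 1) j g" for g
    using cross_heights_mono[OF order.refl less_imp_le[OF k(2)]] .
  have p: "tight i k"
    by (rule tight_sub[OF ij]) (use k t gap sub in auto)
  have alt: "alternating (word X Y m (i + 1) k s) (forward X Y m (i + 1) k)" for s
    by (rule alternating_start_word[OF p IH[OF p]]) (use k in simp)
  obtain \<beta> where bot: "\<And>s. bottom_dir (word X Y m (i + 1) k s) (forward X Y m (i + 1) k) \<beta>"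
    using bottom_dir_pair[OF p] by blast
  define St where "St s z = status (word X Y m (i + 1) k s) (forward X Y m (i + 1) k) \<beta> z" for s z
  note St = St_def
  note ps = pair_status[OF p alt bot, folded St_def]
  note a1 = ps(1) and a2 = ps(2) and b1 = ps(3) and b2 = ps(4) and near = ps(5) and sides = ps(6)
  have "status (word X Y m (i + 1) k (m < X j)) (forward X Y m (i + 1) k) \<beta> (Y j) =
     status (word X Y m (i + 1) k (m < X (k + 1))) (forward X Y m (i + 1) k) \<beta> (Y (k + 1))"
  proof (rule status_along_loop[OF FX FY bX bY loop p alt bot b(4,5,6) ck(3) cj(2)])
    show "(k < k + 1 \<and> j < i + 1 + t) \<or> (j < i + 1 \<and> k < k + 1 + t)" using b(7,8) by simp
    fix l assume l: "k + 1 \<le> l" "l < j" "crosses X m l"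
    have "i < l" using l(1) k(1) b(8) by linarith
    from cross_heightsI[OF FX FY bX bY loop this l(2,3)] show "\<not> between (Y i) (Y k) (Y l)" by (rule gap)
  qed
  then have eq: "St (m < X i) (Y j) = St (\<not> m < X i) (Y k)"
    using St ck(1,4) k(4) t(7) by simp
  have Ck: "cross_heights X Y m (i + 1) j (Y k)"
    by (rule cross_heightsI[OF FX FY bX bY loop k(1-3)])
  note e1 = tight_pair_ends[OF ij] and e2 = tight_pair_ends[OF p]
  have no: "\<not> cross_heights X Y m (i + 1) k g" if "between (Y i) (Y k) g \<or> between (Y j) (Y k) g \<or> g = Y j \<or> g = Y k" for g
  proof
    assume C: "cross_heights X Y m (i + 1) k g"
    from e2[OF C] e1[OF sub[OF C]] e1[OF Ck] that show False
      unfolding between_def by (auto simp: not_less)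
  qed
  \<comment> \<open>No crossing of the whole piece separates \<open>Y i\<close> from
    \<open>Y j\<close>, so \<open>Y k\<close> is above both or below both.\<close>
  have kij: "Y k \<noteq> Y i" "Y i < Y k \<longleftrightarrow> Y j < Y k" "Y j \<noteq> Y k"
    using e1[OF Ck] unfolding between_def by (auto simp: not_less)
  show False
  proof (cases "Y i < Y k")
    case True
    have "St (\<not> m < X i) (Y k) = \<beta>" by (rule a1[OF True]) (use no in \<open>auto simp: between_def\<close>)
    moreover have "St (m < X i) (Y j) = (\<not> \<beta>)"
      by (rule b2) (use True kij no in \<open>auto simp: between_def order.order_iff_strict\<close>)
    ultimately show False using eq by simp
  next
    case False
    then have lt: "Y k < Y i" "Y k < Y j" using kij by auto
    have "St (\<not> m < X i) (Y k) = (\<not> \<beta>)"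
      by (rule b1[OF lt(1)]) (use no in \<open>auto simp: between_def order.order_iff_strict\<close>)
    moreover have "St (m < X i) (Y j) = \<beta>"
      by (rule a2[OF lt(2)]) (use no in \<open>auto simp: between_def\<close>)
    ultimately show False using eq by simp
  qed
qed

text \<open>The piece from \<open>k + 1\<close> to \<open>l\<close> is shorter and defines a status.
  Two parts of the curve remain, from \<open>l + 1\<close> to \<open>j\<close> and from
  \<open>i + 1\<close> to \<open>k\<close>. Each of them keeps the status, and so does the jump
  along the line from \<open>j\<close> to \<open>i + 1\<close>, because no letter of the shorter
  word separates \<open>Y j\<close> from \<open>Y i\<close>. So \<open>l + 1\<close> and
  \<open>k\<close> have the same status, although one lies directly above the cut letter and the
  other directly below it.\<close>

lemma crossing_case:
  assumes ij: "tight i j" and k: "i < k" "k < l" "l < j" "crosses X m k" "crosses X m l" "(m < X k) = (m < X l)"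
    and IH: "\<And>p q. tight p q \<Longrightarrow> q - p < j - i \<Longrightarrow>
      alternating (\<lambda>h. cross_heights X Y m (p + 1) q h \<or> h = Y (p + 1)) (forward X Y m (p + 1) q)"
    and gap: "\<And>g. cross_heights X Y m (i + 1) j g \<or> g = Y i \<Longrightarrow> \<not> between (Y k) (Y l) g"
    and ne: "Y k \<noteq> Y l"
  shows False
proof -
  have t: "lo \<le> i" "i < j" "j + 1 \<le> hi" "j \<le> i + t" "crosses X m i" "crosses X m j" "(m < X i) = (m < X j)"
    using ij unfolding tight_pair_def by auto
  have b: "i < hi" "lo \<le> k" "k < hi" "lo \<le> l" "l < hi" "lo \<le> j" "j < hi" "i + 1 \<le> k" "l + 1 \<le> j"
    "l - k < j - i" "j \<le> hi" "k \<le> hi" "lo \<le> l + 1" "lo \<le> i + 1" "j < k + 1 + t" "l < i + 1 + t" "i < l" "k < j"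
    using t k less_iff_le[of l j] less_iff_le[of i k] zero_less_one[where 'a='z] by linarith+
  note ci = loop_step[OF FX FY bX bY loop t(1) b(1) t(5)]
  note ck = loop_step[OF FX FY bX bY loop b(2,3) k(4)]
  note cl = loop_step[OF FX FY bX bY loop b(4,5) k(5)]
  note cj = loop_step[OF FX FY bX bY loop b(6,7) t(6)]
  have sub: "cross_heights X Y m (k + 1) l g \<Longrightarrow> cross_heights X Y m (i + 1) j g" for g
    using cross_heights_mono[OF less_imp_le[OF k(1)] less_imp_le[OF k(3)]] .
  have p: "tight k l"
    by (rule tight_sub[OF ij]) (use k t gap sub in auto)
  have alt: "alternating (word X Y m (k + 1) l s) (forward X Y m (k + 1) l)" for s
    by (rule alternating_start_word[OF p IH[OF p b(10)]])
  obtain \<beta> where bot: "\<And>s. bottom_dir (word X Y m (k + 1) l s) (forward X Y m (k + 1) l) \<beta>"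
    using bottom_dir_pair[OF p] by blast
  define St where "St s z = status (word X Y m (k + 1) l s) (forward X Y m (k + 1) l) \<beta> z" for s z
  note St = St_def
  note ps = pair_status[OF p alt bot, folded St_def]
  note a1 = ps(1) and a2 = ps(2) and b1 = ps(3) and b2 = ps(4) and near = ps(5) and sides = ps(6)
  have gapi: "\<not> between (Y k) (Y l) (Y r)" if "i < r" "r < j" "crosses X m r" for r
    using gap cross_heightsI[OF FX FY bX bY loop that] by blast
  have "status (word X Y m (k + 1) l (m < X j)) (forward X Y m (k + 1) l) \<beta> (Y j) =
     status (word X Y m (k + 1) l (m < X (l + 1))) (forward X Y m (k + 1) l) \<beta> (Y (l + 1))"
  proof (rule status_along_loop[OF FX FY bX bY loop p alt bot b(13,9,11) cl(3) cj(2)])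
    show "(l < l + 1 \<and> j < k + 1 + t) \<or> (j < k + 1 \<and> l < l + 1 + t)" using b(15) by simp
    fix r assume r: "l + 1 \<le> r" "r < j" "crosses X m r"
    have "i < r" using r(1) b zero_less_one[where 'a='z] by linarith
    then show "\<not> between (Y k) (Y l) (Y r)" by (rule gapi[OF _ r(2,3)])
  qed
  then have E1: "St (m < X i) (Y j) = St (\<not> m < X k) (Y l)"
    using St cl(1,4) k(6) t(7) by simp
  have "status (word X Y m (k + 1) l (m < X k)) (forward X Y m (k + 1) l) \<beta> (Y k) =
     status (word X Y m (k + 1) l (m < X (i + 1))) (forward X Y m (k + 1) l) \<beta> (Y (i + 1))"
  proof (rule status_along_loop[OF FX FY bX bY loop p alt bot b(14,8,12) ci(3) ck(2)])
    show "(l < i + 1 \<and> k < k + 1 + t) \<or> (k < k + 1 \<and> l < i + 1 + t)" using b(16) by simp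
    fix r assume r: "i + 1 \<le> r" "r < k" "crosses X m r"
    have "i < r" "r < j" using r(1,2) b k zero_less_one[where 'a='z] by linarith+
    then show "\<not> between (Y k) (Y l) (Y r)" by (rule gapi[OF _ _ r(3)])
  qed
  then have E2: "St (m < X k) (Y k) = St (\<not> m < X i) (Y i)"
    using St ci(1,4) by simp
  have Ck: "cross_heights X Y m (i + 1) j (Y k)"
    by (rule cross_heightsI[OF FX FY bX bY loop k(1) b(18) k(4)])
  have Cl: "cross_heights X Y m (i + 1) j (Y l)"
    by (rule cross_heightsI[OF FX FY bX bY loop b(17) k(3,5)])
  note e1 = tight_pair_ends[OF ij] and e2 = tight_pair_ends[OF p]
  \<comment> \<open>The jump is made in two moves: a change of side at height \<open>Y j\<close>,
    and then a change of height from \<open>Y j\<close> to \<open>Y i\<close> on the new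
    side.\<close>
  have "St (m < X i) (Y j) = St (\<not> m < X i) (Y j)"
  proof (rule sides)
    show "Y j \<noteq> Y k" "Y j \<noteq> Y l" using e1(3)[OF Ck] e1(3)[OF Cl] by auto
    have "\<not> between (Y k) (Y l) (Y i)" using gap by blast
    then show "\<not> between (Y k) (Y l) (Y j)"
      using e1[OF Ck] e1[OF Cl] unfolding between_def by (metis linorder_neqE order.strict_trans)
  qed
  also have "\<dots> = St (\<not> m < X i) (Y i)"
  proof (rule near)
    fix h assume "cross_heights X Y m (k + 1) l h \<or> h = Y k \<or> h = Y l"
    then have "cross_heights X Y m (i + 1) j h" using sub Ck Cl by blast
    from e1[OF this] show "\<not> between (Y j) (Y i) h \<and> h \<noteq> Y j \<and> h \<noteq> Y i"
      unfolding between_def by blast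
  qed
  finally have E: "St (\<not> m < X k) (Y l) = St (m < X k) (Y k)" using E1 E2 by simp
  have no: "\<not> cross_heights X Y m (k + 1) l g" if "between (Y k) (Y l) g \<or> g = Y k \<or> g = Y l" for g
    using e2[of g] that by blast
  show False
  proof (cases "Y k < Y l")
    case True
    have "St (\<not> m < X k) (Y l) = \<beta>" by (rule a1[OF True]) (use no in \<open>auto simp: between_def\<close>)
    moreover have "St (m < X k) (Y k) = (\<not> \<beta>)"
      by (rule b2[OF True]) (use no in \<open>auto simp: between_def order.order_iff_strict\<close>)
    ultimately show False using E by simp
  next
    case False
    then have lt: "Y l < Y k" using ne by auto
    have "St (\<not> m < X k) (Y l) = (\<not> \<beta>)"
      by (rule b1[OF lt]) (use no in \<open>auto simp: between_def order.order_iff_strict\<close>)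
    moreover have "St (m < X k) (Y k) = \<beta>"
      by (rule a2[OF lt]) (use no in \<open>auto simp: between_def\<close>)
    ultimately show False using E by simp
  qed
qed

text \<open>Suppose two neighbouring letters had the same direction. If one of them is the cut
  letter, which is forward, then the other is a forward crossing, as excluded by
  \<open>star_case\<close>. If both are crossings, \<open>crossing_case\<close> applies with the
  earlier one on the curve as \<open>k\<close>.\<close>

lemma tight_pair_step:
  assumes ij: "tight i j"
    and IH: "\<And>p q. tight p q \<Longrightarrow> q - p < j - i \<Longrightarrow>
      alternating (\<lambda>h. cross_heights X Y m (p + 1) q h \<or> h = Y (p + 1)) (forward X Y m (p + 1) q)"
  shows "alternating (\<lambda>h. cross_heights X Y m (i + 1) j h \<or> h = Y (i + 1)) (forward X Y m (i + 1) j)"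
  unfolding alternating_def
proof (intro allI impI, elim conjE, intro notI)
  have t: "lo \<le> i" "i < j" "j + 1 \<le> hi" "crosses X m i"
    using ij unfolding tight_pair_def by auto
  have "i < hi" using t zero_less_one[where 'a='z] by linarith
  note ci = loop_step[OF FX FY bX bY loop t(1) this t(4)]
  let ?W = "\<lambda>h. cross_heights X Y m (i + 1) j h \<or> h = Y (i + 1)"
  fix c e assume c: "?W c" and e: "?W e" and ce: "c < e" and g: "\<forall>g. c < g \<and> g < e \<longrightarrow> \<not> ?W g"
    and d: "forward X Y m (i + 1) j c = forward X Y m (i + 1) j e"
  note cut = tight_pair_cut[OF FX FY bX bY loop ij]
  have d0: "forward X Y m (i + 1) j (Y (i + 1))"
    using forward_cut[OF FX FY bX bY0' cut, of "m < X (i + 1)"] unfolding cut_height_def by simp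
  have g': "\<not> between c e g \<and> \<not> between e c g" if "?W g" for g
    using g that ce unfolding between_def by auto
  have star: False if h: "cross_heights X Y m (i + 1) j h" and "forward X Y m (i + 1) j h" and gap: "\<And>g. ?W g \<Longrightarrow> \<not> between (Y i) h g" for h
  proof -
    from cross_heightsE[OF FX FY bX bY loop h] obtain k where k: "i < k" "k < j" "crosses X m k" "Y k = h" by blast
    have "(m < X k) = (m < X i)"
      using forward_cross[OF FX FY bX bY loop ij k(1-3)] that(2) k(4) by simp
    from star_case[OF ij k(1-3) this IH] gap k(4) show False by blast
  qed
  show False
  proof (cases "c = Y (i + 1) \<or> e = Y (i + 1)")
    case True
    then show False
    proof
      assume c0: "c = Y (i + 1)"
      then have "cross_heights X Y m (i + 1) j e" using e ce by auto
      moreover have "forward X Y m (i + 1) j e" using d d0 c0 by simp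
      ultimately show False using star[of e] g' c0 ci(1) by metis
    next
      assume e0: "e = Y (i + 1)"
      then have "cross_heights X Y m (i + 1) j c" using c ce by auto
      moreover have "forward X Y m (i + 1) j c" using d d0 e0 by simp
      ultimately show False using star[of c] g' e0 ci(1) by metis
    qed
  next
    case False
    then have C: "cross_heights X Y m (i + 1) j c" "cross_heights X Y m (i + 1) j e" using c e by auto
    from cross_heightsE[OF FX FY bX bY loop C(1)] obtain k where k: "i < k" "k < j" "crosses X m k" "Y k = c" by blast
    from cross_heightsE[OF FX FY bX bY loop C(2)] obtain l where l: "i < l" "l < j" "crosses X m l" "Y l = e" by blast
    have dir: "(m < X k) = (m < X l)"
      using forward_cross[OF FX FY bX bY loop ij k(1-3)] forward_cross[OF FX FY bX bY loop ij l(1-3)] d k(4) l(4)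
      by auto
    have gap: "\<not> between c e g \<and> \<not> between e c g" if "cross_heights X Y m (i + 1) j g \<or> g = Y i" for g
      using g'[of g] that ci(1) by metis
    have "k \<noteq> l" using k l ce by auto
    then consider "k < l" | "l < k" by (metis linorder_neqE)
    then show False
    proof cases
      case 1
      show False
        by (rule crossing_case[OF ij k(1) 1 l(2) k(3) l(3) dir IH]) (use gap k(4) l(4) ce in auto)
    next
      case 2
      show False
        by (rule crossing_case[OF ij l(1) 2 k(2) l(3) k(3) dir[symmetric] IH]) (use gap k(4) l(4) ce in auto)
    qed
  qed
qed

lemma tight_pair_alternating:
  assumes "tight i j"
  shows "alternating (word X Y m (i + 1) j s) (forward X Y m (i + 1) j)"
proof (rule alternating_start_word[OF assms])
  let ?A = "\<lambda>i j. alternating (\<lambda>h. cross_heights X Y m (i + 1) j h \<or> h = Y (i + 1)) (forward X Y m (i + 1) j)"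
  have b: "i \<in> {lo..hi} \<and> j \<in> {lo..hi} \<and> 0 \<le> j - i" if "tight i j" for i j
    using that zero_less_one[where 'a='z] unfolding tight_pair_def atLeastAtMost_iff by (intro conjI) linarith+
  \<comment> \<open>All pairs of one length are treated at once. The quantifiers over
    \<open>i\<close> and \<open>j\<close> may stand inside the induction predicate because they are
    bounded by \<open>lo\<close> and \<open>hi\<close>.\<close>
  have "\<forall>i\<in>{lo..hi}. \<forall>j\<in>{lo..hi}. tight i j \<and> j - i = j0 - i0 \<longrightarrow> ?A i j" if "0 \<le> j0 - i0" for i0 j0
  proof (rule strong_induct[where a=0 and P="\<lambda>L. \<forall>i\<in>{lo..hi}. \<forall>j\<in>{lo..hi}. tight i j \<and> j - i = L \<longrightarrow> ?A i j"])
    show "D (\<lambda>e. \<forall>i\<in>{lo..hi}. \<forall>j\<in>{lo..hi}. tight i j \<and> j - i = e 0 \<longrightarrow> ?A i j)"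
      unfolding tight_pair_def crosses_def between_def
      by (intro dfn F_comp[OF FX] F_comp[OF FY] D_alternating_word[OF FX FY bY])
    show "0 \<le> j0 - i0" by fact
  next
    fix L assume IH: "\<And>l. 0 \<le> l \<Longrightarrow> l < L \<Longrightarrow> \<forall>i\<in>{lo..hi}. \<forall>j\<in>{lo..hi}. tight i j \<and> j - i = l \<longrightarrow> ?A i j"
    show "\<forall>i\<in>{lo..hi}. \<forall>j\<in>{lo..hi}. tight i j \<and> j - i = L \<longrightarrow> ?A i j"
    proof (intro ballI impI, elim conjE)
      fix i j assume ij: "tight i j" "j - i = L"
      show "?A i j"
      proof (rule tight_pair_step[OF ij(1)])
        fix p q assume "tight p q" "q - p < j - i"
        then show "?A p q" using IH[of "q - p"] b[of p q] ij(2) by blast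
      qed
    qed
  qed
  then show "?A i j" using b[OF assms] assms by blast
qed

end

text \<open>The loop is given with its period: \<open>i\<close> and \<open>i + t\<close> are the same crossing, so the
  curve between them closes up without an extra segment.\<close>

lemma path_meets_loop:
  fixes X Y X2 Y2 :: "'z \<Rightarrow> 'z"
  assumes FX: "F (\<lambda>e. X (e 0))" and FY: "F (\<lambda>e. Y (e 0))"
    and FX2: "F (\<lambda>e. X2 (e 0))" and FY2: "F (\<lambda>e. Y2 (e 0))"
    and bX: "\<And>k. 0 \<le> X k \<and> X k \<le> n" and bY: "\<And>k. 0 \<le> Y k \<and> Y k \<le> n"
    and loop: "loop_on X Y 0 (2 * t) t"
    and i: "0 \<le> i" "i < t" "X (i + t) = X i" "Y (i + t) = Y i" "X (i + t + 1) = X (i + 1)"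
    and cr: "crosses X m i" and y: "Y i = y"
    and R: "0 \<le> r" "path_on X2 Y2 0 r" "X2 0 = m" "X2 r = m"
      "(Y2 0 = y - 1 \<and> Y2 r = y + 1) \<or> (Y2 0 = y + 1 \<and> Y2 r = y - 1)"
    and dj: "disjoint_on X Y 0 (2 * t) X2 Y2 0 r"
  shows False
proof -
  have bY0: "0 \<le> Y k" for k using bY by blast
  have t3: "3 \<le> t" using loop unfolding loop_on_def by blast
  have b: "i < i + t" "i + t + 1 \<le> 2 * t" "i < 2 * t" "i + 1 \<le> i + t" "i + t \<le> 2 * t" "0 \<le> i + 1"
    using i(1,2) t3 less_iff_le[of i t] zero_less_one[where 'a='z] by linarith+
  have cr': "crosses X m (i + t)" using cr i unfolding crosses_def by simp
  have p: "tight_pair X Y m 0 (2 * t) t i (i + t)"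
    unfolding tight_pair_def using b i cr cr' by (auto simp: between_def)
  note cut = tight_pair_cut[OF FX FY bX bY loop p]
  have alt: "alternating (word X Y m (i + 1) (i + t) s) (forward X Y m (i + 1) (i + t))" for s
    by (rule tight_pair_alternating[OF FX FY bX bY loop p])
  obtain \<beta> where bot: "\<And>s. bottom_dir (word X Y m (i + 1) (i + t) s) (forward X Y m (i + 1) (i + t)) \<beta>"
    using bottom_dir_pair[OF FX FY bX bY loop p] by blast
  define St where "St s z = status (word X Y m (i + 1) (i + t) s) (forward X Y m (i + 1) (i + t)) \<beta> z" for s z
  note St = St_def
  note ps = pair_status[OF FX FY bX bY loop p alt bot, folded St_def]
  note a1 = ps(1) and a2 = ps(2) and b1 = ps(3) and b2 = ps(4) and near = ps(5) and sides = ps(6)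
  \<comment> \<open>Column \<open>m\<close> is directly to the left of the line, so both ends are
    judged by the word seen from the left.\<close>
  have sF: "(m < X2 0) = False" "(m < X2 r) = False" using R by auto
  have "status (word X Y m (i + 1) (i + t) (m < X2 r)) (forward X Y m (i + 1) (i + t)) \<beta> (Y2 r) =
     status (word X Y m (i + 1) (i + t) (m < X2 0)) (forward X Y m (i + 1) (i + t)) \<beta> (Y2 0)"
  proof (rule status_along_path[OF FX FY bX bY0 cut FX2 FY2 alt bot R(1,2)])
    show "X2 0 = line_col m (m < X2 0)" "X2 r = line_col m (m < X2 r)"
      unfolding sF line_col_def using R by auto
    show "disjoint_on X Y (i + 1) (i + t) X2 Y2 0 r"
      by (rule disjoint_on_sub[OF dj b(6,5)]) auto
    have "Y (i + 1) = Y (i + t)"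
      using loop_step(1)[OF FX FY bX bY loop i(1) b(3) cr] i by simp
    then show "\<not> between (Y (i + 1)) (Y (i + t)) (Y2 k)" for k by (simp add: between_def)
  qed
  then have eq: "St False (Y2 r) = St False (Y2 0)" unfolding sF St .
  \<comment> \<open>A crossing at height \<open>y - 1\<close> would have an end in column
    \<open>m\<close> at that height, but this point is an end of the second path.\<close>
  have no: "\<not> cross_heights X Y m (i + 1) (i + t) (y - 1)"
  proof
    assume "cross_heights X Y m (i + 1) (i + t) (y - 1)"
    then have "word X Y m (i + 1) (i + t) False (y - 1)" unfolding word_def by blast
    from word_point[OF FX FY bX bY0 cut this] obtain k where
      k: "i + 1 \<le> k" "k \<le> i + t" "X k = line_col m False" "Y k = y - 1" by metis
    have "0 \<le> k" "k \<le> 2 * t" using k b by linarith+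
    then have "k \<in> {0..2 * t}" "0 \<in> {0..r}" "r \<in> {0..r}" using R(1) by auto
    then have "\<not> (X k = X2 0 \<and> Y k = Y2 0)" "\<not> (X k = X2 r \<and> Y k = Y2 r)"
      using dj unfolding disjoint_on_def by blast+
    then show False using R k(3,4) by (auto simp: line_col_def)
  qed
  have up: "\<not> (y < g \<and> g < y + 1)" for g using less_iff_le[of y g] by auto
  have dn: "g = y - 1" if "y - 1 \<le> g" "g < y" for g
    using less_iff_le[of g y] that by (auto simp: le_diff_eq intro: order.antisym)
  \<comment> \<open>Because \<open>Y (i + t) = Y i\<close>, the cut is at height \<open>y\<close> in
    the view from either side, and no height fits between \<open>y\<close> and
    \<open>y + 1\<close>.\<close>
  have hi: "St s (y + 1) = \<beta>" for s
    using a1[of "y + 1"] a2[of "y + 1"] up y i(4) by (cases "s = (m < X i)") auto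
  have "St s (y - 1) = (\<not> \<beta>)" for s
  proof (cases "s = (m < X i)")
    case True
    show ?thesis unfolding True by (rule b2) (use y i(4) no dn in auto)
  next
    case False
    then have s: "s = (\<not> m < X i)" by auto
    show ?thesis unfolding s by (rule b1) (use y no dn in auto)
  qed
  then show False using eq hi R(5) by auto
qed

end

section \<open>Substitution\<close>

lemma substT_substT:
  "substT \<sigma> \<rho> (substT \<sigma>' \<rho>' t) = substT (\<lambda>i. substT \<sigma> \<rho> (\<sigma>' i)) (\<lambda>X. \<rho> (\<rho>' X)) t"
  by (induction t) auto

lemma substT_V: "substT V (\<lambda>X. X) t = t"
  by (induction t) auto

lemma substT_V_id: "substT V id t = t"
  by (induction t) auto

lemma substT_up: "substT \<sigma> \<rho> (up 1 t) = substT (\<lambda>i. \<sigma> (Suc i)) \<rho> t"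
  by (simp add: up_def substT_substT id_def)

lemma up_substT: "up 1 (substT \<sigma> \<rho> t) = substT (\<lambda>i. up 1 (\<sigma> i)) \<rho> t"
  by (simp add: up_def substT_substT)

definition under_N :: "(nat \<Rightarrow> tm) \<Rightarrow> nat \<Rightarrow> tm" where
  "under_N \<sigma> = case_nat (V 0) (\<lambda>i. up 1 (\<sigma> i))"

definition under_S :: "(nat \<Rightarrow> nat) \<Rightarrow> nat \<Rightarrow> nat" where
  "under_S \<rho> = case_nat 0 (\<lambda>X. Suc (\<rho> X))"

lemma substF_AllN: "substF \<sigma> \<rho> (AllN A) = AllN (substF (under_N \<sigma>) \<rho> A)"
  by (simp add: under_N_def)

lemma substF_AllS: "substF \<sigma> \<rho> (AllS A) = AllS (substF (\<lambda>i. substT V Suc (\<sigma> i)) (under_S \<rho>) A)"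
  by (simp add: under_S_def)

lemma under_N_comp: "(\<lambda>i. substT (under_N \<sigma>) \<rho> (under_N \<sigma>' i)) = under_N (\<lambda>i. substT \<sigma> \<rho> (\<sigma>' i))"
  by (rule ext) (auto simp: under_N_def substT_up up_substT simp del: One_nat_def split: nat.split)

lemma under_S_comp: "(\<lambda>X. under_S \<rho> (under_S \<rho>' X)) = under_S (\<lambda>X. \<rho> (\<rho>' X))"
  by (auto simp: under_S_def split: nat.split)

lemma substF_substF:
  "substF \<sigma> \<rho> (substF \<sigma>' \<rho>' A) = substF (\<lambda>i. substT \<sigma> \<rho> (\<sigma>' i)) (\<lambda>X. \<rho> (\<rho>' X)) A"
proof (induction A arbitrary: \<sigma> \<rho> \<sigma>' \<rho>')
  case (AllS A)
  have "substT (\<lambda>i. substT V Suc (\<sigma> i)) (under_S \<rho>) (substT V Suc t) = substT V Suc (substT \<sigma> \<rho> t)" for t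
    by (simp add: substT_substT under_S_def)
  then show ?case by (simp add: substF_AllS AllS under_S_comp del: substF.simps)
qed (simp_all add: substT_substT substF_AllN under_N_comp del: substF.simps(7,8))

lemma under_N_V: "under_N V = V"
  by (auto simp: under_N_def up_def split: nat.split)

lemma under_S_id: "under_S (\<lambda>X. X) = (\<lambda>X. X)"
  by (auto simp: under_S_def split: nat.split)

lemma substF_V: "substF V (\<lambda>X. X) A = A"
  by (induction A) (simp_all add: substT_V substF_AllN substF_AllS under_N_V under_S_id del: substF.simps(7,8))

lemma id_eta: "id = (\<lambda>X. X)" by auto

lemma instN_substF: "instN (substF (under_N \<sigma>) \<rho> A) t = substF (case_nat t \<sigma>) \<rho> A"
proof -
  have "(\<lambda>i. substT (case_nat t V) id (under_N \<sigma> i)) = case_nat t \<sigma>"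
    by (rule ext) (auto simp: under_N_def substT_up substT_V_id simp del: One_nat_def split: nat.split)
  then show ?thesis by (simp add: instN_def substF_substF)
qed

lemma instS_substF:
  "instS (substF (\<lambda>i. substT V Suc (\<sigma> i)) (under_S \<rho>) A) X = substF \<sigma> (case_nat X \<rho>) A"
proof -
  have "(\<lambda>i. substT V (case_nat X id) (substT V Suc (\<sigma> i))) = \<sigma>"
    by (auto simp: substT_substT substT_V)
  moreover have "(\<lambda>Y. case_nat X id (under_S \<rho> Y)) = case_nat X \<rho>"
    by (auto simp: under_S_def split: nat.split)
  ultimately show ?thesis by (simp add: instS_def substF_substF)
qed

lemma substF_instN: "substF \<sigma> \<rho> (instN A t) = instN (substF (under_N \<sigma>) \<rho> A) (substT \<sigma> \<rho> t)"
proof -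
  have "(\<lambda>i. substT \<sigma> \<rho> (case_nat t V i)) = case_nat (substT \<sigma> \<rho> t) \<sigma>"
    by (auto split: nat.split)
  then show ?thesis unfolding instN_substF by (simp add: instN_def substF_substF)
qed

lemma substF_instS:
  "substF \<sigma> \<rho> (instS A X) = instS (substF (\<lambda>i. substT V Suc (\<sigma> i)) (under_S \<rho>) A) (\<rho> X)"
proof -
  have "(\<lambda>Y. \<rho> (case_nat X id Y)) = case_nat (\<rho> X) \<rho>"
    by (auto split: nat.split)
  then show ?thesis unfolding instS_substF by (simp add: instS_def substF_substF)
qed

lemma liftN_substF: "substF (under_N \<sigma>) \<rho> (liftN A) = liftN (substF \<sigma> \<rho> A)"
  by (simp add: liftN_def substF_substF under_N_def up_def)

lemma liftS_substF: "substF (\<lambda>i. substT V Suc (\<sigma> i)) (under_S \<rho>) (liftS A) = liftS (substF \<sigma> \<rho> A)"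
  by (simp add: liftS_def substF_substF under_S_def)

text \<open>Stands in for the free variables of a formula. Freshness is only ever used to conclude
  that two substitutions give the same result, so that property is the definition.\<close>

definition depends_below :: "nat \<Rightarrow> nat \<Rightarrow> fm \<Rightarrow> bool" where
  "depends_below k l A \<longleftrightarrow> (\<forall>\<sigma> \<sigma>' \<rho> \<rho>'. (\<forall>i<k. \<sigma> i = \<sigma>' i) \<and> (\<forall>X<l. \<rho> X = \<rho>' X) \<longrightarrow>
     substF \<sigma> \<rho> A = substF \<sigma>' \<rho>' A)"

lemma depends_belowD:
  "depends_below k l A \<Longrightarrow> (\<And>i. i < k \<Longrightarrow> \<sigma> i = \<sigma>' i) \<Longrightarrow> (\<And>X. X < l \<Longrightarrow> \<rho> X = \<rho>' X) \<Longrightarrow>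
   substF \<sigma> \<rho> A = substF \<sigma>' \<rho>' A"
  unfolding depends_below_def by blast

lemma depends_below_AllN: "depends_below (Suc k) l A \<Longrightarrow> depends_below k l (AllN A)"
  unfolding depends_below_def[of k] by (auto intro!: depends_belowD simp: less_Suc_eq_0_disj)

lemma depends_below_AllS: "depends_below k (Suc l) A \<Longrightarrow> depends_below k l (AllS A)"
  unfolding depends_below_def[of k l] by (auto intro!: depends_belowD simp: less_Suc_eq_0_disj)

lemma depends_below_mono: "depends_below k l A \<Longrightarrow> k \<le> k' \<Longrightarrow> l \<le> l' \<Longrightarrow> depends_below k' l' A"
  unfolding depends_below_def by (meson order.strict_trans2)

lemma depends_below_AllN': "depends_below k l A \<Longrightarrow> depends_below k l (AllN A)"
  by (rule depends_below_AllN) (auto intro: depends_below_mono)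

lemma depends_below_AllS': "depends_below k l A \<Longrightarrow> depends_below k l (AllS A)"
  by (rule depends_below_AllS) (auto intro: depends_below_mono)

lemma tm_bound: "\<exists>N. \<forall>\<sigma> \<sigma>' \<rho> \<rho>'. (\<forall>i<N. \<sigma> i = \<sigma>' i) \<and> (\<forall>X<N. \<rho> X = \<rho>' X) \<longrightarrow> substT \<sigma> \<rho> t = substT \<sigma>' \<rho>' t"
proof (induction t)
  case (V i) then show ?case by (intro exI[of _ "Suc i"]) auto
next
  case (Len i) then show ?case by (intro exI[of _ "Suc i"]) auto
next
  case (Plus s t)
  then obtain M N where "\<forall>\<sigma> \<sigma>' \<rho> \<rho>'. (\<forall>i<M. \<sigma> i = \<sigma>' i) \<and> (\<forall>X<M. \<rho> X = \<rho>' X) \<longrightarrow> substT \<sigma> \<rho> s = substT \<sigma>' \<rho>' s"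
    "\<forall>\<sigma> \<sigma>' \<rho> \<rho>'. (\<forall>i<N. \<sigma> i = \<sigma>' i) \<and> (\<forall>X<N. \<rho> X = \<rho>' X) \<longrightarrow> substT \<sigma> \<rho> t = substT \<sigma>' \<rho>' t" by blast
  then show ?case by (intro exI[of _ "max M N"]) auto
next
  case (Times s t)
  then obtain M N where "\<forall>\<sigma> \<sigma>' \<rho> \<rho>'. (\<forall>i<M. \<sigma> i = \<sigma>' i) \<and> (\<forall>X<M. \<rho> X = \<rho>' X) \<longrightarrow> substT \<sigma> \<rho> s = substT \<sigma>' \<rho>' s"
    "\<forall>\<sigma> \<sigma>' \<rho> \<rho>'. (\<forall>i<N. \<sigma> i = \<sigma>' i) \<and> (\<forall>X<N. \<rho> X = \<rho>' X) \<longrightarrow> substT \<sigma> \<rho> t = substT \<sigma>' \<rho>' t" by blast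
  then show ?case by (intro exI[of _ "max M N"]) auto
qed auto

lemma tm_bound2: obtains N where
  "\<And>\<sigma> \<sigma>' \<rho> \<rho>'. \<forall>i<N. \<sigma> i = \<sigma>' i \<Longrightarrow> \<forall>X<N. \<rho> X = \<rho>' X \<Longrightarrow> substT \<sigma> \<rho> s = substT \<sigma>' \<rho>' s \<and> substT \<sigma> \<rho> t = substT \<sigma>' \<rho>' t"
proof -
  from tm_bound[of "s \<^bold>+ t"] obtain N where
    "\<forall>\<sigma> \<sigma>' \<rho> \<rho>'. (\<forall>i<N. \<sigma> i = \<sigma>' i) \<and> (\<forall>X<N. \<rho> X = \<rho>' X) \<longrightarrow> substT \<sigma> \<rho> (s \<^bold>+ t) = substT \<sigma>' \<rho>' (s \<^bold>+ t)" by blast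
  then show thesis by (intro that[of N]) auto
qed

lemma fm_bound: "\<exists>N. depends_below N N A"
proof (induction A)
  case Falsum then show ?case by (auto simp: depends_below_def)
next
  case (Eq s t)
  obtain N where "\<And>\<sigma> \<sigma>' \<rho> \<rho>'. \<forall>i<N. \<sigma> i = \<sigma>' i \<Longrightarrow> \<forall>X<N. \<rho> X = \<rho>' X \<Longrightarrow> substT \<sigma> \<rho> s = substT \<sigma>' \<rho>' s \<and> substT \<sigma> \<rho> t = substT \<sigma>' \<rho>' t"
    using tm_bound2 by blast
  then show ?case unfolding depends_below_def by (intro exI[of _ N]) auto
next
  case (Le s t)
  obtain N where "\<And>\<sigma> \<sigma>' \<rho> \<rho>'. \<forall>i<N. \<sigma> i = \<sigma>' i \<Longrightarrow> \<forall>X<N. \<rho> X = \<rho>' X \<Longrightarrow> substT \<sigma> \<rho> s = substT \<sigma>' \<rho>' s \<and> substT \<sigma> \<rho> t = substT \<sigma>' \<rho>' t"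
    using tm_bound2 by blast
  then show ?case unfolding depends_below_def by (intro exI[of _ N]) auto
next
  case (Mem t X)
  obtain N where "\<And>\<sigma> \<sigma>' \<rho> \<rho>'. \<forall>i<N. \<sigma> i = \<sigma>' i \<Longrightarrow> \<forall>X<N. \<rho> X = \<rho>' X \<Longrightarrow>
      substT \<sigma> \<rho> t = substT \<sigma>' \<rho>' t \<and> substT \<sigma> \<rho> (Len X) = substT \<sigma>' \<rho>' (Len X)"
    using tm_bound2 by blast
  then show ?case unfolding depends_below_def by (intro exI[of _ N]) auto
next
  case (SetEq X Y)
  then show ?case unfolding depends_below_def by (intro exI[of _ "Suc (max X Y)"]) auto
next
  case (Imp A B)
  then obtain M N where "depends_below M M A" "depends_below N N B" by blast
  then have "depends_below (max M N) (max M N) A" "depends_below (max M N) (max M N) B"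
    by (auto elim: depends_below_mono)
  then show ?case by (intro exI[of _ "max M N"]) (unfold depends_below_def substF.simps, metis)
next
  case (AllN A) then show ?case using depends_below_AllN' by blast
next
  case (AllS A) then show ?case using depends_below_AllS' by blast
qed

section \<open>Derivations\<close>

lemma deriv_weaken: "deriv T G A \<Longrightarrow> set G \<subseteq> set G' \<Longrightarrow> deriv T G' A"
proof (induction arbitrary: G' rule: deriv.induct)
  case (ImpI A G B)
  have "deriv T (A # G') B" by (rule ImpI.IH) (use ImpI.prems in auto)
  then show ?case by (rule deriv.ImpI)
next
  case (Raa A G)
  have "deriv T ((\<^bold>\<not> A) # G') \<^bold>\<bottom>" by (rule Raa.IH) (use Raa.prems in auto)
  then show ?case by (rule deriv.Raa)
next
  case (AllNI G A)
  have "deriv T (map liftN G') A" by (rule AllNI.IH) (use AllNI.prems in auto)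
  then show ?case by (rule deriv.AllNI)
next
  case (AllSI G A)
  have "deriv T (map liftS G') A" by (rule AllSI.IH) (use AllSI.prems in auto)
  then show ?case by (rule deriv.AllSI)
next
  case (EqSubst G s t A)
  from deriv.EqSubst[OF EqSubst.IH[OF EqSubst.prems]] show ?case .
next
  case (SetEqSubst G X Y A)
  from deriv.SetEqSubst[OF SetEqSubst.IH[OF SetEqSubst.prems]] show ?case .
qed (auto intro: deriv.intros)

text \<open>The axioms are the one obstacle in the induction on derivations, since an instance of an
  axiom need not be an axiom; hence the premise \<open>ax\<close>, which
  \<open>deriv_closed_instance\<close> will discharge.\<close>

lemma deriv_substF:
  assumes ax: "\<And>B G \<sigma> \<rho>. B \<in> T \<Longrightarrow> deriv T G (substF \<sigma> \<rho> B)"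
  shows "deriv T G A \<Longrightarrow> deriv T (map (substF \<sigma> \<rho>) G) (substF \<sigma> \<rho> A)"
proof (induction arbitrary: \<sigma> \<rho> rule: deriv.induct)
  case (Axiom A G) then show ?case by (intro ax)
next
  case (Hyp A G) then show ?case by (intro deriv.Hyp) auto
next
  case (ImpI A G B) then show ?case by (auto intro: deriv.ImpI)
next
  case (ImpE G A B)
  from deriv.ImpE[OF ImpE.IH(1)[unfolded substF.simps] ImpE.IH(2)] show ?case .
next
  case (Raa A G)
  show ?case by (rule deriv.Raa) (use Raa.IH[of \<sigma> \<rho>] in \<open>simp add: Neg_def\<close>)
next
  case (AllNI G A)
  have "map (substF (under_N \<sigma>) \<rho>) (map liftN G) = map liftN (map (substF \<sigma> \<rho>) G)"
    by (simp add: liftN_substF)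
  from deriv.AllNI[OF AllNI.IH[of "under_N \<sigma>" \<rho>, unfolded this]] show ?case unfolding substF_AllN .
next
  case (AllNE G A t)
  from deriv.AllNE[OF AllNE.IH[unfolded substF_AllN]] show ?case unfolding substF_instN .
next
  case (AllSI G A)
  have "map (substF (\<lambda>i. substT V Suc (\<sigma> i)) (under_S \<rho>)) (map liftS G) = map liftS (map (substF \<sigma> \<rho>) G)"
    by (simp add: liftS_substF)
  from deriv.AllSI[OF AllSI.IH[of "\<lambda>i. substT V Suc (\<sigma> i)" "under_S \<rho>", unfolded this]]
  show ?case unfolding substF_AllS .
next
  case (AllSE G A X)
  from deriv.AllSE[OF AllSE.IH[unfolded substF_AllS]] show ?case unfolding substF_instS .
next
  case (EqRefl G t) then show ?case by (auto intro: deriv.EqRefl)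
next
  case (EqSubst G s t A)
  from deriv.EqSubst[OF EqSubst.IH(1)[unfolded substF.simps] EqSubst.IH(2)[unfolded substF_instN]]
  show ?case unfolding substF_instN .
next
  case (SetEqRefl G X) then show ?case by (auto intro: deriv.SetEqRefl)
next
  case (SetEqSubst G X Y A)
  from deriv.SetEqSubst[OF SetEqSubst.IH(1)[unfolded substF.simps] SetEqSubst.IH(2)[unfolded substF_instS]]
  show ?case unfolding substF_instS .
qed

text \<open>Quantifying \<open>N\<close> times over sets and \<open>N\<close> times over numbers
  yields \<open>C N\<close>, on which every substitution acts trivially. The quantifiers are then
  removed one by one, instantiated by the values of \<open>\<sigma>\<close> and
  \<open>\<rho>\<close>. Derivability from every \<open>G\<close> is assumed because quantifier
  introduction lifts the hypotheses.\<close>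

lemma deriv_closed_instance:
  assumes "\<And>G. deriv T G A"
  shows "deriv T G (substF \<sigma> \<rho> A)"
proof -
  obtain N where N: "depends_below N N A" using fm_bound by blast
  define B where "B j = (AllS ^^ j) A" for j
  define C where "C j = (AllN ^^ j) (B N)" for j
  have B: "deriv T G (B j)" for j G
    unfolding B_def by (induction j arbitrary: G) (auto intro: assms deriv.AllSI)
  have C: "deriv T G (C j)" for j G
    unfolding C_def by (induction j arbitrary: G) (auto intro: B deriv.AllNI)
  have dB: "depends_below N (N - j) (B j)" if "j \<le> N" for j
    using that
  proof (induction j)
    case (Suc j)
    then have "depends_below N (Suc (N - Suc j)) (B j)" by (simp add: Suc_diff_Suc)
    then show ?case unfolding B_def using depends_below_AllS by simp
  qed (use N in \<open>simp add: B_def\<close>)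
  have dC: "depends_below (N - j) 0 (C j)" if "j \<le> N" for j
    using that
  proof (induction j)
    case 0 then show ?case using dB[of N] by (simp add: C_def)
  next
    case (Suc j)
    then have "depends_below (Suc (N - Suc j)) 0 (C j)" by (simp add: Suc_diff_Suc)
    then show ?case unfolding C_def using depends_below_AllN by simp
  qed
  have "substF \<sigma> \<rho> (C N) = substF V (\<lambda>X. X) (C N)" for \<sigma> \<rho>
    by (rule depends_belowD[OF dC[of N]]) auto
  then have top: "deriv T G (substF \<sigma> \<rho> (C N))" for G \<sigma> \<rho> using C[of G N] by (simp add: substF_V)
  have downC: "deriv T G (substF \<sigma> \<rho> (C (N - j)))" if "j \<le> N" for j G \<sigma> \<rho>
    using that
  proof (induction j arbitrary: G \<sigma> \<rho>)
    case (Suc j)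
    have "C (N - j) = AllN (C (N - Suc j))" using Suc.prems
      by (simp add: C_def flip: Suc_diff_Suc)
    then have "deriv T G (AllN (substF (under_N (\<lambda>i. \<sigma> (Suc i))) \<rho> (C (N - Suc j))))"
      using Suc.IH[of G "\<lambda>i. \<sigma> (Suc i)" \<rho>] Suc.prems by (simp add: substF_AllN del: substF.simps)
    from deriv.AllNE[OF this, of "\<sigma> 0"] have "deriv T G (substF (case_nat (\<sigma> 0) (\<lambda>i. \<sigma> (Suc i))) \<rho> (C (N - Suc j)))"
      unfolding instN_substF .
    moreover have "case_nat (\<sigma> 0) (\<lambda>i. \<sigma> (Suc i)) = \<sigma>" by (auto split: nat.split)
    ultimately show ?case by simp
  qed (use top in simp)
  have downB: "deriv T G (substF \<sigma> \<rho> (B (N - j)))" if "j \<le> N" for j G \<sigma> \<rho>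
    using that
  proof (induction j arbitrary: G \<sigma> \<rho>)
    case 0 then show ?case using downC[of N G \<sigma> \<rho>] by (simp add: C_def)
  next
    case (Suc j)
    have "B (N - j) = AllS (B (N - Suc j))" using Suc.prems
      by (simp add: B_def flip: Suc_diff_Suc)
    then have "deriv T G (AllS (substF (\<lambda>i. substT V Suc (\<sigma> i)) (under_S (\<lambda>i. \<rho> (Suc i))) (B (N - Suc j))))"
      using Suc.IH[of G \<sigma> "\<lambda>i. \<rho> (Suc i)"] Suc.prems by (simp add: substF_AllS del: substF.simps)
    from deriv.AllSE[OF this, of "\<rho> 0"] have "deriv T G (substF \<sigma> (case_nat (\<rho> 0) (\<lambda>i. \<rho> (Suc i))) (B (N - Suc j)))"
      unfolding instS_substF .
    moreover have "case_nat (\<rho> 0) (\<lambda>i. \<rho> (Suc i)) = \<rho>" by (auto split: nat.split)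
    ultimately show ?case by simp
  qed
  from downB[of N G \<sigma> \<rho>] show ?thesis by (simp add: B_def)
qed

lemma deriv_instance: "deriv T G A \<Longrightarrow> deriv T (map (substF \<sigma> \<rho>) G) (substF \<sigma> \<rho> A)"
  by (rule deriv_substF[OF deriv_closed_instance]) (rule deriv.Axiom)

lemma deriv_cut: "deriv T (A # G) B \<Longrightarrow> deriv T G A \<Longrightarrow> deriv T G B"
  by (rule deriv.ImpE[OF deriv.ImpI])

lemma deriv_NegE: "deriv T G (\<^bold>\<not> A) \<Longrightarrow> deriv T G A \<Longrightarrow> deriv T G \<^bold>\<bottom>"
  unfolding Neg_def by (rule deriv.ImpE)

section \<open>Maximal consistent Henkin sets\<close>

instance tm :: countable by countable_datatype
instance fm :: countable by countable_datatype

definition consistent :: "fm set \<Rightarrow> fm list \<Rightarrow> bool" where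
  "consistent T G \<longleftrightarrow> \<not> deriv T G \<^bold>\<bottom>"

lemma list_bound: obtains N where "\<And>A. A \<in> set G \<Longrightarrow> depends_below N N A"
proof -
  have "\<exists>N. \<forall>A\<in>set G. depends_below N N A"
  proof (induction G)
    case (Cons A G)
    then obtain M N where "\<forall>A\<in>set G. depends_below N N A" "depends_below M M A" using fm_bound by blast
    then have "depends_below (max M N) (max M N) C" if "C \<in> set (A # G)" for C
      using that depends_below_mono[of M M A] depends_below_mono[of N N C] by auto
    then show ?case by blast
  qed simp
  then show thesis using that by blast
qed

text \<open>The substitution \<open>r\<close> renames the fresh variable \<open>m\<close> to the
  variable about to be bound and shifts the others, so it turns \<open>G\<close> into its lift and
  \<open>instN A (V m)\<close> into \<open>A\<close>.\<close>

lemma fresh_AllN: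
  assumes A: "\<And>C. C \<in> set (A # G) \<Longrightarrow> depends_below m m C" and d: "deriv T G (instN A (V m))"
  shows "deriv T G (AllN A)"
proof -
  define r where "r i = (if i = m then V 0 else V (Suc i))" for i
  have "substF r (\<lambda>X. X) C = liftN C" if "C \<in> set G" for C
    unfolding liftN_def id_eta by (rule depends_belowD[of m m]) (use A that in \<open>auto simp: r_def\<close>)
  then have 1: "map (substF r (\<lambda>X. X)) G = map liftN G" by simp
  have "substF r (\<lambda>X. X) (instN A (V m)) = substF (\<lambda>i. substT r (\<lambda>X. X) (case_nat (V m) V i)) (\<lambda>X. X) A"
    by (simp add: instN_def substF_substF)
  also have "\<dots> = substF V (\<lambda>X. X) A"
    by (rule depends_belowD[of m m]) (use A in \<open>auto simp: r_def split: nat.split\<close>)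
  finally have "deriv T (map liftN G) A" using deriv_instance[OF d, of r "\<lambda>X. X"] 1 by (simp add: substF_V)
  then show ?thesis by (rule deriv.AllNI)
qed

lemma fresh_AllS:
  assumes A: "\<And>C. C \<in> set (A # G) \<Longrightarrow> depends_below m m C" and d: "deriv T G (instS A m)"
  shows "deriv T G (AllS A)"
proof -
  define r where "r i = (if i = m then 0 else Suc i)" for i
  have "substF V r C = liftS C" if "C \<in> set G" for C
    unfolding liftS_def by (rule depends_belowD[of m m]) (use A that in \<open>auto simp: r_def\<close>)
  then have 1: "map (substF V r) G = map liftS G" by simp
  have "substF V r (instS A m) = substF V (\<lambda>X. r (case_nat m id X)) A"
    by (simp add: instS_def substF_substF)
  also have "\<dots> = substF V (\<lambda>X. X) A"
    by (rule depends_belowD[of m m]) (use A in \<open>auto simp: r_def split: nat.split\<close>)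
  finally have "deriv T (map liftS G) A" using deriv_instance[OF d, of V r] 1 by (simp add: substF_V)
  then show ?thesis by (rule deriv.AllSI)
qed

definition henkin_step :: "fm set \<Rightarrow> fm \<Rightarrow> fm list \<Rightarrow> fm list \<Rightarrow> bool" where
  "henkin_step T A G G' \<longleftrightarrow> set G \<subseteq> set G' \<and> (A \<in> set G' \<or> \<not> consistent T (A # G)) \<and>
    (\<forall>B. A = (\<^bold>\<not> AllN B) \<and> A \<in> set G' \<longrightarrow> (\<exists>t. (\<^bold>\<not> instN B t) \<in> set G')) \<and>
    (\<forall>B. A = (\<^bold>\<not> AllS B) \<and> A \<in> set G' \<longrightarrow> (\<exists>X. (\<^bold>\<not> instS B X) \<in> set G'))"

lemma henkin_extension:
  assumes G: "consistent T G"
  shows "\<exists>G'. consistent T G' \<and> henkin_step T A G G'"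
proof (cases "consistent T (A # G)")
  case False
  then have "A \<notin> set G" using G deriv_weaken[of T "A # G" _ G] unfolding consistent_def by (auto simp: insert_absorb)
  with False G show ?thesis unfolding henkin_step_def by (intro exI[of _ G]) auto
next
  case c: True
  consider (N) B where "A = (\<^bold>\<not> AllN B)" | (S) B where "A = (\<^bold>\<not> AllS B)"
    | (other) "\<And>B. A \<noteq> (\<^bold>\<not> AllN B)" "\<And>B. A \<noteq> (\<^bold>\<not> AllS B)" by blast
  then show ?thesis
  proof cases
    case N
    obtain m where m: "\<And>C. C \<in> set (B # A # G) \<Longrightarrow> depends_below m m C" using list_bound by blast
    have "consistent T ((\<^bold>\<not> instN B (V m)) # A # G)"
    proof (rule ccontr)
      assume "\<not> ?thesis"
      then have "deriv T (A # G) (instN B (V m))" unfolding consistent_def by (auto intro: deriv.Raa)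
      from fresh_AllN[OF m this] have "deriv T (A # G) (AllN B)" .
      moreover have "deriv T (A # G) (\<^bold>\<not> AllN B)" by (rule deriv.Hyp) (simp add: N)
      ultimately show False using c deriv_NegE unfolding consistent_def by blast
    qed
    then show ?thesis unfolding henkin_step_def
      by (intro exI[of _ "(\<^bold>\<not> instN B (V m)) # A # G"]) (auto simp: N Neg_def)
  next
    case S
    obtain m where m: "\<And>C. C \<in> set (B # A # G) \<Longrightarrow> depends_below m m C" using list_bound by blast
    have "consistent T ((\<^bold>\<not> instS B m) # A # G)"
    proof (rule ccontr)
      assume "\<not> ?thesis"
      then have "deriv T (A # G) (instS B m)" unfolding consistent_def by (auto intro: deriv.Raa)
      from fresh_AllS[OF m this] have "deriv T (A # G) (AllS B)" .
      moreover have "deriv T (A # G) (\<^bold>\<not> AllS B)" by (rule deriv.Hyp) (simp add: S)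
      ultimately show False using c deriv_NegE unfolding consistent_def by blast
    qed
    then show ?thesis unfolding henkin_step_def
      by (intro exI[of _ "(\<^bold>\<not> instS B m) # A # G"]) (auto simp: S Neg_def)
  next
    case other
    then show ?thesis using c unfolding henkin_step_def by (intro exI[of _ "A # G"]) auto
  qed
qed

definition henkin :: "fm set \<Rightarrow> fm set \<Rightarrow> bool" where
  "henkin T H \<longleftrightarrow> (\<forall>G A. set G \<subseteq> H \<longrightarrow> deriv T G A \<longrightarrow> A \<in> H) \<and> \<^bold>\<bottom> \<notin> H \<and>
    (\<forall>A. A \<in> H \<or> (\<^bold>\<not> A) \<in> H) \<and>
    (\<forall>B. (\<^bold>\<not> AllN B) \<in> H \<longrightarrow> (\<exists>t. (\<^bold>\<not> instN B t) \<in> H)) \<and>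
    (\<forall>B. (\<^bold>\<not> AllS B) \<in> H \<longrightarrow> (\<exists>X. (\<^bold>\<not> instS B X) \<in> H))"

lemma henkin_exists:
  assumes "consistent T G0"
  shows "\<exists>H. set G0 \<subseteq> H \<and> henkin T H"
proof -
  let ?E = "\<lambda>n. from_nat n :: fm"
  have "\<exists>f. \<forall>n. (consistent T (f n) \<and> set G0 \<subseteq> set (f n)) \<and> henkin_step T (?E n) (f n) (f (Suc n))"
  proof (rule dependent_nat_choice)
    show "\<exists>G. consistent T G \<and> set G0 \<subseteq> set G" using assms by blast
  next
    fix G n assume G: "consistent T G \<and> set G0 \<subseteq> set G"
    then obtain G' where G': "consistent T G'" "henkin_step T (?E n) G G'"
      using henkin_extension by blast
    then have "set G0 \<subseteq> set G'" using G unfolding henkin_step_def by blast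
    with G' show "\<exists>G'. (consistent T G' \<and> set G0 \<subseteq> set G') \<and> henkin_step T (?E n) G G'" by blast
  qed
  then obtain f where con: "\<And>n. consistent T (f n)" and G0: "\<And>n. set G0 \<subseteq> set (f n)"
    and f: "\<And>n. henkin_step T (?E n) (f n) (f (Suc n))" by blast
  have step: "set (f n) \<subseteq> set (f (Suc n))"
    and dec: "?E n \<in> set (f (Suc n)) \<or> \<not> consistent T (?E n # f n)"
    and wN: "?E n = (\<^bold>\<not> AllN B) \<Longrightarrow> ?E n \<in> set (f (Suc n)) \<Longrightarrow> \<exists>t. (\<^bold>\<not> instN B t) \<in> set (f (Suc n))"
    and wS: "?E n = (\<^bold>\<not> AllS B) \<Longrightarrow> ?E n \<in> set (f (Suc n)) \<Longrightarrow> \<exists>X. (\<^bold>\<not> instS B X) \<in> set (f (Suc n))" for n B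
    using f[of n, unfolded henkin_step_def] by (blast, blast, metis, metis)
  have mono: "m \<le> n \<Longrightarrow> set (f m) \<subseteq> set (f n)" for m n by (rule lift_Suc_mono_le[where f="\<lambda>n. set (f n)", OF step])
  define H where "H = (\<Union>n. set (f n))"
  have fin: "\<exists>n. set G \<subseteq> set (f n)" if "set G \<subseteq> H" for G
    using that
  proof (induction G)
    case (Cons A G)
    then obtain m n where "set G \<subseteq> set (f n)" "A \<in> set (f m)" unfolding H_def by auto
    then have "set (A # G) \<subseteq> set (f (max m n))"
      using mono[of n "max m n"] mono[of m "max m n"] by auto
    then show ?case by blast
  qed simp
  \<comment> \<open>Witnesses are provided in the stage that deals with the formula, so a member of
    \<open>H\<close> must be shown to have entered by then. Otherwise it would be inconsistent with
    that stage, hence with a later stage that contains both.\<close>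
  have in_stage: "A \<in> set (f (Suc (to_nat A)))" if "A \<in> H" for A
  proof (rule ccontr)
    assume "A \<notin> set (f (Suc (to_nat A)))"
    then have inc: "deriv T (A # f (to_nat A)) \<^bold>\<bottom>" using dec[of "to_nat A"] unfolding consistent_def by simp
    from that obtain n where n: "A \<in> set (f n)" unfolding H_def by auto
    define N where "N = max n (to_nat A)"
    have "deriv T (f N) \<^bold>\<bottom>"
      by (rule deriv_weaken[OF inc]) (use n mono[of n N] mono[of "to_nat A" N] in \<open>auto simp: N_def\<close>)
    then show False using con unfolding consistent_def by blast
  qed
  have decided: "A \<in> H \<or> deriv T (A # f (to_nat A)) \<^bold>\<bottom>" for A
    using dec[of "to_nat A"] unfolding H_def consistent_def by auto
  have closed: "A \<in> H" if GH: "set G \<subseteq> H" and d: "deriv T G A" for G A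
  proof (rule ccontr)
    assume "A \<notin> H"
    then have inc: "deriv T (A # f (to_nat A)) \<^bold>\<bottom>" using decided by blast
    from fin[OF GH] obtain n where n: "set G \<subseteq> set (f n)" by blast
    define N where "N = max n (to_nat A)"
    have "deriv T (A # f N) \<^bold>\<bottom>"
      by (rule deriv_weaken[OF inc]) (use mono[of "to_nat A" N] in \<open>auto simp: N_def\<close>)
    moreover have "deriv T (f N) A"
      by (rule deriv_weaken[OF d]) (use n mono[of n N] in \<open>auto simp: N_def\<close>)
    ultimately show False using con deriv_cut unfolding consistent_def by blast
  qed
  have "henkin T H"
    unfolding henkin_def
  proof (intro conjI allI impI)
    show "\<And>G A. set G \<subseteq> H \<Longrightarrow> deriv T G A \<Longrightarrow> A \<in> H" by (rule closed)
    show "\<^bold>\<bottom> \<notin> H"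
    proof
      assume "\<^bold>\<bottom> \<in> H"
      then obtain n where "\<^bold>\<bottom> \<in> set (f n)" unfolding H_def by auto
      then show False using con[of n] deriv.Hyp unfolding consistent_def by blast
    qed
    fix A show "A \<in> H \<or> (\<^bold>\<not> A) \<in> H"
    proof (cases "A \<in> H")
      case False
      then have "deriv T (f (to_nat A)) (\<^bold>\<not> A)" using decided[of A] unfolding Neg_def by (blast intro: deriv.ImpI)
      then show ?thesis using closed[of "f (to_nat A)"] unfolding H_def by blast
    qed simp
  next
    fix B assume "(\<^bold>\<not> AllN B) \<in> H"
    from in_stage[OF this] wN[of "to_nat (\<^bold>\<not> AllN B)" B] show "\<exists>t. (\<^bold>\<not> instN B t) \<in> H"
      unfolding H_def by auto
  next
    fix B assume "(\<^bold>\<not> AllS B) \<in> H"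
    from in_stage[OF this] wS[of "to_nat (\<^bold>\<not> AllS B)" B] show "\<exists>X. (\<^bold>\<not> instS B X) \<in> H"
      unfolding H_def by auto
  qed
  moreover have "set G0 \<subseteq> H" using G0 unfolding H_def by blast
  ultimately show ?thesis by blast
qed

lemma henkin_Imp: "henkin T H \<Longrightarrow> (A \<^bold>\<longrightarrow> B) \<in> H \<longleftrightarrow> (A \<in> H \<longrightarrow> B \<in> H)"
proof -
  assume H: "henkin T H"
  have cl: "set G \<subseteq> H \<Longrightarrow> deriv T G A \<Longrightarrow> A \<in> H" for G A using H unfolding henkin_def by blast
  have 1: "B \<in> H" if "(A \<^bold>\<longrightarrow> B) \<in> H" "A \<in> H"
    by (rule cl[of "[A \<^bold>\<longrightarrow> B, A]"], use that in simp, rule deriv.ImpE[of _ _ A]) (auto intro: deriv.Hyp)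
  have 2: "(A \<^bold>\<longrightarrow> B) \<in> H" if "B \<in> H"
    by (rule cl[of "[B]"], use that in simp, rule deriv.ImpI) (auto intro: deriv.Hyp)
  have 3: "(A \<^bold>\<longrightarrow> B) \<in> H" if "A \<notin> H"
  proof (rule cl[of "[\<^bold>\<not> A]"])
    have "(\<^bold>\<not> A) \<in> H" using that H unfolding henkin_def by blast
    then show "set [\<^bold>\<not> A] \<subseteq> H" by simp
    have "deriv T [A, \<^bold>\<not> A] \<^bold>\<bottom>" by (rule deriv_NegE[of _ _ A]) (auto intro: deriv.Hyp)
    then have "deriv T ((\<^bold>\<not> B) # [A, \<^bold>\<not> A]) \<^bold>\<bottom>" by (rule deriv_weaken) auto
    then show "deriv T [\<^bold>\<not> A] (A \<^bold>\<longrightarrow> B)" by (rule deriv.ImpI[OF deriv.Raa])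
  qed
  show ?thesis using 1 2 3 by blast
qed

lemma henkin_Falsum: "henkin T H \<Longrightarrow> \<^bold>\<bottom> \<notin> H"
  unfolding henkin_def by blast

lemma henkin_Neg: "henkin T H \<Longrightarrow> (\<^bold>\<not> A) \<in> H \<longleftrightarrow> A \<notin> H"
  using henkin_Imp[of T H A "\<^bold>\<bottom>"] henkin_Falsum[of T H] unfolding Neg_def by blast

lemma henkin_closed: "henkin T H \<Longrightarrow> set G \<subseteq> H \<Longrightarrow> deriv T G A \<Longrightarrow> A \<in> H"
  unfolding henkin_def by blast

lemma henkin_theorem: "henkin T H \<Longrightarrow> deriv T [] B \<Longrightarrow> B \<in> H"
  by (rule henkin_closed[of T H "[]"]) auto

lemma henkin_AllN:
  assumes H: "henkin T H"
  shows "AllN A \<in> H \<longleftrightarrow> (\<forall>t. instN A t \<in> H)"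
proof
  assume A: "AllN A \<in> H"
  show "\<forall>t. instN A t \<in> H"
  proof
    fix t show "instN A t \<in> H"
      by (rule henkin_closed[OF H, of "[AllN A]"], use A in simp, rule deriv.AllNE, rule deriv.Hyp) simp
  qed
next
  show "\<forall>t. instN A t \<in> H \<Longrightarrow> AllN A \<in> H"
    using henkin_Neg[OF H] H unfolding henkin_def by blast
qed

lemma henkin_AllS:
  assumes H: "henkin T H"
  shows "AllS A \<in> H \<longleftrightarrow> (\<forall>X. instS A X \<in> H)"
proof
  assume A: "AllS A \<in> H"
  show "\<forall>X. instS A X \<in> H"
  proof
    fix X show "instS A X \<in> H"
      by (rule henkin_closed[OF H, of "[AllS A]"], use A in simp, rule deriv.AllSE, rule deriv.Hyp) simp
  qed
next
  show "\<forall>X. instS A X \<in> H \<Longrightarrow> AllS A \<in> H"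
    using henkin_Neg[OF H] H unfolding henkin_def by blast
qed

lemma henkin_EqSubst:
  assumes "henkin T H" "(s \<^bold>= t) \<in> H" "instN A s \<in> H"
  shows "instN A t \<in> H"
  by (rule henkin_closed[OF assms(1), of "[s \<^bold>= t, instN A s]"], use assms in simp, rule deriv.EqSubst[of _ _ s])
    (rule deriv.Hyp, simp)+

section \<open>Semantics\<close>

primrec evT :: "('x \<Rightarrow> 'm::{zero,one,plus,times,ord}) \<Rightarrow> (nat \<Rightarrow> 'm) \<Rightarrow> (nat \<Rightarrow> 'x) \<Rightarrow> tm \<Rightarrow> 'm" where
  "evT len e E (V i) = e i"
| "evT len e E \<^bold>0 = 0"
| "evT len e E \<^bold>1 = 1"
| "evT len e E (s \<^bold>+ t) = evT len e E s + evT len e E t"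
| "evT len e E (s \<^bold>* t) = evT len e E s * evT len e E t"
| "evT len e E (Len X) = len (E X)"

text \<open>Equality of sets is a parameter because the sets of the term model are the set variables
  themselves, not classes of them; there \<open>seq\<close> is membership of the equation in the
  Henkin set. In the standard model it is true equality.\<close>

primrec sat :: "('x \<Rightarrow> 'm::{zero,one,plus,times,ord}) \<Rightarrow> ('m \<Rightarrow> 'x \<Rightarrow> bool) \<Rightarrow> ('x \<Rightarrow> 'x \<Rightarrow> bool) \<Rightarrow>
    (nat \<Rightarrow> 'm) \<Rightarrow> (nat \<Rightarrow> 'x) \<Rightarrow> fm \<Rightarrow> bool" where
  "sat len mem seq e E \<^bold>\<bottom> = False"
| "sat len mem seq e E (s \<^bold>= t) = (evT len e E s = evT len e E t)"
| "sat len mem seq e E (SetEq X Y) = seq (E X) (E Y)"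
| "sat len mem seq e E (s \<^bold>\<le> t) = (evT len e E s \<le> evT len e E t)"
| "sat len mem seq e E (t \<^bold>\<in> X) = mem (evT len e E t) (E X)"
| "sat len mem seq e E (A \<^bold>\<longrightarrow> B) = (sat len mem seq e E A \<longrightarrow> sat len mem seq e E B)"
| "sat len mem seq e E (AllN A) = (\<forall>x. sat len mem seq (case_nat x e) E A)"
| "sat len mem seq e E (AllS A) = (\<forall>X. sat len mem seq e (case_nat X E) A)"

lemma evT_substT: "evT len e E (substT \<sigma> \<rho> t) = evT len (\<lambda>i. evT len e E (\<sigma> i)) (\<lambda>X. E (\<rho> X)) t"
  by (induction t) auto

lemma evT_up: "evT len e E (up k t) = evT len (\<lambda>i. e (i + k)) E t"
  by (simp add: up_def evT_substT)

lemma evT_up_simps [simp]: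
  "evT len (case_nat a e) E (up (Suc 0) t) = evT len e E t"
  "evT len (case_nat a (case_nat b e)) E (up 2 t) = evT len e E t"
  "evT len (case_nat a (case_nat b (case_nat c e))) E (up 3 t) = evT len e E t"
  "evT len (case_nat a (case_nat b (case_nat c (case_nat d e)))) E (up 4 t) = evT len e E t"
  by (simp_all add: evT_up numeral_eq_Suc)

lemma sat_substF:
  "sat len mem seq e E (substF \<sigma> \<rho> A) = sat len mem seq (\<lambda>i. evT len e E (\<sigma> i)) (\<lambda>X. E (\<rho> X)) A"
proof (induction A arbitrary: e E \<sigma> \<rho>)
  case (AllN A)
  have "(\<lambda>i. evT len (case_nat x e) E (under_N \<sigma> i)) = case_nat x (\<lambda>i. evT len e E (\<sigma> i))" for x
    by (auto simp: under_N_def split: nat.split)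
  then show ?case unfolding substF_AllN sat.simps AllN by simp
next
  case (AllS A)
  have "(\<lambda>i. evT len e (case_nat X E) (substT V Suc (\<sigma> i))) = (\<lambda>i. evT len e E (\<sigma> i))" for X
    by (simp add: evT_substT)
  moreover have "(\<lambda>Y. case_nat X E (under_S \<rho> Y)) = case_nat X (\<lambda>Y. E (\<rho> Y))" for X
    by (auto simp: under_S_def split: nat.split)
  ultimately show ?case unfolding substF_AllS sat.simps AllS by simp
qed (simp_all add: evT_substT)

lemma sat_connectives [simp]:
  "sat len mem seq e E (\<^bold>\<not> A) = (\<not> sat len mem seq e E A)"
  "sat len mem seq e E (A \<^bold>\<and> B) = (sat len mem seq e E A \<and> sat len mem seq e E B)"
  "sat len mem seq e E (A \<^bold>\<or> B) = (sat len mem seq e E A \<or> sat len mem seq e E B)"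
  "sat len mem seq e E (A \<^bold>\<longleftrightarrow> B) = (sat len mem seq e E A = sat len mem seq e E B)"
  "sat len mem seq e E (ExN A) = (\<exists>x. sat len mem seq (case_nat x e) E A)"
  "sat len mem seq e E (ExS A) = (\<exists>X. sat len mem seq e (case_nat X E) A)"
  "sat len mem seq e E (s \<^bold>< t) = (evT len e E s \<le> evT len e E t \<and> evT len e E s \<noteq> evT len e E t)"
  by (auto simp: Neg_def Conj_def Disj_def Iff_def ExN_def ExS_def Lt_def)

lemma sat_bounded [simp]:
  "sat len mem seq e E (AllLe t A) = (\<forall>x\<le>evT len e E t. sat len mem seq (case_nat x e) E A)"
  "sat len mem seq e E (ExLe t A) = (\<exists>x\<le>evT len e E t. sat len mem seq (case_nat x e) E A)"
  "sat len mem seq e E (AllLt t A) = (\<forall>x. x \<le> evT len e E t \<and> x \<noteq> evT len e E t \<longrightarrow> sat len mem seq (case_nat x e) E A)"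
  "sat len mem seq e E (ExLt t A) = (\<exists>x. (x \<le> evT len e E t \<and> x \<noteq> evT len e E t) \<and> sat len mem seq (case_nat x e) E A)"
  by (auto simp: AllLe_def ExLe_def AllLt_def ExLt_def)

lemma sat_liftN: "sat len mem seq (case_nat x e) E (liftN A) = sat len mem seq e E A"
  by (simp add: liftN_def sat_substF)

lemma sat_liftS: "sat len mem seq e (case_nat X E) (liftS A) = sat len mem seq e E A"
  by (simp add: liftS_def sat_substF)

lemma sat_instN: "sat len mem seq e E (instN A t) = sat len mem seq (case_nat (evT len e E t) e) E A"
proof -
  have "(\<lambda>i. evT len e E (case_nat t V i)) = case_nat (evT len e E t) e"
    by (auto split: nat.split)
  then show ?thesis by (simp add: instN_def sat_substF)
qed

lemma sat_instS: "sat len mem seq e E (instS A X) = sat len mem seq e (case_nat (E X) E) A"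
proof -
  have "(\<lambda>Y. E (case_nat X id Y)) = case_nat (E X) E"
    by (auto split: nat.split)
  then show ?thesis by (simp add: instS_def sat_substF)
qed

text \<open>Applied to the standard model of finite sets of natural numbers to show that
  \<open>V0\<close> is consistent.\<close>

lemma soundness:
  assumes "deriv T G A" and "\<And>B e E. B \<in> T \<Longrightarrow> sat len mem (=) e E B"
    and "\<And>B. B \<in> set G \<Longrightarrow> sat len mem (=) e E B"
  shows "sat len mem (=) e E A"
  using assms(1,3)
proof (induction arbitrary: e E rule: deriv.induct)
  case (Axiom A G) then show ?case using assms(2) by blast
next
  case (Raa A G)
  show ?case
  proof (rule ccontr)
    assume "\<not> ?thesis"
    then have "sat len mem (=) e E \<^bold>\<bottom>" by (intro Raa.IH) (use Raa.prems in auto)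
    then show False by simp
  qed
next
  case (ImpI A G B) then show ?case by auto
next
  case (AllNI G A)
  then show ?case by (auto simp: sat_liftN intro!: AllNI.IH)
next
  case (AllSI G A)
  then show ?case by (auto simp: sat_liftS intro!: AllSI.IH)
next
  case (AllNE G A t)
  then show ?case by (simp add: sat_instN)
next
  case (AllSE G A X)
  then show ?case by (simp add: sat_instS)
next
  case (EqSubst G s t A)
  from EqSubst.IH(1)[OF EqSubst.prems] EqSubst.IH(2)[OF EqSubst.prems] show ?case by (simp add: sat_instN)
next
  case (SetEqSubst G X Y A)
  from SetEqSubst.IH(1)[OF SetEqSubst.prems] SetEqSubst.IH(2)[OF SetEqSubst.prems] show ?case by (simp add: sat_instS)
qed simp_all

definition fset_len :: "nat fset \<Rightarrow> nat" where
  "fset_len S = (if S = {||} then 0 else Suc (Max (fset S)))"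

lemma fset_len_le_iff: "fset_len S \<le> k \<longleftrightarrow> (\<forall>x. x |\<in>| S \<longrightarrow> x < k)"
proof (cases "S = {||}")
  case False
  then have "fset S \<noteq> {}" by (metis bot_fset.rep_eq fset_inject)
  with False show ?thesis by (auto simp: fset_len_def Suc_le_eq)
qed (simp add: fset_len_def)

lemma fset_len_gt: "x |\<in>| S \<Longrightarrow> x < fset_len S"
  using fset_len_le_iff by blast

lemma fset_len_max: "Suc x = fset_len S \<Longrightarrow> x |\<in>| S"
  by (auto simp: fset_len_def split: if_splits intro!: Max_in)

lemma standard_model: "A \<in> V0 \<Longrightarrow> sat fset_len (|\<in>|) (=) e E A"
proof -
  assume "A \<in> V0"
  then consider "A \<in> two_basic" | B where "A = comprehension B" unfolding V0_def by auto
  then show ?thesis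
  proof cases
    case 1
    have se: "S = S'" if "fset_len S = fset_len S'" "\<forall>x. x \<le> fset_len S \<and> x \<noteq> fset_len S \<longrightarrow> x |\<in>| S = (x |\<in>| S')" for S S'
    proof (rule fset_eqI)
      fix x show "x |\<in>| S = (x |\<in>| S')"
        using that fset_len_gt[of x S] fset_len_gt[of x S'] by (metis less_imp_le nat_neq_iff)
    qed
    have pred: "\<exists>y\<le>x. Suc y = x" if "x > 0" for x
      using that by (cases x) auto
    have len: "x \<le> fset_len S \<and> x \<noteq> fset_len S" if "x |\<in>| S" for x S
      using fset_len_gt[OF that] by auto
    from 1 show ?thesis
      unfolding two_basic_def
    proof (elim insertE emptyE; hypsubst, simp_all)
      show "e 0 \<le> e (Suc 0) \<or> e (Suc 0) \<le> e 0" by linarith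
      show "(e 0 \<le> e (Suc 0)) = (e 0 \<le> Suc (e (Suc 0)) \<and> e 0 \<noteq> Suc (e (Suc 0)))" by linarith
      show "0 < e 0 \<longrightarrow> (\<exists>x\<le>e 0. Suc x = e 0)" by (blast intro: pred)
      show "e (Suc 0) |\<in>| E 0 \<longrightarrow> e (Suc 0) \<le> fset_len (E 0) \<and> e (Suc 0) \<noteq> fset_len (E 0)" by (blast dest: len)
      show "Suc (e (Suc 0)) = fset_len (E 0) \<longrightarrow> e (Suc 0) |\<in>| E 0" by (blast intro: fset_len_max)
      show "fset_len (E 0) = fset_len (E (Suc 0)) \<and>
        (\<forall>x. x \<le> fset_len (E 0) \<and> x \<noteq> fset_len (E 0) \<longrightarrow> (x |\<in>| E 0) = (x |\<in>| E (Suc 0))) \<longrightarrow> E 0 = E (Suc 0)"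
        using se[of "E 0" "E (Suc 0)"] by blast
    qed
  next
    case 2
    define S where "S = Abs_fset {z. z < e 0 \<and> sat fset_len (|\<in>|) (=) (case_nat z e) E B}"
    have S: "x |\<in>| S \<longleftrightarrow> x < e 0 \<and> sat fset_len (|\<in>|) (=) (case_nat x e) E B" for x
      unfolding S_def by (subst Abs_fset_inverse) auto
    have "fset_len S \<le> e 0" unfolding fset_len_le_iff using S by blast
    then show ?thesis unfolding 2 comprehension_def sat_connectives sat_bounded sat_liftS
      by (intro exI[of _ S]) (simp add: sat_liftS S)
  qed
qed

lemma V0_consistent: "consistent V0 []"
  unfolding consistent_def using soundness[of V0 "[]" "\<^bold>\<bottom>" fset_len "(|\<in>|)"] standard_model by auto

section \<open>The term model\<close>

definition jordan_sentence :: fm where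
  "jordan_sentence = AllN (AllN (AllS (AllN (AllS (AllN (AllN
      (jordan_curve_seq (V 4) (V 3) 1 (V 2) 0 (V 1) (V 0))))))))"

text \<open>The model is to become a type with class instances, and a type cannot depend on the
  local assumption that the sentence is unprovable. So one Henkin set is fixed beforehand. In the
  case of a provable sentence some Henkin set still has to exist, which is where the consistency of
  \<open>V0\<close> enters.\<close>

definition term_theory :: "fm set" where
  "term_theory = (SOME H. henkin V0 H \<and> (\<not> (V0 \<^bold>\<turnstile> jordan_sentence) \<longrightarrow> (\<^bold>\<not> jordan_sentence) \<in> H))"

lemma term_theory: "henkin V0 term_theory"
  and refutes: "\<not> (V0 \<^bold>\<turnstile> jordan_sentence) \<Longrightarrow> (\<^bold>\<not> jordan_sentence) \<in> term_theory"
proof -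
  have "\<exists>H. henkin V0 H \<and> (\<not> (V0 \<^bold>\<turnstile> jordan_sentence) \<longrightarrow> (\<^bold>\<not> jordan_sentence) \<in> H)"
  proof (cases "V0 \<^bold>\<turnstile> jordan_sentence")
    case True
    with henkin_exists[OF V0_consistent] show ?thesis by auto
  next
    case False
    then have "consistent V0 [\<^bold>\<not> jordan_sentence]"
      unfolding consistent_def proves_def using deriv.Raa by blast
    from henkin_exists[OF this] show ?thesis by auto
  qed
  from someI_ex[OF this] show "henkin V0 term_theory"
    "\<not> (V0 \<^bold>\<turnstile> jordan_sentence) \<Longrightarrow> (\<^bold>\<not> jordan_sentence) \<in> term_theory"
    unfolding term_theory_def by auto
qed

definition eq_tm :: "tm \<Rightarrow> tm \<Rightarrow> bool" where
  "eq_tm s t \<longleftrightarrow> (s \<^bold>= t) \<in> term_theory"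

lemma eq_tm_refl: "eq_tm t t"
  unfolding eq_tm_def by (rule henkin_theorem[OF term_theory deriv.EqRefl])

lemma instN_simps:
  "substT (case_nat t V) id (up 1 s) = s"
  "substT (case_nat t V) id (V 0) = t"
  by (simp_all add: substT_up substT_V_id del: One_nat_def)

lemma eq_tm_subst:
  assumes "eq_tm s t" "instN A s \<in> term_theory" shows "instN A t \<in> term_theory"
  using henkin_EqSubst[OF term_theory] assms unfolding eq_tm_def by blast

lemma eq_tm_sym: "eq_tm s t \<Longrightarrow> eq_tm t s"
  using eq_tm_subst[of s t "V 0 \<^bold>= up 1 s"] eq_tm_refl[of s]
  by (simp add: instN_def instN_simps eq_tm_def del: One_nat_def)

lemma eq_tm_trans: "eq_tm s t \<Longrightarrow> eq_tm t u \<Longrightarrow> eq_tm s u"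
  using eq_tm_subst[of t u "up 1 s \<^bold>= V 0"]
  by (simp add: instN_def instN_simps eq_tm_def del: One_nat_def)

lemma eq_tm_fun:
  assumes "eq_tm s s'" "eq_tm t t'"
  shows "eq_tm (s \<^bold>+ t) (s' \<^bold>+ t')" "eq_tm (s \<^bold>* t) (s' \<^bold>* t')"
proof -
  have "eq_tm (s \<^bold>+ t) (s' \<^bold>+ t)" "eq_tm (s \<^bold>* t) (s' \<^bold>* t)"
    using eq_tm_subst[OF assms(1), of "up 1 (s \<^bold>+ t) \<^bold>= V 0 \<^bold>+ up 1 t"] eq_tm_refl[of "s \<^bold>+ t"]
      eq_tm_subst[OF assms(1), of "up 1 (s \<^bold>* t) \<^bold>= V 0 \<^bold>* up 1 t"] eq_tm_refl[of "s \<^bold>* t"]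
    by (simp_all add: instN_def instN_simps eq_tm_def del: One_nat_def)
  moreover have "eq_tm (s' \<^bold>+ t) (s' \<^bold>+ t')" "eq_tm (s' \<^bold>* t) (s' \<^bold>* t')"
    using eq_tm_subst[OF assms(2), of "up 1 (s' \<^bold>+ t) \<^bold>= up 1 s' \<^bold>+ V 0"] eq_tm_refl[of "s' \<^bold>+ t"]
      eq_tm_subst[OF assms(2), of "up 1 (s' \<^bold>* t) \<^bold>= up 1 s' \<^bold>* V 0"] eq_tm_refl[of "s' \<^bold>* t"]
    by (simp_all add: instN_def instN_simps eq_tm_def del: One_nat_def)
  ultimately show "eq_tm (s \<^bold>+ t) (s' \<^bold>+ t')" "eq_tm (s \<^bold>* t) (s' \<^bold>* t')"
    using eq_tm_trans by blast+
qed

lemma eq_tm_Le: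
  assumes "eq_tm s s'" "eq_tm t t'"
  shows "(s \<^bold>\<le> t) \<in> term_theory \<longleftrightarrow> (s' \<^bold>\<le> t') \<in> term_theory"
proof -
  have *: "(s' \<^bold>\<le> t') \<in> term_theory" if "eq_tm s s'" "eq_tm t t'" "(s \<^bold>\<le> t) \<in> term_theory" for s s' t t'
    using eq_tm_subst[OF that(1), of "V 0 \<^bold>\<le> up 1 t"] eq_tm_subst[OF that(2), of "up 1 s' \<^bold>\<le> V 0"] that(3)
    by (simp add: instN_def instN_simps del: One_nat_def)
  show ?thesis using * assms eq_tm_sym by blast
qed

lemma eq_tm_Mem:
  assumes "eq_tm s s'" shows "(s \<^bold>\<in> X) \<in> term_theory \<longleftrightarrow> (s' \<^bold>\<in> X) \<in> term_theory"
proof -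
  have *: "(s' \<^bold>\<in> X) \<in> term_theory" if "eq_tm s s'" "(s \<^bold>\<in> X) \<in> term_theory" for s s'
    using eq_tm_subst[OF that(1), of "V 0 \<^bold>\<in> X"] that(2) by (simp add: instN_def)
  show ?thesis using * assms eq_tm_sym by blast
qed

quotient_type vnum = tm / eq_tm
proof (rule equivpI)
  show "reflp eq_tm" by (rule reflpI) (rule eq_tm_refl)
  show "symp eq_tm" by (rule sympI) (rule eq_tm_sym)
  show "transp eq_tm" by (rule transpI) (rule eq_tm_trans)
qed

instantiation vnum :: "{zero,one,plus,times,ord}"
begin

lift_definition zero_vnum :: vnum is "\<^bold>0" .
lift_definition one_vnum :: vnum is "\<^bold>1" .
lift_definition plus_vnum :: "vnum \<Rightarrow> vnum \<Rightarrow> vnum" is Plus by (rule eq_tm_fun)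
lift_definition times_vnum :: "vnum \<Rightarrow> vnum \<Rightarrow> vnum" is Times by (rule eq_tm_fun)
lift_definition less_eq_vnum :: "vnum \<Rightarrow> vnum \<Rightarrow> bool" is "\<lambda>s t. (s \<^bold>\<le> t) \<in> term_theory"
  by (rule eq_tm_Le)
definition "x < (y::vnum) \<longleftrightarrow> x \<le> y \<and> x \<noteq> y"

instance ..

end

lift_definition vlen :: "nat \<Rightarrow> vnum" is Len .
lift_definition vmem :: "vnum \<Rightarrow> nat \<Rightarrow> bool" is "\<lambda>t X. (t \<^bold>\<in> X) \<in> term_theory"
  by (rule ext) (rule eq_tm_Mem)

definition vseq :: "nat \<Rightarrow> nat \<Rightarrow> bool" where
  "vseq X Y \<longleftrightarrow> (SetEq X Y) \<in> term_theory"

lemma evT_abs: "evT vlen (\<lambda>i. abs_vnum (\<sigma> i)) \<rho> t = abs_vnum (substT \<sigma> \<rho> t)"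
  by (induction t) (simp_all add: zero_vnum.abs_eq one_vnum.abs_eq plus_vnum.abs_eq times_vnum.abs_eq vlen.abs_eq vlen_def)

lemma abs_vnum_surj: "\<exists>t. x = abs_vnum t"
  by (metis Quotient_abs_rep Quotient_vnum)

text \<open>Number quantifiers range over classes of terms and set quantifiers over variables,
  exactly the witnesses that \<open>henkin\<close> provides.\<close>

lemma truth: "sat vlen vmem vseq (\<lambda>i. abs_vnum (\<sigma> i)) \<rho> A \<longleftrightarrow> substF \<sigma> \<rho> A \<in> term_theory"
proof (induction A arbitrary: \<sigma> \<rho>)
  case Falsum then show ?case using henkin_Falsum[OF term_theory] by simp
next
  case (Eq s t) then show ?case by (simp add: evT_abs vnum.abs_eq_iff eq_tm_def)
next
  case (SetEq X Y) then show ?case by (simp add: vseq_def)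
next
  case (Le s t) then show ?case by (simp add: evT_abs less_eq_vnum.abs_eq)
next
  case (Mem t X) then show ?case by (simp add: evT_abs vmem.abs_eq)
next
  case (Imp A B) then show ?case by (simp add: henkin_Imp[OF term_theory])
next
  case (AllN A)
  have c: "case_nat (abs_vnum t) (\<lambda>i. abs_vnum (\<sigma> i)) = (\<lambda>i. abs_vnum (case_nat t \<sigma> i))" for t
    by (auto split: nat.split)
  have "(\<forall>x. sat vlen vmem vseq (case_nat x (\<lambda>i. abs_vnum (\<sigma> i))) \<rho> A) \<longleftrightarrow>
    (\<forall>t. sat vlen vmem vseq (case_nat (abs_vnum t) (\<lambda>i. abs_vnum (\<sigma> i))) \<rho> A)"
    using abs_vnum_surj by metis
  also have "\<dots> \<longleftrightarrow> AllN (substF (under_N \<sigma>) \<rho> A) \<in> term_theory"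
    unfolding c AllN henkin_AllN[OF term_theory] instN_substF ..
  finally show ?case unfolding substF_AllN sat.simps .
next
  case (AllS A)
  show ?case unfolding substF_AllS sat.simps AllS henkin_AllS[OF term_theory] instS_substF ..
qed

lemma theorem_sat:
  assumes "V0 \<^bold>\<turnstile> A" shows "sat vlen vmem vseq e E A"
proof -
  have "\<forall>i. \<exists>t. e i = abs_vnum t" using abs_vnum_surj by blast
  then obtain \<sigma> where "e = (\<lambda>i. abs_vnum (\<sigma> i))" by metis
  moreover have "substF \<sigma> E A \<in> term_theory"
    using henkin_theorem[OF term_theory, of "substF \<sigma> E A"] deriv_instance[of V0 "[]" A \<sigma> E] assms
    unfolding proves_def by simp
  ultimately show ?thesis using truth by simp
qed

lemma axiom_sat: "A \<in> V0 \<Longrightarrow> sat vlen vmem vseq e E A"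
  by (rule theorem_sat) (simp add: proves_def deriv.Axiom)

lemma term_model_complete:
  assumes "sat vlen vmem vseq (\<lambda>i. abs_vnum (V i)) (\<lambda>X. X) jordan_sentence"
  shows "V0 \<^bold>\<turnstile> jordan_sentence"
  using assms refutes henkin_Neg[OF term_theory] unfolding truth substF_V by blast

section \<open>Arithmetic of the term model\<close>

abbreviation "satV \<equiv> sat vlen vmem vseq"

text \<open>The even variables of a formula hold the environment, the odd ones are parameters: since every
  element of the model is the value of a term in the canonical valuation, they name all elements.\<close>

definition mix :: "(nat \<Rightarrow> vnum) \<Rightarrow> nat \<Rightarrow> vnum" where
  "mix e i = (if even i then e (i div 2) else abs_vnum (V (i div 2)))"

definition TM :: "((nat \<Rightarrow> vnum) \<Rightarrow> vnum) \<Rightarrow> bool" where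
  "TM f \<longleftrightarrow> (\<exists>t. \<forall>e. f e = evT vlen (mix e) (\<lambda>X. X) t)"

definition DM :: "((nat \<Rightarrow> vnum) \<Rightarrow> bool) \<Rightarrow> bool" where
  "DM P \<longleftrightarrow> (\<exists>A. Sigma0B A \<and> (\<forall>e. P e = satV (mix e) (\<lambda>X. X) A))"

lemma TM_var: "TM (\<lambda>e. e i)"
  unfolding TM_def by (rule exI[of _ "V (2 * i)"]) (simp add: mix_def)

lemma TM_const: "TM (\<lambda>e. c)"
proof -
  obtain t where t: "c = abs_vnum t" using abs_vnum_surj by blast
  have "evT vlen (mix e) (\<lambda>X. X) (substT (\<lambda>i. V (2 * i + 1)) (\<lambda>X. X) t) = c" for e
    by (simp add: evT_substT mix_def evT_abs[of V] substT_V t)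
  then show ?thesis unfolding TM_def by metis
qed

lemma TM_plus: "TM f \<Longrightarrow> TM g \<Longrightarrow> TM (\<lambda>e. f e + g e)"
  unfolding TM_def by (metis evT.simps(4))

lemma TM_times: "TM f \<Longrightarrow> TM g \<Longrightarrow> TM (\<lambda>e. f e * g e)"
  unfolding TM_def by (metis evT.simps(5))

lemma DM_False: "DM (\<lambda>e. False)"
  unfolding DM_def by (rule exI[of _ "\<^bold>\<bottom>"]) (simp add: Sigma0B.intros)

lemma DM_imp: "DM P \<Longrightarrow> DM Q \<Longrightarrow> DM (\<lambda>e. P e \<longrightarrow> Q e)"
  unfolding DM_def by (metis Sigma0B.intros(6) sat.simps(6))

lemma DM_eq: "TM f \<Longrightarrow> TM g \<Longrightarrow> DM (\<lambda>e. f e = g e)"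
  unfolding DM_def TM_def by (metis Sigma0B.intros(2) sat.simps(2))

lemma DM_le: "TM f \<Longrightarrow> TM g \<Longrightarrow> DM (\<lambda>e. f e \<le> g e)"
  unfolding DM_def TM_def by (metis Sigma0B.intros(4) sat.simps(4))

lemma DM_mem: "TM f \<Longrightarrow> DM (\<lambda>e. vmem (f e) X)"
  unfolding DM_def TM_def by (metis Sigma0B.intros(5) sat.simps(5))

lemma substF_bounded:
  "substF \<sigma> \<rho> (AllLe t A) = AllLe (substT \<sigma> \<rho> t) (substF (under_N \<sigma>) \<rho> A)"
  "substF \<sigma> \<rho> (ExLe t A) = ExLe (substT \<sigma> \<rho> t) (substF (under_N \<sigma>) \<rho> A)"
  "substF \<sigma> \<rho> (AllLt t A) = AllLt (substT \<sigma> \<rho> t) (substF (under_N \<sigma>) \<rho> A)"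
  "substF \<sigma> \<rho> (ExLt t A) = ExLt (substT \<sigma> \<rho> t) (substF (under_N \<sigma>) \<rho> A)"
  by (simp_all add: AllLe_def ExLe_def AllLt_def ExLt_def ExN_def Neg_def Conj_def Lt_def
      substT_up up_substT under_N_def del: One_nat_def)

lemma Sigma0B_substF: "Sigma0B A \<Longrightarrow> Sigma0B (substF \<sigma> \<rho> A)"
proof (induction arbitrary: \<sigma> \<rho> rule: Sigma0B.induct)
  case (6 A B) then show ?case by (simp add: Sigma0B.intros(6))
next
  case (7 A t) show ?case unfolding substF_bounded by (rule Sigma0B.intros(7)[OF "7.IH"])
next
  case (8 A t) show ?case unfolding substF_bounded by (rule Sigma0B.intros(8)[OF "8.IH"])
next
  case (9 A t) show ?case unfolding substF_bounded by (rule Sigma0B.intros(9)[OF "9.IH"])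
next
  case (10 A t) show ?case unfolding substF_bounded by (rule Sigma0B.intros(10)[OF "10.IH"])
qed (simp_all add: Sigma0B.intros)

lemma DM_ren:
  assumes "DM P" shows "DM (\<lambda>e. P (\<lambda>i. e (r i)))"
proof -
  obtain A where A: "Sigma0B A" "\<And>e. P e = satV (mix e) (\<lambda>X. X) A" using assms unfolding DM_def by blast
  define s where "s i = V (if even i then 2 * r (i div 2) else i)" for i
  have "(\<lambda>i. evT vlen (mix e) (\<lambda>X. X) (s i)) = mix (\<lambda>i. e (r i))" for e
    by (auto simp: s_def mix_def)
  then have "P (\<lambda>i. e (r i)) = satV (mix e) (\<lambda>X. X) (substF s (\<lambda>X. X) A)" for e
    unfolding A(2) sat_substF by simp
  then show ?thesis unfolding DM_def using Sigma0B_substF[OF A(1)] by blast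
qed

text \<open>One value for all variables at once: together with monotonicity this bounds a
  composition of functions.\<close>

lemma TM_subst:
  assumes p: "TM p" and f: "TM f" shows "TM (\<lambda>e. p (\<lambda>_. f e))"
proof -
  obtain t where t: "\<And>e. p e = evT vlen (mix e) (\<lambda>X. X) t" using p unfolding TM_def by blast
  obtain u where u: "\<And>e. f e = evT vlen (mix e) (\<lambda>X. X) u" using f unfolding TM_def by blast
  define s where "s i = (if even i then u else V i)" for i
  have "(\<lambda>i. evT vlen (mix e) (\<lambda>X. X) (s i)) = mix (\<lambda>_. f e)" for e
    by (auto simp: s_def mix_def u)
  then have "p (\<lambda>_. f e) = evT vlen (mix e) (\<lambda>X. X) (substT s (\<lambda>X. X) t)" for e
    unfolding t evT_substT by simp
  then show ?thesis unfolding TM_def by blast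
qed

lemma TM_ren:
  assumes "TM p" shows "TM (\<lambda>e. p (\<lambda>i. e (r i)))"
proof -
  obtain t where t: "\<And>e. p e = evT vlen (mix e) (\<lambda>X. X) t" using assms unfolding TM_def by blast
  define s where "s i = V (if even i then 2 * r (i div 2) else i)" for i
  have "(\<lambda>i. evT vlen (mix e) (\<lambda>X. X) (s i)) = mix (\<lambda>i. e (r i))" for e
    by (auto simp: s_def mix_def)
  then have "p (\<lambda>i. e (r i)) = evT vlen (mix e) (\<lambda>X. X) (substT s (\<lambda>X. X) t)" for e
    unfolding t evT_substT by simp
  then show ?thesis unfolding TM_def by blast
qed

lemma DM_all:
  assumes f: "TM f" and P: "DM (\<lambda>e. P (e 0) (\<lambda>i. e (Suc i)))"
  shows "DM (\<lambda>e. \<forall>x\<le>f e. P x e)"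
proof -
  obtain t where t: "\<And>e. f e = evT vlen (mix e) (\<lambda>X. X) t" using f unfolding TM_def by blast
  obtain A where A: "Sigma0B A" "\<And>e. P (e 0) (\<lambda>i. e (Suc i)) = satV (mix e) (\<lambda>X. X) A"
    using P unfolding DM_def by blast
  \<comment> \<open>Under the quantifier \<open>x\<close> is at index 0 and the old valuation one
    place further up, whereas \<open>mix (case_nat x e)\<close> moves the even positions up by two
    and leaves the odd ones. Hence an even position \<open>i\<close> is found at
    \<open>i - 1\<close> and an odd one at \<open>i + 1\<close>.\<close>
  define s where "s i = V (if i = 0 then 0 else if even i then i - 1 else Suc i)" for i
  have "(\<lambda>i. evT vlen (case_nat x (mix e)) (\<lambda>X. X) (s i)) = mix (case_nat x e)" for x e
  proof
    fix i show "evT vlen (case_nat x (mix e)) (\<lambda>X. X) (s i) = mix (case_nat x e) i"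
    proof (cases i)
      case (Suc j)
      show ?thesis
      proof (cases "even j")
        case True
        then show ?thesis using Suc by (simp add: s_def mix_def)
      next
        case False
        then obtain l where "j = 2 * l + 1" by (elim oddE)
        then show ?thesis using Suc by (simp add: s_def mix_def)
      qed
    qed (simp add: s_def mix_def)
  qed
  then have "P x e = satV (case_nat x (mix e)) (\<lambda>X. X) (substF s (\<lambda>X. X) A)" for x e
    using A(2)[of "case_nat x e"] unfolding sat_substF by simp
  then have "(\<forall>x\<le>f e. P x e) = satV (mix e) (\<lambda>X. X) (AllLe t (substF s (\<lambda>X. X) A))" for e
    using t by simp
  then show ?thesis unfolding DM_def using Sigma0B.intros(7)[OF Sigma0B_substF[OF A(1)]] by blast
qed

lemma DM_not: "DM P \<Longrightarrow> DM (\<lambda>e. \<not> P e)"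
  using DM_imp[OF _ DM_False] by simp

lemma DM_ex:
  "TM f \<Longrightarrow> DM (\<lambda>e. P (e 0) (\<lambda>i. e (Suc i))) \<Longrightarrow> DM (\<lambda>e. \<exists>x\<le>f e. P x e)"
  using DM_not[OF DM_all[of f "\<lambda>x e. \<not> P x e"]] DM_not[of "\<lambda>e. P (e 0) (\<lambda>i. e (Suc i))"] by simp

lemmas dm = TM_var TM_const TM_plus TM_times DM_False DM_imp DM_not DM_eq DM_le DM_all DM_ex

lemma vnum_comprehension:
  assumes "DM (\<lambda>e. P (e 0))"
  shows "\<exists>X. vlen X \<le> y \<and> (\<forall>z. z \<le> y \<and> z \<noteq> y \<longrightarrow> vmem z X = P z)"
proof -
  obtain A where A: "Sigma0B A" "\<And>e. P (e 0) = satV (mix e) (\<lambda>X. X) A" using assms unfolding DM_def by blast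
  \<comment> \<open>In the comprehension axiom index 0 is \<open>z\<close> and index 1 is the bound
    \<open>y\<close>. Moving the other variables by two keeps index 1 free and preserves the parity
    on which \<open>mix\<close> relies.\<close>
  define s where "s i = V (if i = 0 then 0 else i + 2)" for i :: nat
  define e where "e = case_nat y (\<lambda>i. mix (\<lambda>_. 0) i)"
  have "(\<lambda>i. evT vlen (case_nat z e) (\<lambda>X. X) (s i)) = mix (case_nat z (\<lambda>_. 0))" for z
  proof
    fix i show "evT vlen (case_nat z e) (\<lambda>X. X) (s i) = mix (case_nat z (\<lambda>_. 0)) i"
      by (cases i) (auto simp: s_def e_def mix_def split: nat.split)
  qed
  then have P: "satV (case_nat z e) (\<lambda>X. X) (substF s (\<lambda>X. X) A) = P z" for z
    using A(2)[of "case_nat z (\<lambda>_. 0)"] unfolding sat_substF by simp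
  have "comprehension (substF s (\<lambda>X. X) A) \<in> V0"
    unfolding V0_def using Sigma0B_substF[OF A(1)] by blast
  from axiom_sat[OF this, of e "\<lambda>X. X"] show ?thesis
    unfolding comprehension_def sat_connectives sat_bounded sat_liftS P by (auto simp: e_def)
qed

lemma vnum_axioms:
  fixes x y :: vnum
  shows B1: "x + 1 \<noteq> 0"
    and B2: "x + 1 = y + 1 \<Longrightarrow> x = y"
    and B3: "x + 0 = x"
    and B4: "x + (y + 1) = (x + y) + 1"
    and B5: "x * 0 = 0"
    and B6: "x * (y + 1) = (x * y) + x"
    and B7: "x \<le> y \<Longrightarrow> y \<le> x \<Longrightarrow> x = y"
    and B8: "x \<le> x + y"
    and B9: "0 \<le> x"
    and B10: "x \<le> y \<or> y \<le> x"
    and B11: "x \<le> y \<longleftrightarrow> x \<le> y + 1 \<and> x \<noteq> y + 1"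
    and B12: "x \<noteq> 0 \<Longrightarrow> \<exists>y\<le>x. y + 1 = x"
    and L1: "vmem y X \<Longrightarrow> y \<le> vlen X \<and> y \<noteq> vlen X"
    and L2: "y + 1 = vlen X \<Longrightarrow> vmem y X"
proof -
  have sat: "A \<in> V0 \<longrightarrow> satV (case_nat x (\<lambda>_. y)) (\<lambda>_. X) A" for A
    using axiom_sat by blast
  note ax = this[unfolded V0_def two_basic_def]
  show "x + 1 \<noteq> 0" using ax[of "\<^bold>\<not> V 0 \<^bold>+ \<^bold>1 \<^bold>= \<^bold>0"] by simp
  show "x + 1 = y + 1 \<Longrightarrow> x = y" using ax[of "V 0 \<^bold>+ \<^bold>1 \<^bold>= V 1 \<^bold>+ \<^bold>1 \<^bold>\<longrightarrow> V 0 \<^bold>= V 1"] by simp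
  show "x + 0 = x" using ax[of "V 0 \<^bold>+ \<^bold>0 \<^bold>= V 0"] by simp
  show "x + (y + 1) = (x + y) + 1" using ax[of "V 0 \<^bold>+ (V 1 \<^bold>+ \<^bold>1) \<^bold>= (V 0 \<^bold>+ V 1) \<^bold>+ \<^bold>1"] by simp
  show "x * 0 = 0" using ax[of "V 0 \<^bold>* \<^bold>0 \<^bold>= \<^bold>0"] by simp
  show "x * (y + 1) = (x * y) + x" using ax[of "V 0 \<^bold>* (V 1 \<^bold>+ \<^bold>1) \<^bold>= (V 0 \<^bold>* V 1) \<^bold>+ V 0"] by simp
  show "x \<le> y \<Longrightarrow> y \<le> x \<Longrightarrow> x = y" using ax[of "(V 0 \<^bold>\<le> V 1 \<^bold>\<and> V 1 \<^bold>\<le> V 0) \<^bold>\<longrightarrow> V 0 \<^bold>= V 1"] by simp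
  show "x \<le> x + y" using ax[of "V 0 \<^bold>\<le> V 0 \<^bold>+ V 1"] by simp
  show "0 \<le> x" using ax[of "\<^bold>0 \<^bold>\<le> V 0"] by simp
  show "x \<le> y \<or> y \<le> x" using ax[of "V 0 \<^bold>\<le> V 1 \<^bold>\<or> V 1 \<^bold>\<le> V 0"] by simp
  show "x \<le> y \<longleftrightarrow> x \<le> y + 1 \<and> x \<noteq> y + 1" using ax[of "V 0 \<^bold>\<le> V 1 \<^bold>\<longleftrightarrow> V 0 \<^bold>< V 1 \<^bold>+ \<^bold>1"] by simp
  show "x \<noteq> 0 \<Longrightarrow> \<exists>y\<le>x. y + 1 = x"
    using ax[of "\<^bold>\<not> V 0 \<^bold>= \<^bold>0 \<^bold>\<longrightarrow> ExLe (V 0) (V 0 \<^bold>+ \<^bold>1 \<^bold>= V 1)"] by simp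
  show "vmem y X \<Longrightarrow> y \<le> vlen X \<and> y \<noteq> vlen X" using ax[of "V 1 \<^bold>\<in> 0 \<^bold>\<longrightarrow> V 1 \<^bold>< Len 0"] by simp
  show "y + 1 = vlen X \<Longrightarrow> vmem y X" using ax[of "V 1 \<^bold>+ \<^bold>1 \<^bold>= Len 0 \<^bold>\<longrightarrow> V 1 \<^bold>\<in> 0"] by simp
qed

text \<open>A nonzero length is the successor of an element of the set, its largest one, by B12, L2
  and L1. For the set of those \<open>z \<le> x\<close> up to which \<open>P\<close> holds, this
  gives a \<open>k\<close> that cannot be less than \<open>x\<close>. The argument uses the bare
  axioms, since commutativity and the other laws are derived by this induction.\<close>

lemma vnum_induct:
  assumes D: "DM (\<lambda>e. P (e 0))" and 0: "P 0" and step: "\<And>x. P x \<Longrightarrow> P (x + 1)"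
  shows "P x"
proof -
  have "DM (\<lambda>e. \<forall>w\<le>e 0. P w)" using D by (intro dm)
  then obtain Y where Y0: "vlen Y \<le> x + 1" and Y1: "\<forall>z. z \<le> x + 1 \<and> z \<noteq> x + 1 \<longrightarrow> vmem z Y = (\<forall>w\<le>z. P w)"
    using vnum_comprehension[of "\<lambda>z. \<forall>w\<le>z. P w" "x + 1"] by blast
  have Y: "vmem z Y = (\<forall>w\<le>z. P w)" if "z \<le> x" for z
    by (rule Y1[rule_format]) (use B11[of z x] that in simp)
  have refl: "z \<le> z" for z :: vnum using B10[of z z] by simp
  have "vmem 0 Y" using Y[OF B9] 0 B7[OF _ B9] by metis
  then have "vlen Y \<noteq> 0" using L1 B7[OF B9] B9 by metis
  then obtain k where k: "k + 1 = vlen Y" using B12 by blast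
  have kY: "vmem k Y" by (rule L2[OF k])
  have "\<not> x + 1 \<le> k"
  proof
    assume "x + 1 \<le> k"
    then have "x + 1 \<le> k + 1" "x + 1 \<noteq> k + 1" using B11[of "x+1" k] by auto
    then show False using B7 Y0 k by metis
  qed
  then have "k \<le> x" using B10[of "x+1" k] B11[of k x] refl[of k] by metis
  then have all: "\<forall>w\<le>k. P w" using Y kY by blast
  then have "P (k + 1)" using step refl by blast
  then have all': "\<forall>w\<le>k+1. P w" using all B11[of _ k] by metis
  have "\<not> k + 1 \<le> x"
  proof
    assume "k + 1 \<le> x"
    then have "vmem (k + 1) Y" using Y all' by blast
    then show False using L1 k by metis
  qed
  then have "x \<le> k" using B10[of "k+1" x] B11[of x k] refl by metis
  then show ?thesis using all by blast
qed


lemma vnum_add_assoc: "(x + y) + z = x + (y + z :: vnum)"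
proof (rule vnum_induct[where P="\<lambda>z. (x + y) + z = x + (y + z)"])
  show "DM (\<lambda>e. (x + y) + e 0 = x + (y + e 0))" by (intro dm)
qed (simp_all add: B3 B4)

lemma vnum_zero_add: "0 + x = (x :: vnum)"
proof (rule vnum_induct[where P="\<lambda>x. 0 + x = x"])
  show "DM (\<lambda>e. 0 + e 0 = e 0)" by (intro dm)
qed (simp_all add: B3 B4)

lemma vnum_succ_add: "(x + 1) + y = (x + y) + (1 :: vnum)"
proof (rule vnum_induct[where P="\<lambda>y. (x + 1) + y = (x + y) + 1"])
  show "DM (\<lambda>e. (x + 1) + e 0 = (x + e 0) + 1)" by (intro dm)
qed (simp_all add: B3 B4)

lemma vnum_add_commute: "x + y = y + (x :: vnum)"
proof (rule vnum_induct[where P="\<lambda>y. x + y = y + x"])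
  show "DM (\<lambda>e. x + e 0 = e 0 + x)" by (intro dm)
qed (simp_all add: B3 B4 vnum_zero_add vnum_succ_add)

lemma vnum_add_cancel: "x + z = y + z \<Longrightarrow> x = (y :: vnum)"
proof -
  have "x + z = y + z \<longrightarrow> x = y"
  proof (rule vnum_induct[where P="\<lambda>z. x + z = y + z \<longrightarrow> x = y"])
    show "DM (\<lambda>e. x + e 0 = y + e 0 \<longrightarrow> x = y)" by (intro dm)
  qed (auto simp: B3 B4 dest: B2)
  then show "x + z = y + z \<Longrightarrow> x = y" by simp
qed

lemma vnum_zero_times: "0 * x = (0 :: vnum)"
proof (rule vnum_induct[where P="\<lambda>x. 0 * x = 0"])
  show "DM (\<lambda>e. 0 * e 0 = 0)" by (intro dm)
qed (simp_all add: B3 B5 B6)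

lemma vnum_succ_times: "(x + 1) * y = x * y + (y :: vnum)"
proof (rule vnum_induct[where P="\<lambda>y. (x + 1) * y = x * y + y"])
  show "DM (\<lambda>e. (x + 1) * e 0 = x * e 0 + e 0)" by (intro dm)
  fix y assume IH: "(x + 1) * y = x * y + y"
  have "(x + 1) * (y + 1) = (x * y + y) + (x + 1)" by (simp only: B6 IH)
  also have "\<dots> = (x * y + x) + (y + 1)" by (metis vnum_add_assoc vnum_add_commute)
  finally show "(x + 1) * (y + 1) = x * (y + 1) + (y + 1)" by (simp only: B6)
qed (simp_all add: B3 B5)

lemma vnum_times_commute: "x * y = y * (x :: vnum)"
proof (rule vnum_induct[where P="\<lambda>y. x * y = y * x"])
  show "DM (\<lambda>e. x * e 0 = e 0 * x)" by (intro dm)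
qed (simp_all add: B5 B6 vnum_zero_times vnum_succ_times)

lemma vnum_distrib: "x * (y + z) = x * y + x * (z :: vnum)"
proof (rule vnum_induct[where P="\<lambda>z. x * (y + z) = x * y + x * z"])
  show "DM (\<lambda>e. x * (y + e 0) = x * y + x * e 0)" by (intro dm)
  fix z assume IH: "x * (y + z) = x * y + x * z"
  show "x * (y + (z + 1)) = x * y + x * (z + 1)" by (simp only: B4 B6 IH) (simp only: vnum_add_assoc)
qed (simp_all add: B3 B5)

lemma vnum_times_one: "x * 1 = (x :: vnum)"
  using B6[of x 0] by (simp only: vnum_zero_add B5)

lemma vnum_times_assoc: "(x * y) * z = x * (y * z :: vnum)"
proof (rule vnum_induct[where P="\<lambda>z. (x * y) * z = x * (y * z)"])
  show "DM (\<lambda>e. (x * y) * e 0 = x * (y * e 0))" by (intro dm)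
qed (simp_all add: B5 B6 vnum_distrib vnum_times_one)

lemma vnum_le_iff_add: "x \<le> y \<longleftrightarrow> (\<exists>z. y = x + (z :: vnum))"
proof
  \<comment> \<open>The bound on \<open>z\<close> makes the induction predicate a bounded
    formula.\<close>
  have "\<forall>x\<le>y. \<exists>z\<le>y. y = x + z"
  proof (rule vnum_induct[where P="\<lambda>y. \<forall>x\<le>y. \<exists>z\<le>y. y = x + z"])
    show "DM (\<lambda>e. \<forall>x\<le>e 0. \<exists>z\<le>e 0. e 0 = x + z)" by (intro dm)
    have "x = 0" if "x \<le> 0" for x :: vnum by (rule B7[OF that B9])
    then show "\<forall>x\<le>0. \<exists>z\<le>0::vnum. 0 = x + z" using B3[of 0] B9 by metis
  next
    fix y :: vnum assume IH: "\<forall>x\<le>y. \<exists>z\<le>y. y = x + z"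
    show "\<forall>x\<le>y+1. \<exists>z\<le>y+1. y + 1 = x + z"
    proof (intro allI impI)
      fix x assume x: "x \<le> y + 1"
      show "\<exists>z\<le>y+1. y + 1 = x + z"
      proof (cases "x = y + 1")
        case True
        then show ?thesis using B3[of "y+1"] B9 by metis
      next
        case False
        then have "x \<le> y" using x B11[of x y] by simp
        with IH obtain z where "y = x + z" by metis
        then have e: "y + 1 = x + (z + 1)" by (simp add: B4)
        then have "z + 1 \<le> y + 1" using B8[of "z + 1" x] by (simp add: vnum_add_commute)
        with e show ?thesis by metis
      qed
    qed
  qed
  then show "x \<le> y \<Longrightarrow> \<exists>z. y = x + z" by metis
next
  assume "\<exists>z. y = x + z" then show "x \<le> y" using B8 by metis
qed

lemma vnum_le_refl: "x \<le> (x :: vnum)"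
  using B10[of x x] by simp

instance vnum :: "{linorder, comm_semiring_1, ordered_ab_semigroup_add}"
proof
  fix x y z :: vnum
  show "x + y + z = x + (y + z)" by (rule vnum_add_assoc)
  show "x + y = y + x" by (rule vnum_add_commute)
  show "0 + x = x" by (rule vnum_zero_add)
  show "x * y * z = x * (y * z)" by (rule vnum_times_assoc)
  show "x * y = y * x" by (rule vnum_times_commute)
  show "1 * x = x" using vnum_succ_times[of 0 x] by (simp add: vnum_zero_add vnum_zero_times)
  show "(x + y) * z = x * z + y * z" using vnum_distrib[of z x y] by (simp only: vnum_times_commute)
  show "0 * x = 0" by (rule vnum_zero_times)
  show "x * 0 = 0" by (rule B5)
  show "(0::vnum) \<noteq> 1" using B1[of 0] by (metis vnum_zero_add)
  show "x \<le> x" by (rule vnum_le_refl)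
  show "x \<le> y \<Longrightarrow> y \<le> z \<Longrightarrow> x \<le> z" unfolding vnum_le_iff_add using vnum_add_assoc by metis
  show "x \<le> y \<Longrightarrow> y \<le> x \<Longrightarrow> x = y" by (rule B7)
  show "(x < y) = (x \<le> y \<and> \<not> y \<le> x)" unfolding less_vnum_def using B7 vnum_le_refl by metis
  show "x \<le> y \<or> y \<le> x" by (rule B10)
  show "x \<le> y \<Longrightarrow> z + x \<le> z + y" unfolding vnum_le_iff_add using vnum_add_assoc by metis
qed

instance vnum :: cancel_semigroup_add
  by standard (metis vnum_add_cancel vnum_add_commute, rule vnum_add_cancel)

lemma vnum_less_iff: "x < y \<longleftrightarrow> x + 1 \<le> (y :: vnum)"
  using B11[of y x] by (metis B10 less_vnum_def not_le)

text \<open>The two sides differ by the product of the two positive differences. On pairs of numbers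
  this becomes strict monotonicity of multiplication.\<close>

lemma vnum_mult_less: "x < y \<Longrightarrow> u < v \<Longrightarrow> x * v + y * u < x * u + y * (v :: vnum)"
proof -
  assume "x < y" "u < v"
  then obtain p q where "y = x + 1 + p" "v = u + 1 + q"
    unfolding vnum_less_iff vnum_le_iff_add by blast
  then have "x * u + y * v = x * v + y * u + 1 + (p + q + p * q)"
    by (simp add: algebra_simps)
  then show ?thesis unfolding vnum_less_iff vnum_le_iff_add by blast
qed

section \<open>The ordered ring of differences\<close>

lemma vnum_add_le_cancel: "x + z \<le> y + z \<longleftrightarrow> x \<le> (y :: vnum)"
proof
  assume "x + z \<le> y + z"
  then obtain w where "y + z = (x + w) + z" unfolding vnum_le_iff_add by (auto simp: ac_simps)
  then have "y = x + w" by (rule vnum_add_cancel)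
  then show "x \<le> y" unfolding vnum_le_iff_add by blast
qed (rule add_right_mono)

lemma vnum_add_swap: "a + d = c + b \<Longrightarrow> c + f = e + d \<Longrightarrow> a + f = e + (b :: vnum)"
proof (rule vnum_add_cancel[of _ "c + d"])
  assume "a + d = c + b" "c + f = e + d"
  have "(a + f) + (c + d) = (a + d) + (c + f)" by (simp add: ac_simps)
  also have "\<dots> = (c + b) + (e + d)" by (simp only: \<open>a + d = c + b\<close> \<open>c + f = e + d\<close>)
  also have "\<dots> = (e + b) + (c + d)" by (simp add: ac_simps)
  finally show "(a + f) + (c + d) = (e + b) + (c + d)" .
qed

definition diff_eq :: "vnum \<times> vnum \<Rightarrow> vnum \<times> vnum \<Rightarrow> bool" where
  "diff_eq p q \<longleftrightarrow> fst p + snd q = fst q + snd p"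

quotient_type vint = "vnum \<times> vnum" / diff_eq
proof (rule equivpI)
  show "reflp diff_eq" by (rule reflpI) (simp add: diff_eq_def)
  show "symp diff_eq" by (rule sympI) (simp add: diff_eq_def)
  show "transp diff_eq" by (rule transpI) (auto simp: diff_eq_def dest: vnum_add_swap)
qed

lemma diff_eq_add: "diff_eq p p' \<Longrightarrow> diff_eq q q' \<Longrightarrow> diff_eq (fst p + fst q, snd p + snd q) (fst p' + fst q', snd p' + snd q')"
proof -
  assume 1: "diff_eq p p'" "diff_eq q q'"
  have "(fst p + fst q) + (snd p' + snd q') = (fst p + snd p') + (fst q + snd q')" by (simp add: ac_simps)
  also have "\<dots> = (fst p' + snd p) + (fst q' + snd q)" using 1 by (simp only: diff_eq_def)
  also have "\<dots> = (fst p' + fst q') + (snd p + snd q)" by (simp add: ac_simps)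
  finally show ?thesis by (simp add: diff_eq_def)
qed

lemma diff_eq_uminus: "diff_eq p p' \<Longrightarrow> diff_eq (snd p, fst p) (snd p', fst p')"
  unfolding diff_eq_def by (simp add: ac_simps)

lemma diff_eq_times1:
  assumes "diff_eq p p'"
  shows "diff_eq (fst p * fst q + snd p * snd q, fst p * snd q + snd p * fst q)
    (fst p' * fst q + snd p' * snd q, fst p' * snd q + snd p' * fst q)"
proof -
  have e: "fst p + snd p' = fst p' + snd p" using assms by (simp add: diff_eq_def)
  have "(fst p * fst q + snd p * snd q) + (fst p' * snd q + snd p' * fst q)
    = (fst p + snd p') * fst q + (fst p' + snd p) * snd q" by (simp add: algebra_simps)
  also have "\<dots> = (fst p' + snd p) * fst q + (fst p + snd p') * snd q" by (simp only: e)
  also have "\<dots> = (fst p' * fst q + snd p' * snd q) + (fst p * snd q + snd p * fst q)" by (simp add: algebra_simps)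
  finally show ?thesis by (simp add: diff_eq_def)
qed

lemma diff_eq_le: "diff_eq p p' \<Longrightarrow> diff_eq q q' \<Longrightarrow> fst p + snd q \<le> fst q + snd p \<longleftrightarrow> fst p' + snd q' \<le> fst q' + snd p'"
proof -
  assume 1: "diff_eq p p'" "diff_eq q q'"
  have "fst p + snd q \<le> fst q + snd p \<longleftrightarrow>
      (fst p + snd q) + (snd p' + fst q') \<le> (fst q + snd p) + (snd p' + fst q')"
    by (simp only: vnum_add_le_cancel)
  also have "(fst p + snd q) + (snd p' + fst q') = (fst p + snd p') + (fst q' + snd q)" by (simp add: ac_simps)
  also have "\<dots> = (fst p' + snd p) + (fst q + snd q')" using 1 by (simp only: diff_eq_def)
  also have "\<dots> = (fst p' + snd q') + (snd p + fst q)" by (simp add: ac_simps)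
  also have "(fst q + snd p) + (snd p' + fst q') = (fst q' + snd p') + (snd p + fst q)" by (simp add: ac_simps)
  finally show ?thesis by (simp only: vnum_add_le_cancel)
qed

instantiation vint :: "{comm_ring_1,ord}"
begin

lift_definition zero_vint :: vint is "(0, 0)" .
lift_definition one_vint :: vint is "(1, 0)" .
lift_definition plus_vint :: "vint \<Rightarrow> vint \<Rightarrow> vint" is "\<lambda>p q. (fst p + fst q, snd p + snd q)"
  by (rule diff_eq_add)
lift_definition uminus_vint :: "vint \<Rightarrow> vint" is "\<lambda>p. (snd p, fst p)"
  by (rule diff_eq_uminus)
definition minus_vint :: "vint \<Rightarrow> vint \<Rightarrow> vint" where "minus_vint x y = x + (- y)"
lift_definition times_vint :: "vint \<Rightarrow> vint \<Rightarrow> vint"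
  is "\<lambda>p q. (fst p * fst q + snd p * snd q, fst p * snd q + snd p * fst q)"
proof -
  fix p p' q q' assume 1: "diff_eq p p'" "diff_eq q q'"
  have "diff_eq (fst q * fst p' + snd q * snd p', fst q * snd p' + snd q * fst p')
    (fst q' * fst p' + snd q' * snd p', fst q' * snd p' + snd q' * fst p')"
    by (rule diff_eq_times1[OF 1(2)])
  then have 2: "diff_eq (fst p' * fst q + snd p' * snd q, fst p' * snd q + snd p' * fst q)
    (fst p' * fst q' + snd p' * snd q', fst p' * snd q' + snd p' * fst q')"
    by (simp add: ac_simps)
  show "diff_eq (fst p * fst q + snd p * snd q, fst p * snd q + snd p * fst q)
    (fst p' * fst q' + snd p' * snd q', fst p' * snd q' + snd p' * fst q')"
    by (rule equivp_transp[OF vint_equivp diff_eq_times1[OF 1(1)] 2])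
qed

lift_definition less_eq_vint :: "vint \<Rightarrow> vint \<Rightarrow> bool" is "\<lambda>p q. fst p + snd q \<le> fst q + snd p"
  by (rule diff_eq_le)
definition "x < (y::vint) \<longleftrightarrow> x \<le> y \<and> \<not> y \<le> x"

instance
proof
  fix a b c :: vint
  show "a * b * c = a * (b * c)" by transfer (simp add: diff_eq_def algebra_simps)
  show "a * b = b * a" by transfer (simp add: diff_eq_def algebra_simps)
  show "1 * a = a" by transfer (simp add: diff_eq_def)
  show "(a + b) * c = a * c + b * c" by transfer (simp add: diff_eq_def algebra_simps)
  show "(0::vint) \<noteq> 1" by transfer (simp add: diff_eq_def)
  show "a + b + c = a + (b + c)" by transfer (simp add: diff_eq_def ac_simps)
  show "a + b = b + a" by transfer (simp add: diff_eq_def ac_simps)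
  show "0 + a = a" by transfer (simp add: diff_eq_def)
  show "- a + a = 0" by transfer (simp add: diff_eq_def ac_simps)
  show "a - b = a + - b" by (rule minus_vint_def)
qed

end

instance vint :: linorder
proof
  fix x y z :: vint
  show "(x < y) = (x \<le> y \<and> \<not> y \<le> x)" by (rule less_vint_def)
  show "x \<le> x" by transfer simp
  show "x \<le> y \<Longrightarrow> y \<le> z \<Longrightarrow> x \<le> z"
  proof transfer
    fix p q r :: "vnum \<times> vnum" assume "fst p + snd q \<le> fst q + snd p" "fst q + snd r \<le> fst r + snd q"
    then have "(fst p + snd q) + (fst q + snd r) \<le> (fst q + snd p) + (fst r + snd q)" by (rule add_mono)
    then have "(fst p + snd r) + (fst q + snd q) \<le> (fst r + snd p) + (fst q + snd q)" by (simp add: ac_simps)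
    then show "fst p + snd r \<le> fst r + snd p" by (simp only: vnum_add_le_cancel)
  qed
  show "x \<le> y \<Longrightarrow> y \<le> x \<Longrightarrow> x = y" by transfer (simp add: diff_eq_def)
  show "x \<le> y \<or> y \<le> x" by transfer (rule linear)
qed

instantiation vint :: linordered_idom
begin

definition vint_abs: "\<bar>x::vint\<bar> = (if x < 0 then - x else x)"
definition "sgn (x::vint) = (if x = 0 then 0 else if 0 < x then 1 else - 1)"

instance
proof
  fix x y z :: vint
  show "x \<le> y \<Longrightarrow> z + x \<le> z + y"
  proof transfer
    fix p q r :: "vnum \<times> vnum" assume "fst p + snd q \<le> fst q + snd p"
    then have "(fst p + snd q) + (fst r + snd r) \<le> (fst q + snd p) + (fst r + snd r)" by (rule add_right_mono)
    then show "fst (fst r + fst p, snd r + snd p) + snd (fst r + fst q, snd r + snd q)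
      \<le> fst (fst r + fst q, snd r + snd q) + snd (fst r + fst p, snd r + snd p)" by (simp add: ac_simps)
  qed
  show "x < y \<Longrightarrow> 0 < z \<Longrightarrow> z * x < z * y"
    unfolding less_vint_def
  proof transfer
    fix p q r :: "vnum \<times> vnum"
    assume "fst p + snd q \<le> fst q + snd p \<and> \<not> fst q + snd p \<le> fst p + snd q"
      "fst (0, 0) + snd r \<le> fst r + snd (0, 0) \<and> \<not> fst r + snd (0, 0) \<le> fst (0, 0) + snd r"
    then have "fst p + snd q < fst q + snd p" "snd r < fst r" by auto
    from vnum_mult_less[OF this(2) this(1)]
    have "snd r * (fst q + snd p) + fst r * (fst p + snd q) < snd r * (fst p + snd q) + fst r * (fst q + snd p)" .
    then show "fst (fst r * fst p + snd r * snd p, fst r * snd p + snd r * fst p)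
        + snd (fst r * fst q + snd r * snd q, fst r * snd q + snd r * fst q)
      \<le> fst (fst r * fst q + snd r * snd q, fst r * snd q + snd r * fst q)
        + snd (fst r * fst p + snd r * snd p, fst r * snd p + snd r * fst p) \<and>
      \<not> fst (fst r * fst q + snd r * snd q, fst r * snd q + snd r * fst q)
        + snd (fst r * fst p + snd r * snd p, fst r * snd p + snd r * fst p)
      \<le> fst (fst r * fst p + snd r * snd p, fst r * snd p + snd r * fst p)
        + snd (fst r * fst q + snd r * snd q, fst r * snd q + snd r * fst q)"
      by (simp add: algebra_simps less_le_not_le)
  qed
  show "\<bar>x\<bar> = (if x < 0 then - x else x)" by (rule vint_abs)
  show "sgn x = (if x = 0 then 0 else if 0 < x then 1 else - 1)" by (rule sgn_vint_def)
qed

end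

lifting_forget vnum.lifting

lift_definition emb :: "vnum \<Rightarrow> vint" is "\<lambda>x. (x, 0)" .

lemma emb_simps [simp]:
  "emb 0 = 0" "emb 1 = 1" "emb (x + y) = emb x + emb y" "emb (x * y) = emb x * emb y"
  "emb x \<le> emb y \<longleftrightarrow> x \<le> y" "emb x = emb y \<longleftrightarrow> x = y"
  by (transfer; simp add: diff_eq_def)+

lemma emb_less [simp]: "emb x < emb y \<longleftrightarrow> x < y"
  by (simp add: less_le)

lemma emb_nonneg [simp]: "0 \<le> emb x"
  using emb_simps(5)[of 0 x] B9 by simp

lemma emb_diff: obtains x y where "z = emb x - emb y"
proof -
  have "\<exists>x y. z = emb x + - emb y"
  proof transfer
    fix p :: "vnum \<times> vnum"
    show "\<exists>x y. diff_eq p (fst (x, 0) + fst (snd (y, 0), fst (y, 0)), snd (x, 0) + snd (snd (y, 0), fst (y, 0)))"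
      by (rule exI[of _ "fst p"], rule exI[of _ "snd p"]) (simp add: diff_eq_def ac_simps)
  qed
  then obtain x y where "z = emb x + - emb y" by blast
  then show thesis by (intro that[of x y]) simp
qed

lemma nonneg_emb:
  assumes "0 \<le> z" obtains x where "z = emb x"
proof -
  obtain x y where z: "z = emb x - emb y" by (rule emb_diff)
  with assms have "y \<le> x" by simp
  then obtain w where "x = y + w" unfolding vnum_le_iff_add by blast
  with z show thesis by (intro that[of w]) simp
qed

lemma vint_discrete: "0 < (z :: vint) \<Longrightarrow> 1 \<le> z"
proof -
  assume z: "0 < z"
  then obtain x where x: "z = emb x" using nonneg_emb[of z] by auto
  then have "0 < x" using z emb_less[of 0 x] by simp
  then have "1 \<le> x" using vnum_less_iff[of 0 x] by simp
  then show ?thesis using x emb_simps(5)[of 1 x] by simp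
qed

section \<open>Definable predicates on the ring\<close>

text \<open>One ring variable takes two number variables, the minuend at the even and the subtrahend
  at the odd index. Definability over the ring is thereby reduced to definability over the
  model.\<close>

definition dec :: "(nat \<Rightarrow> vnum) \<Rightarrow> nat \<Rightarrow> vint" where
  "dec a i = emb (a (2 * i)) - emb (a (2 * i + 1))"

definition DZ :: "((nat \<Rightarrow> vint) \<Rightarrow> bool) \<Rightarrow> bool" where
  "DZ P \<longleftrightarrow> DM (\<lambda>a. P (dec a))"

text \<open>A function need not be a term, and the coordinates of a coded curve are not; its graph
  has to be definable and its values bounded by a term. The bound allows a bounded quantifier to
  introduce the value, as in \<open>DZ_subst\<close>.\<close>

definition FZ :: "((nat \<Rightarrow> vint) \<Rightarrow> vint) \<Rightarrow> bool" where
  "FZ f \<longleftrightarrow> (\<exists>p. TM p \<and> (\<forall>a. \<bar>f (dec a)\<bar> \<le> emb (p a))) \<and> DZ (\<lambda>e. e 0 = f (\<lambda>i. e (Suc i)))"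

lemma dec_ren: "(\<lambda>i. dec a (r i)) = dec (\<lambda>j. a (2 * r (j div 2) + j mod 2))"
  by (rule ext) (simp add: dec_def)

lemma dec_Suc: "(\<lambda>i. dec a (Suc i)) = dec (\<lambda>j. a (Suc (Suc j)))"
  by (rule ext) (simp add: dec_def)

lemma DZ_ren: "DZ P \<Longrightarrow> DZ (\<lambda>e. P (\<lambda>i. e (r i)))"
  unfolding DZ_def dec_ren[of _ r] by (rule DM_ren)

lemma DZ_False: "DZ (\<lambda>e. False)"
  unfolding DZ_def by (rule DM_False)

lemma DZ_imp: "DZ P \<Longrightarrow> DZ Q \<Longrightarrow> DZ (\<lambda>e. P e \<longrightarrow> Q e)"
  unfolding DZ_def by (rule DM_imp)

lemma DZ_not: "DZ P \<Longrightarrow> DZ (\<lambda>e. \<not> P e)"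
  using DZ_imp[OF _ DZ_False] by simp

lemma DZ_conj: "DZ P \<Longrightarrow> DZ Q \<Longrightarrow> DZ (\<lambda>e. P e \<and> Q e)"
  using DZ_not[OF DZ_imp[OF _ DZ_not]] by simp

text \<open>An element of absolute value at most \<open>emb p\<close> is \<open>emb x\<close> or
  \<open>- emb x\<close> with \<open>x \<le> p\<close>, so a quantifier over such elements becomes
  two bounded number quantifiers.\<close>

lemma abs_le_iff_emb:
  fixes P :: "vint \<Rightarrow> bool"
  shows "(\<forall>k. \<bar>k\<bar> \<le> emb p \<longrightarrow> P k) \<longleftrightarrow>
    (\<forall>y\<le>p. \<forall>x\<le>p. x \<le> y + p \<and> y \<le> x + p \<longrightarrow> P (emb x - emb y))"
proof safe
  fix x y assume P: "\<forall>k. \<bar>k\<bar> \<le> emb p \<longrightarrow> P k" and "x \<le> y + p" "y \<le> x + p"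
  then have "emb x \<le> emb (y + p)" "emb y \<le> emb (x + p)" by (simp_all del: emb_simps(3))
  then show "P (emb x - emb y)" using P by (auto simp: abs_le_iff)
next
  fix k assume A: "\<forall>y\<le>p. \<forall>x\<le>p. x \<le> y + p \<and> y \<le> x + p \<longrightarrow> P (emb x - emb y)" and k: "\<bar>k\<bar> \<le> emb p"
  show "P k"
  proof (cases "0 \<le> k")
    case True
    then obtain x where "k = emb x" by (rule nonneg_emb)
    then show ?thesis using A[rule_format, of 0 x] k B9 by (simp add: vnum_le_iff_add)
  next
    case False
    then obtain x where "- k = emb x" using nonneg_emb[of "- k"] by auto
    then have "k = emb 0 - emb x" by (simp add: minus_equation_iff)
    then show ?thesis using A[rule_format, of x 0] k B9 by (simp add: vnum_le_iff_add)
  qed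
qed

lemma DM_abs_bounded:
  assumes p: "TM p" and P: "DZ (\<lambda>e. P (e 0) (\<lambda>i. e (Suc i)))"
  shows "DM (\<lambda>a. \<forall>k. \<bar>k\<bar> \<le> emb (p a) \<longrightarrow> P k (dec a))"
proof -
  have 1: "DM (\<lambda>a. P (emb (a 0) - emb (a 1)) (dec (\<lambda>i. a (Suc (Suc i)))))"
    using P unfolding DZ_def dec_Suc by (simp add: dec_def)
  have p1: "TM (\<lambda>a. p (\<lambda>i. a (Suc i)))" "TM (\<lambda>a. p (\<lambda>i. a (Suc (Suc i))))"
    using TM_ren[OF p, of Suc] TM_ren[OF p, of "\<lambda>i. Suc (Suc i)"] by simp_all
  have conj: "DM P \<Longrightarrow> DM Q \<Longrightarrow> DM (\<lambda>a. P a \<and> Q a)" for P Q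
    using DM_not[OF DM_imp[OF _ DM_not]] by simp
  have "DM (\<lambda>a. \<forall>y\<le>p a. \<forall>x\<le>p a. x \<le> y + p a \<and> y \<le> x + p a \<longrightarrow> P (emb x - emb y) (dec a))"
    by (intro dm conj p p1) (use 1 in simp)
  then show ?thesis unfolding abs_le_iff_emb .
qed

text \<open>The value is named by a universal quantifier guarded by \<open>k = f e\<close>; the term
  bound for \<open>f\<close> makes that quantifier a bounded one.\<close>

lemma DZ_subst:
  assumes f: "FZ f" and P: "DZ (\<lambda>e. P (e 0) (\<lambda>i. e (Suc i)))"
  shows "DZ (\<lambda>e. P (f e) e)"
proof -
  obtain p where p: "TM p" "\<And>a. \<bar>f (dec a)\<bar> \<le> emb (p a)" using f unfolding FZ_def by blast
  have "DZ (\<lambda>e. e 0 = f (\<lambda>i. e (Suc i)) \<longrightarrow> P (e 0) (\<lambda>i. e (Suc i)))"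
    using f P unfolding FZ_def by (intro DZ_imp) blast+
  from DM_abs_bounded[OF p(1), of "\<lambda>k e. k = f e \<longrightarrow> P k e", OF this]
  have "DM (\<lambda>a. \<forall>k. \<bar>k\<bar> \<le> emb (p a) \<longrightarrow> k = f (dec a) \<longrightarrow> P k (dec a))" .
  moreover have "(\<forall>k. \<bar>k\<bar> \<le> emb (p a) \<longrightarrow> k = f (dec a) \<longrightarrow> P k (dec a)) = P (f (dec a)) (dec a)" for a
    using p(2) by blast
  ultimately show ?thesis unfolding DZ_def by simp
qed

lemma FZ_ren:
  assumes f: "FZ f" shows "FZ (\<lambda>e. f (\<lambda>i. e (r i)))"
  unfolding FZ_def
proof
  obtain p where p: "TM p" "\<And>a. \<bar>f (dec a)\<bar> \<le> emb (p a)" using f unfolding FZ_def by blast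
  show "\<exists>p. TM p \<and> (\<forall>a. \<bar>f (\<lambda>i. dec a (r i))\<bar> \<le> emb (p a))"
    unfolding dec_ren[of _ r] using TM_ren[OF p(1), of "\<lambda>j. 2 * r (j div 2) + j mod 2"] p(2) by blast
  have "DZ (\<lambda>e. e 0 = f (\<lambda>i. e (Suc i)))" using f unfolding FZ_def by blast
  from DZ_ren[OF this, of "case_nat 0 (\<lambda>i. Suc (r i))"] show "DZ (\<lambda>e. e 0 = f (\<lambda>i. e (Suc (r i))))" by simp
qed

lemma FZ_Suc: "FZ f \<Longrightarrow> FZ (\<lambda>e. f (\<lambda>i. e (Suc i)))"
  by (rule FZ_ren)

lemma DZ_subst2:
  assumes f: "FZ f" and g: "FZ g" and P: "DZ (\<lambda>e. P (e 0) (e 1) (\<lambda>i. e (Suc (Suc i))))"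
  shows "DZ (\<lambda>e. P (g e) (f e) e)"
proof -
  have "DZ (\<lambda>e. P (g (\<lambda>i. e (Suc i))) (e 0) (\<lambda>i. e (Suc i)))"
    by (rule DZ_subst[where P="\<lambda>k e. P k (e 0) (\<lambda>i. e (Suc i))", OF FZ_Suc[OF g]]) (use P in simp)
  from DZ_subst[where P="\<lambda>k e. P (g e) k e", OF f this] show ?thesis .
qed

lemma DZ_atoms:
  "DZ (\<lambda>e. e i \<le> e j)" "DZ (\<lambda>e. e i = e j)" "DZ (\<lambda>e. e i = c)" "DZ (\<lambda>e. e i = e j + e k)"
  "DZ (\<lambda>e. e i = e j - e k)" "DZ (\<lambda>e. e i = e j * e k)"
proof -
  have le: "emb a - emb b \<le> emb c - emb d \<longleftrightarrow> a + d \<le> c + b" for a b c d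
    using emb_simps(5)[of "a + d" "c + b"] by (simp add: algebra_simps)
  have eq: "emb a - emb b = emb c - emb d \<longleftrightarrow> a + d = c + b" for a b c d
    using emb_simps(6)[of "a + d" "c + b"] by (simp add: algebra_simps)
  have add: "(emb a - emb b) + (emb c - emb d) = emb (a + c) - emb (b + d)"
    "(emb a - emb b) - (emb c - emb d) = emb (a + d) - emb (b + c)"
    "(emb a - emb b) * (emb c - emb d) = emb (a * c + b * d) - emb (a * d + b * c)" for a b c d
    by (simp_all add: algebra_simps)
  show "DZ (\<lambda>e. e i \<le> e j)" "DZ (\<lambda>e. e i = e j)" "DZ (\<lambda>e. e i = e j + e k)"
    "DZ (\<lambda>e. e i = e j - e k)" "DZ (\<lambda>e. e i = e j * e k)"
    unfolding DZ_def dec_def le add eq by (intro dm)+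
  obtain x y where c: "c = emb x - emb y" by (rule emb_diff)
  show "DZ (\<lambda>e. e i = c)" unfolding DZ_def dec_def c eq by (intro dm)
qed

lemma FZ_var: "FZ (\<lambda>e. e i)"
  unfolding FZ_def
proof
  have "TM (\<lambda>a. a (2 * i) + a (2 * i + 1))" by (intro dm)
  moreover have "\<bar>dec a i\<bar> \<le> emb (a (2 * i) + a (2 * i + 1))" for a
    unfolding dec_def abs_le_iff using emb_nonneg[of "a (2*i)"] emb_nonneg[of "a (2*i+1)"]
    unfolding emb_simps by linarith
  ultimately show "\<exists>p. TM p \<and> (\<forall>a. \<bar>dec a i\<bar> \<le> emb (p a))" by (intro exI conjI allI)
  show "DZ (\<lambda>e. e 0 = e (Suc i))" by (rule DZ_atoms)
qed

lemma FZ_const: "FZ (\<lambda>e. c)"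
  unfolding FZ_def
proof
  obtain x where "\<bar>c\<bar> = emb x" using nonneg_emb[of "\<bar>c\<bar>"] by auto
  then show "\<exists>p. TM p \<and> (\<forall>a. \<bar>c\<bar> \<le> emb (p a))" using TM_const[of x] by (intro exI[of _ "\<lambda>_. x"]) simp
  show "DZ (\<lambda>e. e 0 = c)" by (rule DZ_atoms)
qed

lemma FZ_binary:
  assumes f: "FZ f" and g: "FZ g" and b: "\<And>a b. TM a \<Longrightarrow> TM b \<Longrightarrow> TM (\<lambda>e. op' (a e) (b e))"
    and bd: "\<And>x y p q. \<bar>x\<bar> \<le> emb p \<Longrightarrow> \<bar>y\<bar> \<le> emb q \<Longrightarrow> \<bar>op x y\<bar> \<le> emb (op' p q)"
    and at: "DZ (\<lambda>e. e 2 = op (e 1) (e 0))"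
  shows "FZ (\<lambda>e. op (f e) (g e))"
  unfolding FZ_def
proof
  obtain p where p: "TM p" "\<And>a. \<bar>f (dec a)\<bar> \<le> emb (p a)" using f unfolding FZ_def by blast
  obtain q where q: "TM q" "\<And>a. \<bar>g (dec a)\<bar> \<le> emb (q a)" using g unfolding FZ_def by blast
  show "\<exists>p. TM p \<and> (\<forall>a. \<bar>op (f (dec a)) (g (dec a))\<bar> \<le> emb (p a))"
    by (intro exI[of _ "\<lambda>a. op' (p a) (q a)"] conjI allI b p q bd)
  show "DZ (\<lambda>e. e 0 = op (f (\<lambda>i. e (Suc i))) (g (\<lambda>i. e (Suc i))))"
    by (rule DZ_subst2[where P="\<lambda>x y e. e 0 = op y x", OF FZ_Suc[OF f] FZ_Suc[OF g]])
      (use at in \<open>simp add: numeral_2_eq_2\<close>)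
qed

lemma FZ_add: "FZ f \<Longrightarrow> FZ g \<Longrightarrow> FZ (\<lambda>e. f e + g e)"
  by (rule FZ_binary[where op="(+)" and op'="(+)"]) (auto intro: TM_plus DZ_atoms simp: abs_le_iff)

lemma FZ_diff: "FZ f \<Longrightarrow> FZ g \<Longrightarrow> FZ (\<lambda>e. f e - g e)"
  by (rule FZ_binary[where op="(-)" and op'="(+)"]) (auto intro: TM_plus DZ_atoms simp: abs_le_iff)

lemma FZ_mult: "FZ f \<Longrightarrow> FZ g \<Longrightarrow> FZ (\<lambda>e. f e * g e)"
  by (rule FZ_binary[where op="(*)" and op'="(*)"])
    (auto intro: TM_times DZ_atoms simp: abs_mult intro!: mult_mono)

lemma DZ_le: "FZ f \<Longrightarrow> FZ g \<Longrightarrow> DZ (\<lambda>e. f e \<le> g e)"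
  by (rule DZ_subst2[where P="\<lambda>x y e. y \<le> x"]) (auto intro: DZ_atoms)

lemma DZ_ball:
  assumes f: "FZ f" and g: "FZ g" and P: "DZ (\<lambda>e. P (e 0) (\<lambda>i. e (Suc i)))"
  shows "DZ (\<lambda>e. \<forall>k\<in>{f e..g e}. P k e)"
proof -
  obtain p where p: "TM p" "\<And>a. \<bar>f (dec a)\<bar> \<le> emb (p a)" using f unfolding FZ_def by blast
  obtain q where q: "TM q" "\<And>a. \<bar>g (dec a)\<bar> \<le> emb (q a)" using g unfolding FZ_def by blast
  have pq: "TM (\<lambda>a. p a + q a)" by (intro dm p q)
  have "DZ (\<lambda>e. f (\<lambda>i. e (Suc i)) \<le> e 0 \<and> e 0 \<le> g (\<lambda>i. e (Suc i)) \<longrightarrow> P (e 0) (\<lambda>i. e (Suc i)))"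
    by (intro DZ_imp DZ_conj DZ_le FZ_var FZ_Suc f g P)
  from DM_abs_bounded[OF pq, of "\<lambda>k e. f e \<le> k \<and> k \<le> g e \<longrightarrow> P k e", OF this]
  have "DM (\<lambda>a. \<forall>k. \<bar>k\<bar> \<le> emb (p a + q a) \<longrightarrow> f (dec a) \<le> k \<and> k \<le> g (dec a) \<longrightarrow> P k (dec a))" .
  moreover have "(\<forall>k. \<bar>k\<bar> \<le> emb (p a + q a) \<longrightarrow> f (dec a) \<le> k \<and> k \<le> g (dec a) \<longrightarrow> P k (dec a)) \<longleftrightarrow>
      (\<forall>k\<in>{f (dec a)..g (dec a)}. P k (dec a))" for a
  proof -
    have "\<bar>k\<bar> \<le> emb (p a + q a)" if "f (dec a) \<le> k" "k \<le> g (dec a)" for k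
      using p(2)[of a] q(2)[of a] that unfolding abs_le_iff emb_simps by linarith
    then show ?thesis by auto
  qed
  ultimately show ?thesis unfolding DZ_def by simp
qed

lemma evT_mono: "(\<And>i. e i \<le> e' i) \<Longrightarrow> evT vlen e E t \<le> evT vlen e' E t"
proof (induction t)
  case (Times s t)
  have "x * y \<le> x' * y'" if "x \<le> x'" "y \<le> y'" for x y x' y' :: vnum
    using that unfolding vnum_le_iff_add by (auto simp: algebra_simps) (metis add.assoc)
  then show ?case using Times by simp
qed (auto intro: add_mono)

lemma TM_mono: "TM p \<Longrightarrow> (\<And>i. a i \<le> a' i) \<Longrightarrow> p a \<le> p a'"
  unfolding TM_def by (auto simp: mix_def intro!: evT_mono)

text \<open>The bound of \<open>X (f e)\<close> uses that terms are monotone.\<close>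

lemma FZ_comp:
  assumes X: "FZ (\<lambda>e. X (e 0))" and f: "FZ f" shows "FZ (\<lambda>e. X (f e))"
  unfolding FZ_def
proof
  obtain p where p: "TM p" "\<And>a. \<bar>X (dec a 0)\<bar> \<le> emb (p a)" using X unfolding FZ_def by blast
  obtain q where q: "TM q" "\<And>a. \<bar>f (dec a)\<bar> \<le> emb (q a)" using f unfolding FZ_def by blast
  have "\<bar>X (f (dec a))\<bar> \<le> emb (p (\<lambda>_. q a))" for a
  proof -
    obtain x y where xy: "f (dec a) = emb x - emb y" "x \<le> q a" "y \<le> q a"
    proof (cases "0 \<le> f (dec a)")
      case True
      then obtain x where "f (dec a) = emb x" by (rule nonneg_emb)
      then show thesis using q(2)[of a] B9 by (intro that[of x 0]) simp_all
    next
      case False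
      then obtain x where x: "- f (dec a) = emb x" using nonneg_emb[of "- f (dec a)"] by auto
      then have "f (dec a) = emb 0 - emb x" by (simp add: minus_equation_iff)
      moreover have "- f (dec a) \<le> emb (q a)" using q(2)[of a] by (simp add: abs_le_iff)
      ultimately show thesis using B9 x by (intro that[of 0 x]) simp_all
    qed
    \<comment> \<open>A valuation that codes \<open>f (dec a)\<close> as ring variable 0 and has
      entries at most \<open>q a\<close> everywhere, so that monotonicity of \<open>p\<close>
      compares it with the constant valuation.\<close>
    define a' where "a' i = (if i = 0 then x else if i = 1 then y else 0)" for i :: nat
    have "f (dec a) = dec a' 0" by (simp add: dec_def a'_def xy)
    then have "\<bar>X (f (dec a))\<bar> \<le> emb (p a')" using p(2) by simp
    also have "\<dots> \<le> emb (p (\<lambda>_. q a))"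
      unfolding emb_simps by (rule TM_mono[OF p(1)]) (use xy B9 in \<open>auto simp: a'_def\<close>)
    finally show ?thesis .
  qed
  then show "\<exists>p. TM p \<and> (\<forall>a. \<bar>X (f (dec a))\<bar> \<le> emb (p a))" using TM_subst[OF p(1) q(1)] by blast
  have "DZ (\<lambda>e. e 0 = X (e (Suc 0)))" using X unfolding FZ_def by blast
  then have "DZ (\<lambda>e. e 1 = X (e 0))" using DZ_ren[of "\<lambda>e. e 0 = X (e (Suc 0))" "\<lambda>i. 1 - i"] by simp
  from DZ_subst[where P="\<lambda>k e. e 0 = X k", OF FZ_Suc[OF f]] this
  show "DZ (\<lambda>e. e 0 = X (f (\<lambda>i. e (Suc i))))" by simp
qed

lemma vint_induct:
  assumes D: "DZ (\<lambda>e. P (e 0))" and 0: "P 0" and step: "\<And>k. 0 \<le> k \<Longrightarrow> P k \<Longrightarrow> P (k + 1)" and k: "0 \<le> k"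
  shows "P k"
proof -
  obtain x where x: "k = emb x" using k by (rule nonneg_emb)
  have "DM (\<lambda>a. P (emb (a 0) - emb (a 1)))" using D unfolding DZ_def dec_def by simp
  then have "DM (\<lambda>a. P (emb (a 1) - emb (a 0)))"
    using DM_ren[of "\<lambda>a. P (emb (a 0) - emb (a 1))" "\<lambda>i. 1 - i"] by simp
  \<comment> \<open>The quantifier over \<open>y \<le> 0\<close> fixes the subtrahend to 0 and
    leaves a predicate of one number variable, as \<open>vnum_induct\<close> requires.\<close>
  then have "DM (\<lambda>a. \<forall>y\<le>0. P (emb (a 0) - emb y))" by (intro dm) simp
  moreover have "(\<forall>y\<le>0. P (z - emb y)) = P z" for z
  proof -
    have "y \<le> 0 \<longleftrightarrow> y = 0" for y :: vnum using B7[OF _ B9] vnum_le_refl by metis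
    then show ?thesis by simp
  qed
  ultimately have "DM (\<lambda>a. P (emb (a 0)))" by simp
  then have "P (emb x)"
    by (rule vnum_induct[where P="\<lambda>x. P (emb x)"]) (use 0 step in auto)
  then show ?thesis using x by simp
qed

definition memZ :: "vint \<Rightarrow> nat \<Rightarrow> bool" where
  "memZ k X \<longleftrightarrow> (\<exists>x. k = emb x \<and> vmem x X)"

lemma DZ_mem: assumes f: "FZ f" shows "DZ (\<lambda>e. memZ (f e) X)"
proof -
  have eq: "memZ (emb a - emb b) X \<longleftrightarrow> (\<exists>x\<le>a. a = x + b \<and> vmem x X)" for a b
  proof -
    have "emb a - emb b = emb x \<longleftrightarrow> a = x + b" for x
      using emb_simps(6)[of a "x + b"] by (auto simp: algebra_simps)
    moreover have "a = x + b \<Longrightarrow> x \<le> a" for x by (auto simp: vnum_le_iff_add)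
    ultimately show ?thesis unfolding memZ_def by blast
  qed
  have conj: "DM P \<Longrightarrow> DM Q \<Longrightarrow> DM (\<lambda>a. P a \<and> Q a)" for P Q
    using DM_not[OF DM_imp[OF _ DM_not]] by simp
  have "DZ (\<lambda>e. memZ (e 0) X)"
    unfolding DZ_def dec_def eq by (intro dm conj DM_mem)
  then show ?thesis by (rule DZ_subst[where P="\<lambda>k e. memZ k X", OF f])
qed

section \<open>Decoding the sentence\<close>

interpretation vint: definability DZ FZ
proof
  show "\<And>P k. DZ (\<lambda>e. P (e 0)) \<Longrightarrow> P 0 \<Longrightarrow> (\<And>k. 0 \<le> k \<Longrightarrow> P k \<Longrightarrow> P (k + 1)) \<Longrightarrow> 0 \<le> k \<Longrightarrow> P k"
    by (rule vint_induct)
qed (fact DZ_False DZ_imp DZ_le DZ_ball DZ_ren FZ_ren FZ_var FZ_const FZ_add FZ_diff FZ_comp vint_discrete)+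

section \<open>Pairs, entries and edges over the ring\<close>

definition zpair :: "vint \<Rightarrow> vint \<Rightarrow> vint" where
  "zpair x y = (x + y) * (x + y + 1) + (1 + 1) * y"

definition zentry :: "nat \<Rightarrow> vint \<Rightarrow> vint \<Rightarrow> bool" where
  "zentry Z k e \<longleftrightarrow>
    (0 \<le> e \<and> e < emb (vlen Z) \<and> memZ (zpair k e) Z \<and> (\<forall>z\<in>{0..e-1}. \<not> memZ (zpair k z) Z)) \<or>
    (e = emb (vlen Z) \<and> (\<forall>z\<in>{0..emb (vlen Z)-1}. \<not> memZ (zpair k z) Z))"

definition zedge :: "nat \<Rightarrow> vint \<Rightarrow> vint \<Rightarrow> vint \<Rightarrow> vint \<Rightarrow> vint \<Rightarrow> bool" where
  "zedge Z k x y x' y' \<longleftrightarrow> zentry Z k (zpair (zpair x y) (zpair x' y'))"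

text \<open>With \<open>s = x + y\<close> the value lies between \<open>s * (s + 1)\<close> and
  \<open>s * (s + 1) + 2 * s\<close>, hence below \<open>(s + 1) * (s + 2)\<close>, where the values
  for larger sums begin. So it determines \<open>s\<close>, and then \<open>y\<close>.\<close>

lemma zpair_inj:
  assumes "0 \<le> x" "0 \<le> y" "0 \<le> x'" "0 \<le> y'" "zpair x y = zpair x' y'"
  shows "x = x' \<and> y = y'"
proof -
  have *: "\<not> x + y < x' + y'" if "0 \<le> x" "0 \<le> y" "0 \<le> x'" "0 \<le> y'" "zpair x y = zpair x' y'" for x y x' y'
  proof
    assume "x + y < x' + y'"
    then have s: "x + y + 1 \<le> x' + y'" using vint.less_iff_le by blast
    have "(x + y + 1) * (x + y + 1 + 1) \<le> (x' + y') * (x' + y' + 1)"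
      by (rule mult_mono) (use s that in auto)
    then have "(x + y) * (x + y + 1) + (x + y + 1) + (x + y + 1) \<le> (x' + y') * (x' + y' + 1)"
      by (simp add: algebra_simps)
    moreover have "(x' + y') * (x' + y' + 1) \<le> zpair x' y'" using that unfolding zpair_def by simp
    moreover have "zpair x y \<le> (x + y) * (x + y + 1) + (x + y) + (x + y)"
      using that unfolding zpair_def distrib_right mult_1_left by linarith
    ultimately show False using that(5) zero_less_one[where 'a=vint] by linarith
  qed
  have s: "x + y = x' + y'"
    using *[OF assms] *[OF assms(3,4,1,2) assms(5)[symmetric]] by simp
  have "y = y'" using assms(5) unfolding zpair_def s by simp
  with s show ?thesis by simp
qed

lemma zpair_nonneg: "0 \<le> x \<Longrightarrow> 0 \<le> y \<Longrightarrow> 0 \<le> zpair x y"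
  unfolding zpair_def by simp

lemma zentry_fun:
  assumes "zentry Z k e" "zentry Z k e'" shows "e = e'"
proof -
  have *: "\<not> e < e'" if "zentry Z k e" "zentry Z k e'" for e e'
    using that vint.less_iff_le unfolding zentry_def by (auto simp: le_diff_eq)
  show ?thesis using *[OF assms] *[OF assms(2,1)] by simp
qed

lemma zedge_fun:
  assumes "zedge Z k x y x' y'" "zedge Z k u v u' v'"
    and "0 \<le> x" "0 \<le> y" "0 \<le> x'" "0 \<le> y'" "0 \<le> u" "0 \<le> v" "0 \<le> u'" "0 \<le> v'"
  shows "x = u \<and> y = v \<and> x' = u' \<and> y' = v'"
proof -
  have "zpair (zpair x y) (zpair x' y') = zpair (zpair u v) (zpair u' v')"
    using assms(1,2) zentry_fun unfolding zedge_def by blast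
  then have "zpair x y = zpair u v \<and> zpair x' y' = zpair u' v'"
    by (intro zpair_inj zpair_nonneg) (use assms in auto)
  then show ?thesis using zpair_inj assms by metis
qed

lemma FZ_zpair: "FZ f \<Longrightarrow> FZ g \<Longrightarrow> FZ (\<lambda>e. zpair (f e) (g e))"
  unfolding zpair_def by (intro FZ_add FZ_mult FZ_const)

lemma DZ_zentry: "FZ f \<Longrightarrow> FZ g \<Longrightarrow> DZ (\<lambda>e. zentry Z (f e) (g e))"
proof -
  have "DZ (\<lambda>e. zentry Z (e 0) (e 1))"
    unfolding zentry_def by (intro vint.dfn DZ_mem FZ_zpair)
  then show "FZ f \<Longrightarrow> FZ g \<Longrightarrow> DZ (\<lambda>e. zentry Z (f e) (g e))" by (rule vint.D_comp2)
qed

lemma DZ_zedge: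
  "FZ k \<Longrightarrow> FZ x \<Longrightarrow> FZ y \<Longrightarrow> FZ x' \<Longrightarrow> FZ y' \<Longrightarrow> DZ (\<lambda>e. zedge Z (k e) (x e) (y e) (x' e) (y' e))"
  unfolding zedge_def by (intro DZ_zentry FZ_zpair)

text \<open>The geometry works with total functions, so they take the value 0 where \<open>Q\<close>
  gives no point. Their graphs are definable because \<open>fun_Q\<close> leaves no choice, and
  \<open>n\<close> bounds the values.\<close>

lemma coordinate_functions:
  assumes D: "DZ (\<lambda>e. Q (e 0) (e 1) (e 2))" and n: "0 \<le> n"
    and fun_Q: "\<And>k x y x' y'. Q k x y \<Longrightarrow> Q k x' y' \<Longrightarrow> {x, y, x', y'} \<subseteq> {0..n} \<Longrightarrow> x = x' \<and> y = y'"
  shows "\<exists>X Y. FZ (\<lambda>e. X (e 0)) \<and> FZ (\<lambda>e. Y (e 0)) \<and> (\<forall>k. 0 \<le> X k \<and> X k \<le> n) \<and> (\<forall>k. 0 \<le> Y k \<and> Y k \<le> n) \<and>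
    (\<forall>k x y. Q k x y \<and> x \<in> {0..n} \<and> y \<in> {0..n} \<longrightarrow> X k = x \<and> Y k = y)"
proof -
  have main: "\<exists>X. FZ (\<lambda>e. X (e 0)) \<and> (\<forall>k. 0 \<le> X k \<and> X k \<le> n) \<and> (\<forall>k x y. Q k x y \<and> x \<in> {0..n} \<and> y \<in> {0..n} \<longrightarrow> X k = x)"
    if D: "DZ (\<lambda>e. Q (e 0) (e 1) (e 2))"
    and fun_Q: "\<And>k x y x' y'. Q k x y \<Longrightarrow> Q k x' y' \<Longrightarrow> {x, y, x', y'} \<subseteq> {0..n} \<Longrightarrow> x = x' \<and> y = y'" for Q
  proof -
    define S where "S k x \<longleftrightarrow> x \<in> {0..n} \<and> (\<exists>y\<in>{0..n}. Q k x y)" for k x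
    define X where "X k = (if \<exists>x. S k x then SOME x. S k x else 0)" for k
    have S: "X k = x" if "S k x" for k x
    proof -
      have "S k (X k)" unfolding X_def using that by (auto intro: someI)
      then show ?thesis using that fun_Q unfolding S_def by auto
    qed
    have bd: "0 \<le> X k \<and> X k \<le> n" for k
    proof (cases "\<exists>x. S k x")
      case True
      then obtain x where "S k x" by blast
      then show ?thesis using S[of k x] unfolding S_def by auto
    next
      case False
      then have "X k = 0" unfolding X_def by (rule if_not_P)
      then show ?thesis using n by simp
    qed
    have "x = X k \<longleftrightarrow> S k x \<or> (x = 0 \<and> \<not> (\<exists>x. S k x))" for x k
    proof (cases "\<exists>x. S k x")
      case True
      then obtain z where z: "S k z" by blast
      then have "X k = z" by (rule S)
      then show ?thesis using z S by metis
    next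
      case False
      then have "X k = 0" unfolding X_def by (rule if_not_P)
      then show ?thesis using False by auto
    qed
    then have graph: "x = X k \<longleftrightarrow> (\<exists>y\<in>{0..n}. 0 \<le> x \<and> x \<le> n \<and> Q k x y) \<or>
        (x = 0 \<and> \<not> (\<exists>x\<in>{0..n}. \<exists>y\<in>{0..n}. Q k x y))" for x k
      unfolding S_def by auto
    have D3: "DZ (\<lambda>e. Q (e i) (e j) (e l))" for i j l
      using DZ_ren[OF D, of "\<lambda>r. if r = 0 then i else if r = 1 then j else l"] by simp
    have "FZ (\<lambda>e. X (e 0))"
      unfolding FZ_def
    proof
      obtain b where b: "n = emb b" using n by (rule nonneg_emb)
      show "\<exists>p. TM p \<and> (\<forall>a. \<bar>X (dec a 0)\<bar> \<le> emb (p a))"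
        by (rule exI[of _ "\<lambda>_. b"]) (use bd b in \<open>auto intro: TM_const\<close>)
      show "DZ (\<lambda>e. e 0 = X (e (Suc 0)))"
        unfolding graph by (intro vint.dfn D3)
    qed
    moreover have "\<forall>k x y. Q k x y \<and> x \<in> {0..n} \<and> y \<in> {0..n} \<longrightarrow> X k = x"
      using S unfolding S_def by blast
    ultimately show ?thesis using bd by blast
  qed
  have D': "DZ (\<lambda>e. Q (e 0) (e 2) (e 1))"
    using DZ_ren[OF D, of "\<lambda>r. if r = 0 then 0 else if r = 1 then 2 else 1"] by simp
  have "\<exists>X. FZ (\<lambda>e. X (e 0)) \<and> (\<forall>k. 0 \<le> X k \<and> X k \<le> n) \<and> (\<forall>k x y. Q k x y \<and> x \<in> {0..n} \<and> y \<in> {0..n} \<longrightarrow> X k = x)"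
    by (rule main[of Q, OF D]) (use fun_Q in blast)
  then obtain X where X: "FZ (\<lambda>e. X (e 0))" "\<forall>k. 0 \<le> X k \<and> X k \<le> n"
    "\<forall>k x y. Q k x y \<and> x \<in> {0..n} \<and> y \<in> {0..n} \<longrightarrow> X k = x" by blast
  have "\<exists>Y. FZ (\<lambda>e. Y (e 0)) \<and> (\<forall>k. 0 \<le> Y k \<and> Y k \<le> n) \<and> (\<forall>k y x. Q k x y \<and> y \<in> {0..n} \<and> x \<in> {0..n} \<longrightarrow> Y k = y)"
  proof (rule main[of "\<lambda>k y x. Q k x y", OF D'])
    fix k x y x' y' assume "Q k y x" "Q k y' x'" "{x, y, x', y'} \<subseteq> {0..n}"
    then show "x = x' \<and> y = y'" using fun_Q[of k y x y' x'] by simp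
  qed
  then obtain Y where Y: "FZ (\<lambda>e. Y (e 0))" "\<forall>k. 0 \<le> Y k \<and> Y k \<le> n"
    "\<forall>k y x. Q k x y \<and> y \<in> {0..n} \<and> x \<in> {0..n} \<longrightarrow> Y k = y" by blast
  show ?thesis
  proof (intro exI conjI)
    show "FZ (\<lambda>e. X (e 0))" "FZ (\<lambda>e. Y (e 0))" by fact+
    show "\<forall>k. 0 \<le> X k \<and> X k \<le> n" "\<forall>k. 0 \<le> Y k \<and> Y k \<le> n" by fact+
    show "\<forall>k x y. Q k x y \<and> x \<in> {0..n} \<and> y \<in> {0..n} \<longrightarrow> X k = x \<and> Y k = y" using X(3) Y(3) by blast
  qed
qed

text \<open>The curve is run through twice, so that a full period following any crossing
  \<open>i < t\<close> is available without reducing indices modulo \<open>t\<close>.\<close>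

lemma closed_curve_loop:
  assumes n: "0 \<le> n" and t: "4 \<le> t"
    and edge: "\<And>k. 0 \<le> k \<Longrightarrow> k < t \<Longrightarrow> \<exists>x\<in>{0..n}. \<exists>y\<in>{0..n}. \<exists>x'\<in>{0..n}. \<exists>y'\<in>{0..n}. zedge Z k x y x' y' \<and> grid_adj x y x' y'"
    and next_edge: "\<And>k x y x' y' u v u' v'. 0 \<le> k \<Longrightarrow> k + 1 < t \<Longrightarrow> zedge Z k x y x' y' \<Longrightarrow> zedge Z (k + 1) u v u' v' \<Longrightarrow>
      {x, y, x', y', u, v, u', v'} \<subseteq> {0..n} \<Longrightarrow> x' = u \<and> y' = v"
    and distinct: "\<And>k l x y x' y' u v u' v'. 0 \<le> k \<Longrightarrow> k < t \<Longrightarrow> 0 \<le> l \<Longrightarrow> l < t \<Longrightarrow> k \<noteq> l \<Longrightarrow>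
      zedge Z k x y x' y' \<Longrightarrow> zedge Z l u v u' v' \<Longrightarrow> {x, y, x', y', u, v, u', v'} \<subseteq> {0..n} \<Longrightarrow> \<not> (x = u \<and> y = v)"
    and closed: "\<And>x y x' y' u v u' v'. zedge Z (t - 1) x y x' y' \<Longrightarrow> zedge Z 0 u v u' v' \<Longrightarrow>
      {x, y, x', y', u, v, u', v'} \<subseteq> {0..n} \<Longrightarrow> x' = u \<and> y' = v"
  obtains X Y where "FZ (\<lambda>e. X (e 0))" "FZ (\<lambda>e. Y (e 0))" "\<And>k. 0 \<le> X k \<and> X k \<le> n" "\<And>k. 0 \<le> Y k \<and> Y k \<le> n"
    "loop_on X Y 0 (2 * t) t"
    "\<And>k. 0 \<le> k \<Longrightarrow> k \<le> t \<Longrightarrow> X (k + t) = X k \<and> Y (k + t) = Y k"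
    "\<And>k. 0 \<le> k \<Longrightarrow> k < t \<Longrightarrow> zedge Z k (X k) (Y k) (X (k + 1)) (Y (k + 1))"
proof -
  \<comment> \<open>Point \<open>k\<close> is the start of edge \<open>k\<close>, of edge
    \<open>k - t\<close> in the second round, and of edge 0 at the final index
    \<open>2 * t\<close>.\<close>
  define Q where "Q k x y \<longleftrightarrow> (\<exists>x'\<in>{0..n}. \<exists>y'\<in>{0..n}.
     (0 \<le> k \<and> k < t \<and> zedge Z k x y x' y') \<or> (t \<le> k \<and> k < 2 * t \<and> zedge Z (k - t) x y x' y') \<or>
     (k = 2 * t \<and> zedge Z 0 x y x' y'))" for k x y
  have DQ: "DZ (\<lambda>e. Q (e 0) (e 1) (e 2))" unfolding Q_def by (intro vint.dfn DZ_zedge)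
  have fun_Q: "x = x' \<and> y = y'" if "Q k x y" "Q k x' y'" "{x, y, x', y'} \<subseteq> {0..n}" for k x y x' y'
  proof -
    from that(1) obtain a b where a: "a \<in> {0..n}" "b \<in> {0..n}"
      "(0 \<le> k \<and> k < t \<and> zedge Z k x y a b) \<or> (t \<le> k \<and> k < 2 * t \<and> zedge Z (k - t) x y a b) \<or> (k = 2 * t \<and> zedge Z 0 x y a b)"
      unfolding Q_def by blast
    from that(2) obtain c d where c: "c \<in> {0..n}" "d \<in> {0..n}"
      "(0 \<le> k \<and> k < t \<and> zedge Z k x' y' c d) \<or> (t \<le> k \<and> k < 2 * t \<and> zedge Z (k - t) x' y' c d) \<or> (k = 2 * t \<and> zedge Z 0 x' y' c d)"
      unfolding Q_def by blast
    obtain l where "zedge Z l x y a b" "zedge Z l x' y' c d"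
    proof -
      consider "k < t" | "t \<le> k" "k < 2 * t" | "k = 2 * t" "t \<le> k" using a(3) t by force
      then show thesis using a(3) c(3) that by cases auto
    qed
    from zedge_fun[OF this] show ?thesis using that(3) a(1,2) c(1,2) by simp
  qed
  have "\<exists>X Y. FZ (\<lambda>e. X (e 0)) \<and> FZ (\<lambda>e. Y (e 0)) \<and> (\<forall>k. 0 \<le> X k \<and> X k \<le> n) \<and> (\<forall>k. 0 \<le> Y k \<and> Y k \<le> n) \<and>
    (\<forall>k x y. Q k x y \<and> x \<in> {0..n} \<and> y \<in> {0..n} \<longrightarrow> X k = x \<and> Y k = y)"
    by (rule coordinate_functions[OF DQ n]) (rule fun_Q)
  then obtain X Y where XY: "FZ (\<lambda>e. X (e 0))" "FZ (\<lambda>e. Y (e 0))" "\<And>k. 0 \<le> X k \<and> X k \<le> n" "\<And>k. 0 \<le> Y k \<and> Y k \<le> n"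
    and q: "\<And>k x y. Q k x y \<Longrightarrow> x \<in> {0..n} \<Longrightarrow> y \<in> {0..n} \<Longrightarrow> X k = x \<and> Y k = y"
    by blast
  have bX: "X k \<in> {0..n}" "Y k \<in> {0..n}" for k using XY by auto
  have low: "\<exists>a\<in>{0..n}. \<exists>b\<in>{0..n}. zedge Z k (X k) (Y k) a b \<and> grid_adj (X k) (Y k) a b \<and> X (k + t) = X k \<and> Y (k + t) = Y k"
    if k: "0 \<le> k" "k < t" for k
  proof -
    from edge[OF k] obtain x y a b where e: "x \<in> {0..n}" "y \<in> {0..n}" "a \<in> {0..n}" "b \<in> {0..n}"
      "zedge Z k x y a b" "grid_adj x y a b" by blast
    have "Q k x y" unfolding Q_def using e k by blast
    then have 1: "X k = x \<and> Y k = y" using q e by blast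
    have "t \<le> k + t" "k + t < 2 * t" "k + t - t = k" using k by auto
    then have "Q (k + t) x y" unfolding Q_def using e by (metis (no_types, lifting))
    then have "X (k + t) = x \<and> Y (k + t) = y" using q e by blast
    with 1 have eq: "X k = x" "Y k = y" "X (k + t) = x" "Y (k + t) = y" by auto
    show ?thesis unfolding eq using e by blast
  qed
  have top: "X (2 * t) = X 0 \<and> Y (2 * t) = Y 0"
  proof -
    have "0 < t" using t by linarith
    from low[OF order.refl this] obtain a b where "a \<in> {0..n}" "b \<in> {0..n}" "zedge Z 0 (X 0) (Y 0) a b" by blast
    then have "Q (2 * t) (X 0) (Y 0)" unfolding Q_def by blast
    then show ?thesis using q bX by blast
  qed
  have per: "X (k + t) = X k \<and> Y (k + t) = Y k" if k: "0 \<le> k" "k \<le> t" for k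
  proof (cases "k = t")
    case True
    have "0 < t" using t by linarith
    with low[of 0] have a: "X t = X 0 \<and> Y t = Y 0" by auto
    have tt: "t + t = 2 * t" by (rule mult_2[symmetric])
    show ?thesis unfolding True tt using top a by metis
  next
    case False
    then have "k < t" using k by simp
    with low[OF k(1)] show ?thesis by blast
  qed
  have edgeXY: "zedge Z k (X k) (Y k) (X (k + 1)) (Y (k + 1)) \<and> grid_adj (X k) (Y k) (X (k + 1)) (Y (k + 1))"
    if k: "0 \<le> k" "k < t" for k
  proof -
    from low[OF k] obtain a b where ab: "a \<in> {0..n}" "b \<in> {0..n}" "zedge Z k (X k) (Y k) a b" "grid_adj (X k) (Y k) a b" by blast
    have "a = X (k + 1) \<and> b = Y (k + 1)"
    proof (cases "k + 1 < t")
      case True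
      have "0 \<le> k + 1" using k by simp
      from low[OF this True] obtain c d where "c \<in> {0..n}" "d \<in> {0..n}" "zedge Z (k+1) (X (k+1)) (Y (k+1)) c d" by blast
      then show ?thesis using next_edge[OF k(1) True ab(3)] ab bX by simp
    next
      case False
      then have "k + 1 = t" using k(2) vint.less_iff_le[of k t] by auto
      then have kt: "k = t - 1" "k + 1 = 0 + t" by auto
      have "0 < t" using t by linarith
      from low[OF order.refl this] obtain c d where "c \<in> {0..n}" "d \<in> {0..n}" "zedge Z 0 (X 0) (Y 0) c d" by blast
      then have "a = X 0 \<and> b = Y 0" using closed[OF ab(3)[unfolded kt(1)]] ab bX by simp
      then show ?thesis using per[of 0] t unfolding kt(2) by simp
    qed
    with ab show ?thesis by blast
  qed
  have dist: "\<not> (X k = X l \<and> Y k = Y l)" if "0 \<le> k" "k < t" "0 \<le> l" "l < t" "k \<noteq> l" for k l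
    using distinct[OF that conjunct1[OF edgeXY[OF that(1,2)]] conjunct1[OF edgeXY[OF that(3,4)]]] bX by simp
  have loop: "loop_on X Y 0 (2 * t) t"
    unfolding loop_on_def
  proof (intro conjI ballI impI)
    show "3 \<le> t" using t by linarith
    show "path_on X Y 0 (2 * t)" unfolding path_on_def
    proof
      fix k assume k: "k \<in> {0..2 * t - 1}"
      show "grid_adj (X k) (Y k) (X (k + 1)) (Y (k + 1))"
      proof (cases "k < t")
        case True then show ?thesis using edgeXY k by auto
      next
        case False
        have "k < 2 * t" using k zero_less_one[where 'a=vint] by auto
        then have j: "0 \<le> k - t" "k - t < t" "k - t \<le> t" "0 \<le> k - t + 1" "k - t + 1 \<le> t"
          using False vint.less_iff_le[of k "2 * t"] by auto
        have "grid_adj (X (k - t)) (Y (k - t)) (X (k - t + 1)) (Y (k - t + 1))" using edgeXY[OF j(1,2)] by blast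
        moreover have "X k = X (k - t)" "Y k = Y (k - t)" using per[OF j(1,3)] by auto
        moreover have "X (k + 1) = X (k - t + 1)" "Y (k + 1) = Y (k - t + 1)" using per[OF j(4,5)] by auto
        ultimately show ?thesis by simp
      qed
    qed
    fix k l assume k: "k \<in> {0..2 * t}" and l: "l \<in> {0..2 * t}" and kl: "k < l \<and> l < k + t"
    \<comment> \<open>Each index is congruent modulo \<open>t\<close> to an index of the first round
      with the same point. Different indices less than \<open>t\<close> apart have different
      residues, so \<open>dist\<close> separates their points.\<close>
    have red: "\<exists>j. 0 \<le> j \<and> j < t \<and> X i = X j \<and> Y i = Y j \<and> (i = j \<or> i = j + t \<or> i = j + 2 * t)"
      if i: "i \<in> {0..2 * t}" for i
    proof -
      consider "i < t" | "t \<le> i" "i < 2 * t" | "i = 2 * t" using i by force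
      then show ?thesis
      proof cases
        case 1 then show ?thesis using i by auto
      next
        case 2 then show ?thesis using per[of "i - t"] by (intro exI[of _ "i - t"]) auto
      next
        case 3 then show ?thesis using top t by (intro exI[of _ 0]) auto
      qed
    qed
    from red[OF k] obtain k' where k': "0 \<le> k'" "k' < t" "X k = X k'" "Y k = Y k'" "k = k' \<or> k = k' + t \<or> k = k' + 2 * t" by blast
    from red[OF l] obtain l' where l': "0 \<le> l'" "l' < t" "X l = X l'" "Y l = Y l'" "l = l' \<or> l = l' + t \<or> l = l' + 2 * t" by blast
    have "k' \<noteq> l'"
    proof
      assume "k' = l'"
      then show False using k'(5) l'(5) kl t by (elim disjE conjE) linarith+
    qed
    then show "\<not> (X k = X l \<and> Y k = Y l)" using dist[OF k'(1,2) l'(1,2)] k' l' by simp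
  qed
  show thesis by (rule that[OF XY loop per]) (use edgeXY in blast)+
qed

section \<open>Satisfaction in the term model, read over the ring\<close>

lemma memZ_emb: "memZ (emb a) Z \<longleftrightarrow> vmem a Z"
  unfolding memZ_def by auto

lemma emb_cases: "0 \<le> z \<Longrightarrow> \<exists>x. z = emb x"
  using nonneg_emb by metis

lemma emb_pred: "emb x \<le> emb t - 1 \<longleftrightarrow> x \<le> t \<and> x \<noteq> t"
proof -
  have "emb x \<le> emb t - 1 \<longleftrightarrow> emb x < emb t"
    using vint.less_iff_le[of "emb x" "emb t"] by (simp add: le_diff_eq)
  then show ?thesis by (auto simp: less_le)
qed

lemma ball_emb: "(\<forall>z\<in>{0..emb t - 1}. P z) \<longleftrightarrow> (\<forall>x. x \<le> t \<and> x \<noteq> t \<longrightarrow> P (emb x))"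
  using emb_pred emb_cases by fastforce

lemma bex_emb: "(\<exists>z\<in>{0..emb t}. P z) \<longleftrightarrow> (\<exists>x\<le>t. P (emb x))"
  using emb_cases by fastforce

lemma zpair_emb: "zpair (emb x) (emb y) = emb ((x + y) * (x + y + 1) + (1 + 1) * y)"
  unfolding zpair_def by (simp only: emb_simps)

lemma evT_pair: "emb (evT vlen e E (pair s t)) = zpair (emb (evT vlen e E s)) (emb (evT vlen e E t))"
  unfolding zpair_emb pair_def by (simp only: evT.simps)

lemma emb_succ: "emb a = emb b + 1 \<longleftrightarrow> a = b + 1"
  using emb_simps(6)[of a "b + 1"] by simp

lemma zentry_emb: "zentry Z (emb i) (emb e) \<longleftrightarrow>
    ((e \<le> vlen Z \<and> e \<noteq> vlen Z) \<and> memZ (zpair (emb i) (emb e)) Z \<and>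
      (\<forall>z. z \<le> e \<and> z \<noteq> e \<longrightarrow> \<not> memZ (zpair (emb i) (emb z)) Z)) \<or>
    (e = vlen Z \<and> (\<forall>z. z \<le> vlen Z \<and> z \<noteq> vlen Z \<longrightarrow> \<not> memZ (zpair (emb i) (emb z)) Z))"
  unfolding zentry_def ball_emb by (simp add: less_le)

lemma sat_entry:
  "satV e E (entry Z i t) \<longleftrightarrow> zentry (E Z) (emb (evT vlen e E i)) (emb (evT vlen e E t))"
  unfolding zentry_emb entry_def by (simp add: memZ_emb[symmetric] evT_pair)

lemma zentry_bound: "zentry Z k e \<Longrightarrow> e \<le> emb (vlen Z)"
  unfolding zentry_def by auto

lemma zpair_bounds: "0 \<le> x \<Longrightarrow> 0 \<le> y \<Longrightarrow> x \<le> zpair x y" "0 \<le> x \<Longrightarrow> 0 \<le> y \<Longrightarrow> y \<le> zpair x y"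
  unfolding zpair_def distrib_right mult_1_left
  using mult_nonneg_nonneg[of x "x + y + 1"] mult_nonneg_nonneg[of y "x + y + 1"]
    mult_nonneg_nonneg[of x "x + y"] mult_nonneg_nonneg[of y "x + y"]
  by (auto simp: distrib_left)

text \<open>A pair is at least as large as its components, and an entry is at most the length. So
  the bounds \<open>Len Z\<close> on quantifiers over end points exclude none of them.\<close>

lemma zentry_pair_bounds:
  assumes "zentry Z k (zpair (emb p) (emb q))" shows "p \<le> vlen Z" "q \<le> vlen Z"
proof -
  have "emb p \<le> emb (vlen Z)" "emb q \<le> emb (vlen Z)"
    using order.trans[OF zpair_bounds(1) zentry_bound[OF assms]] order.trans[OF zpair_bounds(2) zentry_bound[OF assms]]
    by simp_all
  then show "p \<le> vlen Z" "q \<le> vlen Z" by simp_all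
qed

lemma sat_grid_edge:
  "satV e E (grid_edge n p q) \<longleftrightarrow> (\<exists>x\<in>{0..emb (evT vlen e E n)}. \<exists>y\<in>{0..emb (evT vlen e E n)}.
    \<exists>x'\<in>{0..emb (evT vlen e E n)}. \<exists>y'\<in>{0..emb (evT vlen e E n)}.
    emb (evT vlen e E p) = zpair x y \<and> emb (evT vlen e E q) = zpair x' y' \<and> grid_adj x y x' y')"
  unfolding bex_emb grid_edge_def zpair_emb grid_adj_def
  by (simp add: differ_by_one_def pair_def emb_succ conj_disj_distribL del: emb_simps(3,4) cong: conj_cong)
    (simp add: ac_simps)


lemma sat_edge_seq:
  assumes "satV e E (edge_seq n t Z)" "0 \<le> k" "k < emb (evT vlen e E t)"
  shows "\<exists>x\<in>{0..emb (evT vlen e E n)}. \<exists>y\<in>{0..emb (evT vlen e E n)}. \<exists>x'\<in>{0..emb (evT vlen e E n)}.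
    \<exists>y'\<in>{0..emb (evT vlen e E n)}. zedge (E Z) k x y x' y' \<and> grid_adj x y x' y'"
proof -
  obtain i where i: "k = emb i" using emb_cases assms(2) by blast
  have "i \<le> evT vlen e E t \<and> i \<noteq> evT vlen e E t" using assms(3) i by (simp add: less_le)
  with assms(1) obtain p q where "zentry (E Z) k (zpair (emb p) (emb q))"
     "satV (case_nat q (case_nat p (case_nat i e))) E (grid_edge (up 3 n) (V 1) (V 0))"
    unfolding edge_seq_def by (auto simp: sat_entry evT_pair i numeral_2_eq_2)
  then show ?thesis unfolding sat_grid_edge zedge_def by simp metis
qed

lemma sat_chain:
  assumes "satV e E (chain t Z)" "0 \<le> k" "k < emb (evT vlen e E t)" "0 \<le> l" "l < emb (evT vlen e E t)"
    and pq: "0 \<le> p" "0 \<le> q" "0 \<le> u" "0 \<le> v"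
    and ent: "zentry (E Z) k (zpair p q)" "zentry (E Z) l (zpair u v)"
  shows "(l = k + 1 \<longrightarrow> q = u) \<and> (k \<noteq> l \<longrightarrow> p \<noteq> u)"
proof -
  obtain i where i: "k = emb i" using emb_cases assms(2) by blast
  obtain j where j: "l = emb j" using emb_cases assms(4) by blast
  obtain p' q' u' v' where e: "p = emb p'" "q = emb q'" "u = emb u'" "v = emb v'" using emb_cases pq by metis
  have ij: "i \<le> evT vlen e E t \<and> i \<noteq> evT vlen e E t" "j \<le> evT vlen e E t \<and> j \<noteq> evT vlen e E t"
    using assms(3,5) i j by (simp_all add: less_le)
  have b: "p' \<le> vlen (E Z)" "q' \<le> vlen (E Z)" "u' \<le> vlen (E Z)" "v' \<le> vlen (E Z)"
    using zentry_pair_bounds ent unfolding e by blast+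
  from assms(1)[unfolded chain_def sat_bounded, rule_format, of i j p' q' u' v'] ij b ent
  show ?thesis unfolding e i j
    by (simp add: sat_entry evT_pair numeral_eq_Suc emb_succ del: emb_simps(3,4))
qed

lemma sat_closed:
  assumes "satV e E (closed_curve t Z)"
  shows "satV e E (chain t Z)" "4 \<le> emb (evT vlen e E t)"
    "\<exists>p\<ge>0. \<exists>q\<ge>0. \<exists>r\<ge>0. zentry (E Z) (emb (evT vlen e E t) - 1) (zpair p q) \<and> zentry (E Z) 0 (zpair q r)"
proof -
  show "satV e E (chain t Z)" using assms unfolding closed_curve_def by simp
  have "1 + 1 + 1 + 1 \<le> evT vlen e E t" using assms unfolding closed_curve_def sat_connectives by (simp only: sat.simps evT.simps)
  then have "emb (1 + 1 + 1 + 1) \<le> emb (evT vlen e E t)" by (rule iffD2[OF emb_simps(5)])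
  then show "4 \<le> emb (evT vlen e E t)" unfolding emb_simps(2,3) by simp
  from assms obtain i p q r where "i + 1 = evT vlen e E t"
    "zentry (E Z) (emb i) (zpair (emb p) (emb q))" "zentry (E Z) (emb 0) (zpair (emb q) (emb r))"
    unfolding closed_curve_def by (auto simp: sat_entry evT_pair numeral_eq_Suc)
  moreover from this(1) have "emb (evT vlen e E t) - 1 = emb i" using emb_simps(3)[of i 1] by simp
  ultimately show "\<exists>p\<ge>0. \<exists>q\<ge>0. \<exists>r\<ge>0. zentry (E Z) (emb (evT vlen e E t) - 1) (zpair p q) \<and> zentry (E Z) 0 (zpair q r)"
    using emb_nonneg emb_simps(1) by metis
qed

lemma sat_connects:
  assumes "satV e E (connects t Z p1 p2)"
  shows "satV e E (chain t Z)" "1 \<le> emb (evT vlen e E t)"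
    "\<exists>r\<ge>0. zentry (E Z) 0 (zpair (emb (evT vlen e E p1)) r)"
    "\<exists>r\<ge>0. zentry (E Z) (emb (evT vlen e E t) - 1) (zpair r (emb (evT vlen e E p2)))"
proof -
  show "satV e E (chain t Z)" using assms unfolding connects_def by simp
  from assms obtain i r r' where i: "i + 1 = evT vlen e E t"
    and ent: "zentry (E Z) 0 (zpair (emb (evT vlen e E p1)) (emb r))"
    "zentry (E Z) (emb i) (zpair (emb r') (emb (evT vlen e E p2)))"
    unfolding connects_def by (auto simp: sat_entry evT_pair)
  have s: "emb (evT vlen e E t) = emb i + 1" using i emb_simps(3)[of i 1] by simp
  show "1 \<le> emb (evT vlen e E t)" using s emb_nonneg[of i] by simp
  show "\<exists>r\<ge>0. zentry (E Z) 0 (zpair (emb (evT vlen e E p1)) r)" using ent(1) emb_nonneg by metis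
  have "emb (evT vlen e E t) - 1 = emb i" using s by simp
  then show "\<exists>r\<ge>0. zentry (E Z) (emb (evT vlen e E t) - 1) (zpair r (emb (evT vlen e E p2)))" using ent(2) emb_nonneg by metis
qed

definition has_degree :: "vint \<Rightarrow> nat \<Rightarrow> vint \<Rightarrow> bool" where
  "has_degree t Z p \<longleftrightarrow> (\<exists>u\<ge>0. \<exists>k\<ge>0. k < t \<and> (zentry Z k (zpair p u) \<or> zentry Z k (zpair u p)))"

lemma sat_has_edge:
  "satV e E (has_edge t Z p u) \<longleftrightarrow> (\<exists>i. (i \<le> evT vlen e E t \<and> i \<noteq> evT vlen e E t) \<and>
     (zentry (E Z) (emb i) (zpair (emb (evT vlen e E p)) (emb (evT vlen e E u))) \<or>
      zentry (E Z) (emb i) (zpair (emb (evT vlen e E u)) (emb (evT vlen e E p)))))"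
  unfolding has_edge_def by (simp add: sat_entry evT_pair)

lemma sat_degree_ge1:
  "satV e E (degree_ge1 t Z p) \<longleftrightarrow> has_degree (emb (evT vlen e E t)) (E Z) (emb (evT vlen e E p))"
proof
  assume "satV e E (degree_ge1 t Z p)"
  then obtain u i where "i \<le> evT vlen e E t \<and> i \<noteq> evT vlen e E t"
     "zentry (E Z) (emb i) (zpair (emb (evT vlen e E p)) (emb u)) \<or>
      zentry (E Z) (emb i) (zpair (emb u) (emb (evT vlen e E p)))"
    unfolding degree_ge1_def by (auto simp: sat_has_edge)
  moreover from this(1) have "emb i < emb (evT vlen e E t)" by (simp add: less_le)
  ultimately show "has_degree (emb (evT vlen e E t)) (E Z) (emb (evT vlen e E p))"
    unfolding has_degree_def using emb_nonneg by metis
next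
  assume "has_degree (emb (evT vlen e E t)) (E Z) (emb (evT vlen e E p))"
  then obtain u k where uk: "0 \<le> u" "0 \<le> k" "k < emb (evT vlen e E t)"
    "zentry (E Z) k (zpair (emb (evT vlen e E p)) u) \<or> zentry (E Z) k (zpair u (emb (evT vlen e E p)))"
    unfolding has_degree_def by blast
  obtain u' i where e: "u = emb u'" "k = emb i" using emb_cases uk by metis
  have "u' \<le> vlen (E Z)" using uk(4) zentry_pair_bounds unfolding e by blast
  then show "satV e E (degree_ge1 t Z p)"
    using uk(3,4) unfolding e degree_ge1_def by (auto simp: sat_has_edge less_le)
qed

lemma sat_degree_eq2:
  "satV e E (degree_eq2 t Z p) \<Longrightarrow> has_degree (emb (evT vlen e E t)) (E Z) (emb (evT vlen e E p))"
  unfolding sat_degree_ge1[symmetric] degree_eq2_def degree_ge1_def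
  by (auto simp: sat_has_edge numeral_eq_Suc evT_up)

lemma sat_different_sides:
  assumes "satV e E (different_sides n t Z p1 p2)"
  defines "N \<equiv> emb (evT vlen e E n)" and "T \<equiv> emb (evT vlen e E t)"
  shows "\<exists>x\<in>{0..N}. \<exists>y1\<in>{0..N}. \<exists>y2\<in>{0..N}. \<exists>y\<in>{0..N}.
    emb (evT vlen e E p1) = zpair x y1 \<and> emb (evT vlen e E p2) = zpair x y2 \<and>
    (y1 = y2 + 2 \<or> y2 = y1 + 2) \<and> y + y = y1 + y2 \<and>
    \<not> has_degree T (E Z) (zpair x y1) \<and> \<not> has_degree T (E Z) (zpair x y2) \<and> has_degree T (E Z) (zpair x y)"
proof -
  from assms(1) obtain x y1 y2 y where b: "x \<le> evT vlen e E n" "y1 \<le> evT vlen e E n" "y2 \<le> evT vlen e E n" "y \<le> evT vlen e E n"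
    and s: "satV (case_nat y (case_nat y2 (case_nat y1 (case_nat x e)))) E
      (up 4 p1 \<^bold>= pair (V 3) (V 2) \<^bold>\<and> up 4 p2 \<^bold>= pair (V 3) (V 1) \<^bold>\<and>
       (V 2 \<^bold>= V 1 \<^bold>+ (\<^bold>1 \<^bold>+ \<^bold>1) \<^bold>\<or> V 1 \<^bold>= V 2 \<^bold>+ (\<^bold>1 \<^bold>+ \<^bold>1)) \<^bold>\<and>
       V 0 \<^bold>+ V 0 \<^bold>= V 2 \<^bold>+ V 1 \<^bold>\<and>
       degree_eq0 (up 4 t) Z (up 4 p1) \<^bold>\<and> degree_eq0 (up 4 t) Z (up 4 p2) \<^bold>\<and>
       degree_eq2 (up 4 t) Z (pair (V 3) (V 0)))"
    unfolding different_sides_def sat_bounded by auto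
  let ?e = "case_nat y (case_nat y2 (case_nat y1 (case_nat x e)))"
  have v: "evT vlen ?e E (V 0) = y" "evT vlen ?e E (V 1) = y2" "evT vlen ?e E (V 2) = y1" "evT vlen ?e E (V 3) = x"
    by simp_all
  have "evT vlen ?e E (up 4 p1) = evT vlen ?e E (pair (V 3) (V 2))" "evT vlen ?e E (up 4 p2) = evT vlen ?e E (pair (V 3) (V 1))"
    using s unfolding sat_connectives sat.simps by blast+
  then have "emb (evT vlen e E p1) = emb (evT vlen ?e E (pair (V 3) (V 2)))" "emb (evT vlen e E p2) = emb (evT vlen ?e E (pair (V 3) (V 1)))"
    by (simp_all only: evT_up_simps)
  then have p: "emb (evT vlen e E p1) = zpair (emb x) (emb y1)" "emb (evT vlen e E p2) = zpair (emb x) (emb y2)"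
    unfolding evT_pair v .
  have y: "emb y1 = emb y2 + 2 \<or> emb y2 = emb y1 + 2" "emb y + emb y = emb y1 + emb y2"
  proof -
    have "y1 = y2 + (1 + 1) \<or> y2 = y1 + (1 + 1)" and 2: "y + y = y1 + y2"
      using s unfolding sat_connectives sat.simps evT.simps(3,4) v by blast+
    then have "emb y1 = emb (y2 + (1 + 1)) \<or> emb y2 = emb (y1 + (1 + 1))" by blast
    then show "emb y1 = emb y2 + 2 \<or> emb y2 = emb y1 + 2" unfolding emb_simps by simp
    from 2 have "emb (y + y) = emb (y1 + y2)" by simp
    then show "emb y + emb y = emb y1 + emb y2" unfolding emb_simps .
  qed
  have "\<not> satV ?e E (degree_ge1 (up 4 t) Z (up 4 p1))" "\<not> satV ?e E (degree_ge1 (up 4 t) Z (up 4 p2))"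
    using s unfolding sat_connectives degree_eq0_def by blast+
  then have d: "\<not> has_degree T (E Z) (zpair (emb x) (emb y1))" "\<not> has_degree T (E Z) (zpair (emb x) (emb y2))"
    unfolding sat_degree_ge1 evT_up_simps p T_def .
  have "satV ?e E (degree_eq2 (up 4 t) Z (pair (V 3) (V 0)))" using s unfolding sat_connectives by blast
  from sat_degree_eq2[OF this] have "has_degree T (E Z) (zpair (emb x) (emb y))"
    unfolding evT_pair T_def v by simp
  then show ?thesis unfolding N_def bex_emb using b p y d by blast
qed

lemma sat_intersect:
  assumes "has_degree (emb (evT vlen e E s)) (E R) (zpair x y)" "has_degree (emb (evT vlen e E t)) (E B) (zpair x y)"
    and "x \<in> {0..emb (evT vlen e E n)}" "y \<in> {0..emb (evT vlen e E n)}"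
  shows "satV e E (intersect n s R t B)"
proof -
  obtain a b where ab: "x = emb a" "y = emb b" using assms(3,4) emb_cases[of x] emb_cases[of y] by auto
  then have "a \<le> evT vlen e E n" "b \<le> evT vlen e E n" using assms(3,4) by auto
  then show ?thesis
    using assms(1,2) unfolding intersect_def ab sat_bounded sat_connectives sat_degree_ge1 evT_pair
    by simp blast
qed


lemma open_curve_path:
  assumes n: "0 \<le> n" and s: "1 \<le> s"
    and edge: "\<And>k. 0 \<le> k \<Longrightarrow> k < s \<Longrightarrow> \<exists>x\<in>{0..n}. \<exists>y\<in>{0..n}. \<exists>x'\<in>{0..n}. \<exists>y'\<in>{0..n}. zedge Z k x y x' y' \<and> grid_adj x y x' y'"
    and next_edge: "\<And>k x y x' y' u v u' v'. 0 \<le> k \<Longrightarrow> k + 1 < s \<Longrightarrow> zedge Z k x y x' y' \<Longrightarrow> zedge Z (k + 1) u v u' v' \<Longrightarrow>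
      {x, y, x', y', u, v, u', v'} \<subseteq> {0..n} \<Longrightarrow> x' = u \<and> y' = v"
  shows "\<exists>X Y. FZ (\<lambda>e. X (e 0)) \<and> FZ (\<lambda>e. Y (e 0)) \<and> (\<forall>k. 0 \<le> X k \<and> X k \<le> n) \<and> (\<forall>k. 0 \<le> Y k \<and> Y k \<le> n) \<and>
    (\<forall>k\<ge>0. k < s \<longrightarrow> zedge Z k (X k) (Y k) (X (k + 1)) (Y (k + 1)) \<and> grid_adj (X k) (Y k) (X (k + 1)) (Y (k + 1)))"
proof -
  \<comment> \<open>Point \<open>k\<close> is the start of edge \<open>k\<close>; no edge starts at
    the last point \<open>s\<close>, which is taken as the end of edge \<open>s - 1\<close>.\<close>
  define Q where "Q k x y \<longleftrightarrow> (\<exists>x'\<in>{0..n}. \<exists>y'\<in>{0..n}.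
     (0 \<le> k \<and> k < s \<and> zedge Z k x y x' y') \<or> (k = s \<and> zedge Z (s - 1) x' y' x y))" for k x y
  have DQ: "DZ (\<lambda>e. Q (e 0) (e 1) (e 2))" unfolding Q_def by (intro vint.dfn DZ_zedge)
  have fun_Q: "x = x' \<and> y = y'" if "Q k x y" "Q k x' y'" "{x, y, x', y'} \<subseteq> {0..n}" for k x y x' y'
  proof -
    from that(1) obtain a b where a: "a \<in> {0..n}" "b \<in> {0..n}"
      "(k < s \<and> zedge Z k x y a b) \<or> (k = s \<and> zedge Z (s - 1) a b x y)"
      unfolding Q_def by blast
    from that(2) obtain c d where c: "c \<in> {0..n}" "d \<in> {0..n}"
      "(k < s \<and> zedge Z k x' y' c d) \<or> (k = s \<and> zedge Z (s - 1) c d x' y')"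
      unfolding Q_def by blast
    show ?thesis
    proof (cases "k = s")
      case True
      then have "zedge Z (s - 1) a b x y" "zedge Z (s - 1) c d x' y'" using a(3) c(3) by auto
      from zedge_fun[OF this] show ?thesis using that(3) a(1,2) c(1,2) by simp
    next
      case False
      then have "zedge Z k x y a b" "zedge Z k x' y' c d" using a(3) c(3) by auto
      from zedge_fun[OF this] show ?thesis using that(3) a(1,2) c(1,2) by simp
    qed
  qed
  have "\<exists>X Y. FZ (\<lambda>e. X (e 0)) \<and> FZ (\<lambda>e. Y (e 0)) \<and> (\<forall>k. 0 \<le> X k \<and> X k \<le> n) \<and> (\<forall>k. 0 \<le> Y k \<and> Y k \<le> n) \<and>
    (\<forall>k x y. Q k x y \<and> x \<in> {0..n} \<and> y \<in> {0..n} \<longrightarrow> X k = x \<and> Y k = y)"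
    by (rule coordinate_functions[OF DQ n]) (rule fun_Q)
  then obtain X Y where XY: "FZ (\<lambda>e. X (e 0))" "FZ (\<lambda>e. Y (e 0))" "\<forall>k. 0 \<le> X k \<and> X k \<le> n" "\<forall>k. 0 \<le> Y k \<and> Y k \<le> n"
    and q: "\<And>k x y. Q k x y \<Longrightarrow> x \<in> {0..n} \<Longrightarrow> y \<in> {0..n} \<Longrightarrow> X k = x \<and> Y k = y"
    by blast
  have edgeXY: "zedge Z k (X k) (Y k) (X (k + 1)) (Y (k + 1)) \<and> grid_adj (X k) (Y k) (X (k + 1)) (Y (k + 1))"
    if k: "0 \<le> k" "k < s" for k
  proof -
    from edge[OF k] obtain x y a b where e: "x \<in> {0..n}" "y \<in> {0..n}" "a \<in> {0..n}" "b \<in> {0..n}"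
      "zedge Z k x y a b" "grid_adj x y a b" by blast
    have "Q k x y" unfolding Q_def using e k by blast
    then have 1: "X k = x \<and> Y k = y" using q e by blast
    have 2: "X (k + 1) = a \<and> Y (k + 1) = b"
    proof (cases "k + 1 < s")
      case True
      have k1: "0 \<le> k + 1" using k by simp
      from edge[OF this True] obtain c d c' d' where c: "c \<in> {0..n}" "d \<in> {0..n}" "c' \<in> {0..n}" "d' \<in> {0..n}"
        "zedge Z (k + 1) c d c' d'" by blast
      have "Q (k + 1) c d" unfolding Q_def using c k1 True by blast
      moreover have "a = c \<and> b = d" using next_edge[OF k(1) True e(5) c(5)] e c by simp
      ultimately show ?thesis using q e by blast
    next
      case False
      then have "k + 1 = s" using k(2) vint.less_iff_le[of k s] by auto
      then have ks: "k + 1 = s" "s - 1 = k" by auto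
      have "Q s a b" unfolding Q_def ks(2) using e by blast
      then show ?thesis unfolding ks(1) using q e by blast
    qed
    show ?thesis using e(5,6) 1 2 by simp
  qed
  show ?thesis using XY edgeXY by blast
qed

lemma jordan_curve_sat: "satV e E (jordan_curve_seq n t B s R p1 p2)"
  unfolding jordan_curve_seq_def sat.simps sat_connectives
proof (intro impI, elim conjE, rule ccontr)
  let ?n = "emb (evT vlen e E n)" and ?t = "emb (evT vlen e E t)" and ?s = "emb (evT vlen e E s)"
  assume eB: "satV e E (edge_seq n t B)" and cB: "satV e E (closed_curve t B)"
    and ds: "satV e E (different_sides n t B p1 p2)"
    and eR: "satV e E (edge_seq n s R)" and cR: "satV e E (connects s R p1 p2)"
    and no: "\<not> satV e E (intersect n s R t B)"
  have n: "0 \<le> ?n" by simp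
  have next_edge: "x' = u \<and> y' = v" if "satV e E (chain c Z)" "0 \<le> k" "k + 1 < emb (evT vlen e E c)"
    "zedge (E Z) k x y x' y'" "zedge (E Z) (k + 1) u v u' v'" "{x, y, x', y', u, v, u', v'} \<subseteq> {0..?n}"
    for c Z k x y x' y' u v u' v'
  proof -
    have k: "k < emb (evT vlen e E c)" "0 \<le> k + 1" using that(2,3) zero_less_one[where 'a=vint] by linarith+
    have b: "0 \<le> zpair x y" "0 \<le> zpair x' y'" "0 \<le> zpair u v" "0 \<le> zpair u' v'"
      using that(6) by (auto intro!: zpair_nonneg)
    from sat_chain[OF that(1,2) k that(3) b that(4,5)[unfolded zedge_def]] have "zpair x' y' = zpair u v" by simp
    then show ?thesis by (intro zpair_inj) (use that(6) in auto)
  qed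
  note cl = sat_closed[OF cB] and co = sat_connects[OF cR]
  from sat_different_sides[OF ds] obtain x y1 y2 y where xy: "x \<in> {0..?n}" "y1 \<in> {0..?n}" "y2 \<in> {0..?n}" "y \<in> {0..?n}"
    and p: "emb (evT vlen e E p1) = zpair x y1" "emb (evT vlen e E p2) = zpair x y2"
    and yy: "y1 = y2 + 2 \<or> y2 = y1 + 2" "y + y = y1 + y2"
    and deg: "\<not> has_degree ?t (E B) (zpair x y1)" "\<not> has_degree ?t (E B) (zpair x y2)" "has_degree ?t (E B) (zpair x y)"
    by blast
  have y12: "(y1 = y - 1 \<and> y2 = y + 1) \<or> (y1 = y + 1 \<and> y2 = y - 1)"
    using yy by (elim disjE) (rule disjI2, simp, rule disjI1, simp)
  have "\<exists>X Y. FZ (\<lambda>e. X (e 0)) \<and> FZ (\<lambda>e. Y (e 0)) \<and> (\<forall>k. 0 \<le> X k \<and> X k \<le> ?n) \<and> (\<forall>k. 0 \<le> Y k \<and> Y k \<le> ?n) \<and>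
    (\<forall>k\<ge>0. k < ?s \<longrightarrow> zedge (E R) k (X k) (Y k) (X (k + 1)) (Y (k + 1)) \<and> grid_adj (X k) (Y k) (X (k + 1)) (Y (k + 1)))"
    by (rule open_curve_path[OF n co(2) sat_edge_seq[OF eR] next_edge[OF co(1)]])
  then obtain X2 Y2 where FR: "FZ (\<lambda>e. X2 (e 0))" "FZ (\<lambda>e. Y2 (e 0))" and b2: "\<And>k. 0 \<le> X2 k \<and> X2 k \<le> ?n" "\<And>k. 0 \<le> Y2 k \<and> Y2 k \<le> ?n"
    and edgeR: "\<And>k. 0 \<le> k \<Longrightarrow> k < ?s \<Longrightarrow> zedge (E R) k (X2 k) (Y2 k) (X2 (k + 1)) (Y2 (k + 1)) \<and> grid_adj (X2 k) (Y2 k) (X2 (k + 1)) (Y2 (k + 1))"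
    by blast
  have s0: "0 < ?s" "0 \<le> ?s - 1" "?s - 1 < ?s" "?s - 1 + 1 = ?s" using co(2) zero_less_one[where 'a=vint] by (linarith, linarith, linarith, simp)
  have pos2: "0 \<le> zpair (X2 k) (Y2 k)" for k using b2 by (simp add: zpair_nonneg)
  have start: "X2 0 = x \<and> Y2 0 = y1"
  proof -
    obtain r where r: "0 \<le> r" "zentry (E R) 0 (zpair (zpair x y1) r)" using co(3) unfolding p by blast
    have "zentry (E R) 0 (zpair (zpair (X2 0) (Y2 0)) (zpair (X2 (0+1)) (Y2 (0+1))))"
      using edgeR[OF order.refl s0(1)] unfolding zedge_def by blast
    from zpair_inj[OF pos2 pos2 _ r(1) zentry_fun[OF this r(2)]] have "zpair (X2 0) (Y2 0) = zpair x y1"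
      using xy by (simp add: zpair_nonneg)
    then show ?thesis by (intro zpair_inj) (use b2 xy in auto)
  qed
  have stop: "X2 ?s = x \<and> Y2 ?s = y2"
  proof -
    obtain r where r: "0 \<le> r" "zentry (E R) (?s - 1) (zpair r (zpair x y2))" using co(4) unfolding p by blast
    have "zentry (E R) (?s - 1) (zpair (zpair (X2 (?s - 1)) (Y2 (?s - 1))) (zpair (X2 ?s) (Y2 ?s)))"
      using edgeR[OF s0(2,3)] unfolding zedge_def s0(4) by blast
    from zpair_inj[OF pos2 pos2 r(1) _ zentry_fun[OF this r(2)]] have "zpair (X2 ?s) (Y2 ?s) = zpair x y2"
      using xy by (simp add: zpair_nonneg)
    then show ?thesis by (intro zpair_inj) (use b2 xy in auto)
  qed
  have degR: "has_degree ?s (E R) (zpair (X2 k) (Y2 k))" if k: "0 \<le> k" "k \<le> ?s" for k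
  proof (cases "k = ?s")
    case True
    show ?thesis using edgeR[OF s0(2,3)] pos2 s0(2,3) unfolding True has_degree_def zedge_def s0(4) by blast
  next
    case False
    then have "k < ?s" using k by simp
    then show ?thesis using edgeR[OF k(1)] pos2 k(1) unfolding has_degree_def zedge_def by blast
  qed
  show False
  proof (rule closed_curve_loop[OF n cl(2) sat_edge_seq[OF eB] next_edge[OF cl(1)]])
    fix k l a b a' b' u v u' v'
    assume k: "0 \<le> k" "k < ?t" "0 \<le> l" "l < ?t" "k \<noteq> l" and z: "zedge (E B) k a b a' b'" "zedge (E B) l u v u' v'"
      and bd: "{a, b, a', b', u, v, u', v'} \<subseteq> {0..?n}"
    have "0 \<le> zpair a b" "0 \<le> zpair a' b'" "0 \<le> zpair u v" "0 \<le> zpair u' v'"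
      using bd by (auto intro!: zpair_nonneg)
    from sat_chain[OF cl(1) k(1-4) this z[unfolded zedge_def]] k(5) show "\<not> (a = u \<and> b = v)" by blast
  next
    fix a b a' b' u v u' v'
    assume z: "zedge (E B) (?t - 1) a b a' b'" "zedge (E B) 0 u v u' v'"
      and bd: "{a, b, a', b', u, v, u', v'} \<subseteq> {0..?n}"
    have pos: "0 \<le> zpair a b" "0 \<le> zpair a' b'" "0 \<le> zpair u v" "0 \<le> zpair u' v'"
      using bd by (auto intro!: zpair_nonneg)
    from cl(3) obtain p q r where r: "0 \<le> p" "0 \<le> q" "0 \<le> r" "zentry (E B) (?t - 1) (zpair p q)" "zentry (E B) 0 (zpair q r)" by blast
    have "zpair a' b' = q" using zpair_inj[OF pos(1,2) r(1,2)] zentry_fun[OF z(1)[unfolded zedge_def] r(4)] by blast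
    moreover have "zpair u v = q" using zpair_inj[OF pos(3,4) r(2,3)] zentry_fun[OF z(2)[unfolded zedge_def] r(5)] by blast
    ultimately have "zpair a' b' = zpair u v" by simp
    then show "a' = u \<and> b' = v" by (intro zpair_inj) (use bd in auto)
  next
    fix X Y
    assume FB: "FZ (\<lambda>e. X (e 0))" "FZ (\<lambda>e. Y (e 0))" and b1: "\<And>k. 0 \<le> X k \<and> X k \<le> ?n" "\<And>k. 0 \<le> Y k \<and> Y k \<le> ?n"
      and loop: "loop_on X Y 0 (2 * ?t) ?t"
      and per: "\<And>k. 0 \<le> k \<Longrightarrow> k \<le> ?t \<Longrightarrow> X (k + ?t) = X k \<and> Y (k + ?t) = Y k"
      and edgeB: "\<And>k. 0 \<le> k \<Longrightarrow> k < ?t \<Longrightarrow> zedge (E B) k (X k) (Y k) (X (k + 1)) (Y (k + 1))"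
    have t4: "4 \<le> ?t" by (rule cl(2))
    have pos1: "0 \<le> zpair (X k) (Y k)" for k using b1 by (simp add: zpair_nonneg)
    have deg_low: "has_degree ?t (E B) (zpair (X k) (Y k))" if "0 \<le> k" "k < ?t" for k
      using edgeB[OF that] pos1 that unfolding has_degree_def zedge_def by blast
    have deg_mid: "has_degree ?t (E B) (zpair (X k) (Y k))" if k: "0 \<le> k" "k \<le> ?t" for k
    proof (cases "k = ?t")
      case True
      have "X ?t = X 0 \<and> Y ?t = Y 0" using per[of 0] t4 by simp
      then show ?thesis unfolding True using deg_low[of 0] t4 by simp
    next
      case False then show ?thesis using deg_low k by simp
    qed
    have degB: "has_degree ?t (E B) (zpair (X k) (Y k))" if k: "0 \<le> k" "k \<le> 2 * ?t" for k
    proof (cases "k \<le> ?t")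
      case True then show ?thesis using deg_mid k by simp
    next
      case False
      then have j: "0 \<le> k - ?t" "k - ?t \<le> ?t" using k by auto
      have "X k = X (k - ?t) \<and> Y k = Y (k - ?t)" using per[OF j] by simp
      then show ?thesis using deg_mid[OF j] by simp
    qed
    \<comment> \<open>Every point of either path lies on one of its edges, so a common point has
      positive degree in both sequences and makes them intersect.\<close>
    have dj: "disjoint_on X Y 0 (2 * ?t) X2 Y2 0 ?s" unfolding disjoint_on_def
    proof (intro ballI notI)
      fix k l assume k: "k \<in> {0..2 * ?t}" and l: "l \<in> {0..?s}" and eq: "X k = X2 l \<and> Y k = Y2 l"
      have "has_degree ?s (E R) (zpair (X k) (Y k))" using degR[of l] l eq by simp
      moreover have "has_degree ?t (E B) (zpair (X k) (Y k))" using degB[of k] k by simp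
      ultimately have "satV e E (intersect n s R t B)" by (rule sat_intersect) (use b1 in auto)
      with no show False ..
    qed
    have off: "\<not> (X k = x \<and> Y k = y - 1)" "\<not> (X k = x \<and> Y k = y + 1)" if "0 \<le> k" "k \<le> 2 * ?t" for k
      using degB[OF that] deg(1,2) y12 by auto
    \<comment> \<open>An index at which the curve visits the midpoint of \<open>p1\<close> and
      \<open>p2\<close>. With the help of the period it is chosen at least 1, so that
      \<open>j - 1\<close> is an index as well.\<close>
    obtain j where j: "1 \<le> j" "j \<le> ?t" "X j = x" "Y j = y"
    proof -
      from deg(3) obtain u k where u: "0 \<le> u" "0 \<le> k" "k < ?t"
        "zentry (E B) k (zpair (zpair x y) u) \<or> zentry (E B) k (zpair u (zpair x y))"
        unfolding has_degree_def by blast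
      have ent: "zentry (E B) k (zpair (zpair (X k) (Y k)) (zpair (X (k + 1)) (Y (k + 1))))"
        using edgeB[OF u(2,3)] unfolding zedge_def .
      have xy0: "0 \<le> x" "0 \<le> y" "0 \<le> zpair x y" using xy by (auto simp: zpair_nonneg)
      from u(4) show thesis
      proof
        assume "zentry (E B) k (zpair (zpair x y) u)"
        from zpair_inj[OF pos1 pos1 xy0(3) u(1) zentry_fun[OF ent this]] have "zpair (X k) (Y k) = zpair x y" ..
        then have XYk: "X k = x \<and> Y k = y" by (intro zpair_inj) (use b1 xy0 in auto)
        show thesis
        proof (cases "k = 0")
          case True
          then have "X ?t = x \<and> Y ?t = y" using per[of 0] XYk t4 by simp
          then show thesis using that[of ?t] t4 by simp
        next
          case False
          then have "1 \<le> k" using vint_discrete[of k] u(2) by simp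
          then show thesis using that[of k] XYk u(3) by simp
        qed
      next
        assume "zentry (E B) k (zpair u (zpair x y))"
        from zpair_inj[OF pos1 pos1 u(1) xy0(3) zentry_fun[OF ent this]] have "zpair (X (k+1)) (Y (k+1)) = zpair x y" ..
        then have "X (k + 1) = x \<and> Y (k + 1) = y" by (intro zpair_inj) (use b1 xy0 in auto)
        then show thesis using that[of "k + 1"] u(2,3) vint.less_iff_le[of k ?t] by simp
      qed
    qed
    have jb: "0 \<le> j - 1" "j - 1 < 2 * ?t" "0 \<le> j" "j < 2 * ?t" "j - 1 \<le> 2 * ?t" "0 \<le> j + 1" "j + 1 \<le> 2 * ?t"
      "j - 1 < j + 1" "j + 1 < j - 1 + ?t" "j - 1 < ?t" "j - 1 + 1 = j"
      using j(1,2) t4 zero_less_one[where 'a=vint] by (linarith | simp)+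
    have path: "path_on X Y 0 (2 * ?t)" using loop unfolding loop_on_def by blast
    from vint.path_on_adj[OF path jb(1,2)] have "grid_adj (X (j - 1)) (Y (j - 1)) x y" unfolding jb(11) j(3,4) .
    \<comment> \<open>The vertical neighbours of the midpoint are \<open>p1\<close> and
      \<open>p2\<close>, which have degree 0, so the curve arrives and departs horizontally.\<close>
    then have prev: "Y (j - 1) = y \<and> (X (j - 1) = x + 1 \<or> X (j - 1) = x - 1)"
      using off[OF jb(1,5)] unfolding grid_adj_def by (auto simp: algebra_simps)
    from vint.path_on_adj[OF path jb(3,4)] have "grid_adj x y (X (j + 1)) (Y (j + 1))" unfolding j(3,4) .
    then have nxt: "Y (j + 1) = y \<and> (X (j + 1) = x + 1 \<or> X (j + 1) = x - 1)"
      using off[OF jb(6,7)] unfolding grid_adj_def by (auto simp: algebra_simps)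
    have "\<not> (X (j - 1) = X (j + 1) \<and> Y (j - 1) = Y (j + 1))"
      by (rule vint.loop_distinct[OF FB b1 loop jb(1,7,8,9)])
    \<comment> \<open>The two neighbours differ, so one of them is on the right. The curve thus
      crosses the line directly to the right of column \<open>x\<close> at height \<open>y\<close>,
      in step \<open>j\<close> or in step \<open>j - 1\<close>.\<close>
    then consider "X (j + 1) = x + 1" | "X (j - 1) = x + 1" using prev nxt by auto
    then obtain i where i: "0 \<le> i" "i < ?t" "crosses X x i" "Y i = y"
    proof cases
      case 1
      show thesis
      \<comment> \<open>\<open>path_meets_loop\<close> asks for a crossing before \<open>t\<close>;
        step \<open>t\<close> is replaced by step 0, which is the same by periodicity.\<close>
      proof (cases "j = ?t")
        case True
        have "X 0 = x" "Y 0 = y" using per[of 0] j t4 unfolding True by auto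
        moreover have "X (0 + 1) = x + 1" using per[of 1] 1 t4 unfolding True by (simp add: add.commute)
        ultimately show thesis using that[of 0] t4 by (simp add: crosses_def)
      next
        case False
        then show thesis using that[of j] j jb(3) 1 by (simp add: crosses_def)
      qed
    next
      case 2
      then show thesis using that[of "j - 1"] jb prev j by (simp add: crosses_def)
    qed
    have pi: "X (i + ?t) = X i" "Y (i + ?t) = Y i" "X (i + ?t + 1) = X (i + 1)"
      using per[of i] per[of "i + 1"] i(1,2) vint.less_iff_le[of i ?t] by (auto simp: ac_simps)
    have pathR: "path_on X2 Y2 0 ?s" unfolding path_on_def
      using edgeR vint.less_iff_le by (auto simp: le_diff_eq)
    show False
      by (rule vint.path_meets_loop[OF FB FR b1 loop i(1,2) pi i(3,4) _ pathR _ _ _ dj])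
        (use start stop y12 in auto)
  qed
qed

theorem mainTheorem2:
  shows "V0 \<^bold>\<turnstile>
    AllN (AllN (AllS (AllN (AllS (AllN (AllN
      (jordan_curve_seq (V 4) (V 3) 1 (V 2) 0 (V 1) (V 0))))))))"
  unfolding jordan_sentence_def[symmetric]
  by (rule term_model_complete) (simp only: jordan_sentence_def sat.simps jordan_curve_sat simp_thms)

end
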